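(* Let $(W,S)$ be a Coxeter system with Hecke algebra $\mathcal H$. Let $\mathscr I_0\subseteq W$ be a $W$-graph ideal with respect to $J\subseteq \mathrm{Pos}(\mathscr I_0)$, and let $C_0=\{c^0_w\mid w\in\mathscr I_0\}$ be the $W$-graph basis of the module $\mathscr S_0=\mathscr S(\mathscr I_0,J)$, with associated $W$-graph $\Gamma(\mathscr I_0)=(C_0,\mu,\tau)$. Suppose that $\mathscr I\subseteq\mathscr I_0$ is an ideal of $(W,\le_L)$ such that $\{c^0_w\mid w\in\mathscr I_0\setminus\mathscr I\}$ is a closed subset of $C_0$. Then $\mathscr I$ is a $W$-graph ideal with respect to $J$. Moreover, the $W$-graph corresponding to $(\mathscr I,J)$ is isomorphic to the full subgraph of $\Gamma(\mathscr I_0)$ on the vertex set $\{c^0_w\mid w\in\mathscr I\}\subseteq C_0$, with $\tau$ and $\mu$ functions inherited from $\Gamma(\mathscr I_0)$.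
   Context: **Hecke algebra.** $(W,S)$ is a Coxeter system with length function $l$, Bruhat order $\le$, and left weak order $\le_L$ ($u\le_L w$ iff $l(w)=l(wu^{-1})+l(u)$, i.e. $u$ is a suffix of $w$). $\mathcal A=\mathbb Z[q,q^{-1}]$, $\mathcal A^+=\mathbb Z[q]$. $\mathcal H$ is the associative $\mathcal A$-algebra generated by $T_s$ ($s\in S$) with $T_s^2=1+(q-q^{-1})T_s$ and the braid relations; it has $\mathcal A$-basis $(T_w)_{w\in W}$. The involution $a\mapsto\overline a$ of $\mathcal A$ with $\overline q=q^{-1}$ extends to a ring involution of $\mathcal H$ with $\overline{T_s}=T_s^{-1}$. **$W$-graphs.** A $W$-graph is a triple $\Gamma=(V,\mu,\tau)$, with $V$ a set, $\mu\colon V\times V\to\mathbb Z$, and $\tau$ a map from $V$ to the power set of $S$, such that the free $\mathcal A$-module on $V$ is an $\mathcal H$-module via $T_sv=-q^{-1}v$ if $s\in\tau(v)$ and $T_sv=qv+\sum_{u\in V,\,s\in\tau(u)}\mu(u,v)u$ if $s\notin\tau(v)$. A subset $U\subseteq V$ is closed if it spans an $\mathcal H$-submodule; equivalently, if $u\in U$, $v\in V$, $\tau(v)\nsubseteq\tau(u)$ and $\mu(v,u)\ne0$ imply $v\in U$. An isomorphism of $W$-graphs is a bijection of vertex sets preserving $\mu$ and $\tau$. **$W$-graph ideals.** For $J\subseteq S$, $D_J=\{w\in W\mid l(ws)>l(w)\text{ for all }s\in J\}$. For $X\subseteq W$, $\mathrm{Pos}(X)=\{s\in S\mid l(xs)>l(x)\text{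 for all }x\in X\}$. An ideal of $(W,\le_L)$ is a subset $\mathscr I\subseteq W$ containing every suffix of each of its elements. Let $\mathscr I$ be an ideal and $J\subseteq\mathrm{Pos}(\mathscr I)$ (so $\mathscr I\subseteq D_J$). For $w\in\mathscr I$ put $\mathrm{SA}(w)=\{s\in S\mid sw>w,\ sw\in\mathscr I\}$, $\mathrm{SD}(w)=\{s\in S\mid sw<w\}$, $\mathrm{WA}(w)=\{s\in S\mid sw>w,\ sw\in D_J\setminus\mathscr I\}$, $\mathrm{WD}(w)=\{s\in S\mid sw>w,\ sw\notin D_J\}$, and $\mathrm D(w)=\mathrm{SD}(w)\cup\mathrm{WD}(w)$. $\mathscr I$ is a $W$-graph ideal with respect to $J$ if: (i) there is an $\mathcal A$-free $\mathcal H$-module $\mathscr S=\mathscr S(\mathscr I,J)$ with $\mathcal A$-basis $(b_w\mid w\in\mathscr I)$ such that $T_sb_w=b_{sw}$ if $s\in\mathrm{SA}(w)$; $T_sb_w=b_{sw}+(q-q^{-1})b_w$ if $s\in\mathrm{SD}(w)$; $T_sb_w=-q^{-1}b_w$ if $s\in\mathrm{WD}(w)$; $T_sb_w=qb_w-\sum_{y\in\mathscr I,\,y<sw}r^s_{y,w}b_y$ for some $r^s_{y,w}\in q\mathcal A^+$ if $s\in\mathrm{WA}(w)$; (ii) $\mathscr S$ admits an $\mathcal A$-semilinear involution $\alpha\mapsto\overline\alpha$ with $\overline{b_1}=b_1$ and $\overline{h\alpha}=\overline h\,\overline\alpha$ for all $h\in\mathcal H$, $\alpha\in\mathscr S$.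 (If $\mathscr I=\emptyset$, then $\mathscr S=0$ and the condition on $b_1$ is vacuous.) **Associated $W$-graph (known).** If $\mathscr I$ is a $W$-graph ideal with respect to $J$, then $\mathscr S(\mathscr I,J)$ has a unique $\mathcal A$-basis $C=(c_w\mid w\in\mathscr I)$ (the $W$-graph basis) with $\overline{c_w}=c_w$ and $b_w=c_w+q\sum_{y\in\mathscr I,\,y<w}q_{y,w}c_y$, $q_{y,w}\in\mathcal A^+$. Let $\mu_{y,w}$ be the constant term of $q_{y,w}$. Put $\mu(c_y,c_w)=\mu_{y,w}$ if $y<w$, $\mu_{w,y}$ if $w<y$, and $0$ otherwise, and $\tau(c_w)=\mathrm D(w)$. Then $(C,\mu,\tau)$ is a $W$-graph; it is called the $W$-graph corresponding to $(\mathscr I,J)$, and it depends only on $(\mathscr I,J)$. *)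

theory Defs
  imports
    "HOL-Algebra.QuotRing"
    "HOL-Algebra.Module"
    "HOL-Algebra.Multiplicative_Group"
    "HOL-Library.Poly_Mapping"
begin

section \<open>Coxeter systems\<close>

definition word_prod :: "('w, 'g) monoid_scheme \<Rightarrow> 'w list \<Rightarrow> 'w" where
  "word_prod W xs = foldr (\<lambda>x y. x \<otimes>\<^bsub>W\<^esub> y) xs \<one>\<^bsub>W\<^esub>"

text \<open>
  The congruence on words over \<open>S\<close> generated by the relations \<open>(s t)^m(s,t) = 1\<close>, where
  \<open>m(s,t)\<close> is the order of \<open>s t\<close>. For an element of infinite order \<^const>\<open>group.ord\<close> is \<open>0\<close>
  and the relation is void; for \<open>s = t\<close> (an involution) it says \<open>s s = 1\<close>. Because of the
  latter, words without formal inverses suffice to present the group.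
\<close>
inductive coxeter_cong :: "('w, 'g) monoid_scheme \<Rightarrow> 'w set \<Rightarrow> 'w list \<Rightarrow> 'w list \<Rightarrow> bool"
  for W :: "('w, 'g) monoid_scheme" and S :: "'w set" where
  rel: "\<lbrakk>xs \<in> lists S; ys \<in> lists S; s \<in> S; t \<in> S\<rbrakk> \<Longrightarrow>
     coxeter_cong W S (xs @ concat (replicate (group.ord W (s \<otimes>\<^bsub>W\<^esub> t)) [s, t]) @ ys) (xs @ ys)"
| refl: "xs \<in> lists S \<Longrightarrow> coxeter_cong W S xs xs"
| sym: "coxeter_cong W S xs ys \<Longrightarrow> coxeter_cong W S ys xs"
| trans: "\<lbrakk>coxeter_cong W S xs ys; coxeter_cong W S ys zs\<rbrakk> \<Longrightarrow> coxeter_cong W S xs zs"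

locale coxeter_system = group W for W (structure) +
  fixes S :: "'a set"
  assumes S_carrier: "S \<subseteq> carrier W"
    and S_order_two: "s \<in> S \<Longrightarrow> s \<noteq> \<one> \<and> s \<otimes> s = \<one>"
    and S_generates: "generate W S = carrier W"
    and S_presentation:
      "\<lbrakk>xs \<in> lists S; ys \<in> lists S; word_prod W xs = word_prod W ys\<rbrakk> \<Longrightarrow> coxeter_cong W S xs ys"

definition cox_length :: "('w, 'g) monoid_scheme \<Rightarrow> 'w set \<Rightarrow> 'w \<Rightarrow> nat" where
  "cox_length W S w = (LEAST n. \<exists>xs \<in> lists S. length xs = n \<and> word_prod W xs = w)"

definition reflections :: "('w, 'g) monoid_scheme \<Rightarrow> 'w set \<Rightarrow> 'w set" where
  "reflections W S = {x \<otimes>\<^bsub>W\<^esub> s \<otimes>\<^bsub>W\<^esub> inv\<^bsub>W\<^esub> x |x s. x \<in> carrier W \<and> s \<in> S}"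

definition bruhat_le :: "('w, 'g) monoid_scheme \<Rightarrow> 'w set \<Rightarrow> 'w \<Rightarrow> 'w \<Rightarrow> bool" where
  "bruhat_le W S u w \<longleftrightarrow> u \<in> carrier W \<and>
     (\<lambda>x y. \<exists>t \<in> reflections W S. y = x \<otimes>\<^bsub>W\<^esub> t \<and> cox_length W S x < cox_length W S y)\<^sup>*\<^sup>* u w"

definition bruhat_less :: "('w, 'g) monoid_scheme \<Rightarrow> 'w set \<Rightarrow> 'w \<Rightarrow> 'w \<Rightarrow> bool" where
  "bruhat_less W S u w \<longleftrightarrow> bruhat_le W S u w \<and> u \<noteq> w"

definition left_weak_le :: "('w, 'g) monoid_scheme \<Rightarrow> 'w set \<Rightarrow> 'w \<Rightarrow> 'w \<Rightarrow> bool" where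
  "left_weak_le W S u w \<longleftrightarrow> u \<in> carrier W \<and> w \<in> carrier W \<and>
     cox_length W S w = cox_length W S (w \<otimes>\<^bsub>W\<^esub> inv\<^bsub>W\<^esub> u) + cox_length W S u"

definition weak_ideal :: "('w, 'g) monoid_scheme \<Rightarrow> 'w set \<Rightarrow> 'w set \<Rightarrow> bool" where
  "weak_ideal W S I \<longleftrightarrow> I \<subseteq> carrier W \<and> (\<forall>w \<in> I. \<forall>u. left_weak_le W S u w \<longrightarrow> u \<in> I)"

definition Pos :: "('w, 'g) monoid_scheme \<Rightarrow> 'w set \<Rightarrow> 'w set \<Rightarrow> 'w set" where
  "Pos W S X = {s \<in> S. \<forall>x \<in> X. cox_length W S x < cox_length W S (x \<otimes>\<^bsub>W\<^esub> s)}"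

definition D_set :: "('w, 'g) monoid_scheme \<Rightarrow> 'w set \<Rightarrow> 'w set \<Rightarrow> 'w set" where
  "D_set W S J = {w \<in> carrier W. \<forall>s \<in> J. cox_length W S w < cox_length W S (w \<otimes>\<^bsub>W\<^esub> s)}"


section \<open>Laurent polynomials and the Hecke algebra\<close>

text \<open>\<open>\<int>[q, q\<^sup>-\<^sup>1]\<close> as the monoid algebra of the additive group \<open>\<int>\<close>: the exponent of \<open>q\<close> is the index.\<close>
type_synonym laurent = "int \<Rightarrow>\<^sub>0 int"

definition q_var :: laurent where "q_var = Poly_Mapping.single 1 1"
definition q_inv :: laurent where "q_inv = Poly_Mapping.single (- 1) 1"

definition laurent_bar :: "laurent \<Rightarrow> laurent" where
  "laurent_bar = Poly_Mapping.map_key uminus"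

definition laurent_pos :: "laurent set" where
  "laurent_pos = {a. \<forall>k \<in> Poly_Mapping.keys a. 0 \<le> k}"

text \<open>The free associative \<open>\<int>[q, q\<^sup>-\<^sup>1]\<close>-algebra on \<open>S\<close>; its basis is the set of words over \<open>S\<close>.\<close>
definition free_algebra :: "'w set \<Rightarrow> ('w list \<Rightarrow>\<^sub>0 laurent) ring" where
  "free_algebra S =
     \<lparr>carrier = {f. Poly_Mapping.keys f \<subseteq> lists S},
      mult = (\<lambda>f g. \<Sum>u \<in> Poly_Mapping.keys f. \<Sum>v \<in> Poly_Mapping.keys g.
        Poly_Mapping.single (u @ v) (Poly_Mapping.lookup f u * Poly_Mapping.lookup g v)),
      one = Poly_Mapping.single [] 1,
      zero = 0,
      add = (+)\<rparr>"

text \<open>The alternating word \<open>s t s \<dots>\<close> with \<open>n\<close> letters.\<close>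
primrec alternating :: "nat \<Rightarrow> 'w \<Rightarrow> 'w \<Rightarrow> 'w list" where
  "alternating 0 s t = []"
| "alternating (Suc n) s t = s # alternating n t s"

definition hecke_relators :: "('w, 'g) monoid_scheme \<Rightarrow> 'w set \<Rightarrow> ('w list \<Rightarrow>\<^sub>0 laurent) set" where
  "hecke_relators W S =
     {Poly_Mapping.single [s, s] 1
        - (Poly_Mapping.single [] 1 + Poly_Mapping.single [s] (q_var - q_inv)) |s. s \<in> S} \<union>
     {Poly_Mapping.single (alternating (group.ord W (s \<otimes>\<^bsub>W\<^esub> t)) s t) 1
        - Poly_Mapping.single (alternating (group.ord W (s \<otimes>\<^bsub>W\<^esub> t)) t s) 1 |s t.
        s \<in> S \<and> t \<in> S \<and> s \<noteq> t}"

definition hecke_ideal :: "('w, 'g) monoid_scheme \<Rightarrow> 'w set \<Rightarrow> ('w list \<Rightarrow>\<^sub>0 laurent) set" where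
  "hecke_ideal W S = Idl\<^bsub>free_algebra S\<^esub> (hecke_relators W S)"

type_synonym 'w hecke_elt = "('w list \<Rightarrow>\<^sub>0 laurent) set"

definition hecke :: "('w, 'g) monoid_scheme \<Rightarrow> 'w set \<Rightarrow> 'w hecke_elt ring" where
  "hecke W S = free_algebra S Quot hecke_ideal W S"

definition hecke_gen :: "('w, 'g) monoid_scheme \<Rightarrow> 'w set \<Rightarrow> 'w \<Rightarrow> 'w hecke_elt" where
  "hecke_gen W S s = hecke_ideal W S +>\<^bsub>free_algebra S\<^esub> Poly_Mapping.single [s] 1"

text \<open>The structure map from the coefficient ring to the Hecke algebra.\<close>
definition hecke_scalar :: "('w, 'g) monoid_scheme \<Rightarrow> 'w set \<Rightarrow> laurent \<Rightarrow> 'w hecke_elt" where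
  "hecke_scalar W S a = hecke_ideal W S +>\<^bsub>free_algebra S\<^esub> Poly_Mapping.single [] a"

definition hecke_bar :: "('w, 'g) monoid_scheme \<Rightarrow> 'w set \<Rightarrow> 'w hecke_elt \<Rightarrow> 'w hecke_elt" where
  "hecke_bar W S = (THE \<beta>. \<beta> \<in> extensional (carrier (hecke W S)) \<and>
     \<beta> \<in> ring_hom (hecke W S) (hecke W S) \<and>
     (\<forall>h \<in> carrier (hecke W S). \<beta> (\<beta> h) = h) \<and>
     (\<forall>a. \<beta> (hecke_scalar W S a) = hecke_scalar W S (laurent_bar a)) \<and>
     (\<forall>s \<in> S. \<beta> (hecke_gen W S s) = inv\<^bsub>hecke W S\<^esub> (hecke_gen W S s)))"


section \<open>Modules over the Hecke algebra\<close>

text \<open>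
  The library's locale \<^locale>\<open>module\<close> requires a commutative ring of scalars. As there, only the
  additive structure and the scalar multiplication of the module record are relevant.
\<close>
locale left_module = R?: ring R + M?: abelian_group M
  for R :: "('a, 'b) ring_scheme" (structure) and M :: "('a, 'c, 'd) module_scheme" (structure) +
  assumes smult_closed: "\<lbrakk>a \<in> carrier R; x \<in> carrier M\<rbrakk> \<Longrightarrow> a \<odot>\<^bsub>M\<^esub> x \<in> carrier M"
    and smult_l_distr: "\<lbrakk>a \<in> carrier R; b \<in> carrier R; x \<in> carrier M\<rbrakk> \<Longrightarrow>
      (a \<oplus> b) \<odot>\<^bsub>M\<^esub> x = a \<odot>\<^bsub>M\<^esub> x \<oplus>\<^bsub>M\<^esub> b \<odot>\<^bsub>M\<^esub> x"
    and smult_r_distr: "\<lbrakk>a \<in> carrier R; x \<in> carrier M; y \<in> carrier M\<rbrakk> \<Longrightarrow>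
      a \<odot>\<^bsub>M\<^esub> (x \<oplus>\<^bsub>M\<^esub> y) = a \<odot>\<^bsub>M\<^esub> x \<oplus>\<^bsub>M\<^esub> a \<odot>\<^bsub>M\<^esub> y"
    and smult_assoc: "\<lbrakk>a \<in> carrier R; b \<in> carrier R; x \<in> carrier M\<rbrakk> \<Longrightarrow>
      (a \<otimes> b) \<odot>\<^bsub>M\<^esub> x = a \<odot>\<^bsub>M\<^esub> (b \<odot>\<^bsub>M\<^esub> x)"
    and smult_one: "x \<in> carrier M \<Longrightarrow> \<one> \<odot>\<^bsub>M\<^esub> x = x"

definition act :: "('w, 'g) monoid_scheme \<Rightarrow> 'w set \<Rightarrow> ('w hecke_elt, 'm) module \<Rightarrow> 'w \<Rightarrow> 'm \<Rightarrow> 'm" where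
  "act W S M s x = hecke_gen W S s \<odot>\<^bsub>M\<^esub> x"

definition scal ::
    "('w, 'g) monoid_scheme \<Rightarrow> 'w set \<Rightarrow> ('w hecke_elt, 'm) module \<Rightarrow> laurent \<Rightarrow> 'm \<Rightarrow> 'm" where
  "scal W S M a x = hecke_scalar W S a \<odot>\<^bsub>M\<^esub> x"

definition lin_comb ::
    "('w, 'g) monoid_scheme \<Rightarrow> 'w set \<Rightarrow> ('w hecke_elt, 'm) module \<Rightarrow>
      ('i \<Rightarrow> 'm) \<Rightarrow> ('i \<Rightarrow>\<^sub>0 laurent) \<Rightarrow> 'm" where
  "lin_comb W S M b f =
     (\<Oplus>\<^bsub>M\<^esub>i \<in> Poly_Mapping.keys f. scal W S M (Poly_Mapping.lookup f i) (b i))"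

definition is_basis ::
    "('w, 'g) monoid_scheme \<Rightarrow> 'w set \<Rightarrow> ('w hecke_elt, 'm) module \<Rightarrow> 'i set \<Rightarrow> ('i \<Rightarrow> 'm) \<Rightarrow> bool" where
  "is_basis W S M I b \<longleftrightarrow>
     b ` I \<subseteq> carrier M \<and>
     (\<forall>x \<in> carrier M. \<exists>f. Poly_Mapping.keys f \<subseteq> I \<and> lin_comb W S M b f = x) \<and>
     (\<forall>f. Poly_Mapping.keys f \<subseteq> I \<and> lin_comb W S M b f = \<zero>\<^bsub>M\<^esub> \<longrightarrow> f = 0)"


section \<open>\<open>W\<close>-graphs\<close>

record ('v, 'w) W_graph =
  verts :: "'v set"
  mu :: "'v \<Rightarrow> 'v \<Rightarrow> int"
  tau :: "'v \<Rightarrow> 'w set"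

text \<open>
  \<open>N\<close> is the free \<open>\<int>[q, q\<^sup>-\<^sup>1]\<close>-module on the vertices with the action of the Hecke algebra
  prescribed by the graph; the vertex \<open>v\<close> is the basis element \<open>Poly_Mapping.single v 1\<close>.
  The action is stated coefficientwise, so the sum in the last clause is forced to be finite.
\<close>
definition W_graph_module ::
    "('w, 'g) monoid_scheme \<Rightarrow> 'w set \<Rightarrow> ('v, 'w) W_graph \<Rightarrow>
      ('w hecke_elt, 'v \<Rightarrow>\<^sub>0 laurent) module \<Rightarrow> bool" where
  "W_graph_module W S \<Gamma> N \<longleftrightarrow>
     left_module (hecke W S) N \<and>
     carrier N = {f. Poly_Mapping.keys f \<subseteq> verts \<Gamma>} \<and>
     (\<forall>f \<in> carrier N. \<forall>g \<in> carrier N. f \<oplus>\<^bsub>N\<^esub> g = f + g) \<and>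
     (\<forall>a. \<forall>f \<in> carrier N. scal W S N a f = Poly_Mapping.map ((*) a) f) \<and>
     (\<forall>s \<in> S. \<forall>v \<in> verts \<Gamma>.
       if s \<in> tau \<Gamma> v
       then act W S N s (Poly_Mapping.single v 1) = Poly_Mapping.single v (- q_inv)
       else \<forall>u. Poly_Mapping.lookup (act W S N s (Poly_Mapping.single v 1)) u =
              (if u = v then q_var else 0) +
              (if u \<in> verts \<Gamma> \<and> s \<in> tau \<Gamma> u then of_int (mu \<Gamma> u v) else 0))"

text \<open>
  \<open>U\<close> spans a submodule for the action of the Hecke algebra defined by \<open>\<Gamma>\<close>. The module \<open>N\<close> exists
  precisely when \<open>\<Gamma>\<close> is a \<open>W\<close>-graph, and \<open>\<Gamma>\<close> then determines the action on its carrier.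
\<close>
definition W_graph_closed ::
    "('w, 'g) monoid_scheme \<Rightarrow> 'w set \<Rightarrow> ('v, 'w) W_graph \<Rightarrow> 'v set \<Rightarrow> bool" where
  "W_graph_closed W S \<Gamma> U \<longleftrightarrow>
     U \<subseteq> verts \<Gamma> \<and>
     (\<exists>N. W_graph_module W S \<Gamma> N \<and> submodule {f. Poly_Mapping.keys f \<subseteq> U} (hecke W S) N)"

definition full_subgraph :: "('v, 'w) W_graph \<Rightarrow> 'v set \<Rightarrow> ('v, 'w) W_graph" where
  "full_subgraph \<Gamma> U = \<Gamma>\<lparr>verts := U\<rparr>"

definition W_graph_iso :: "('u, 'w) W_graph \<Rightarrow> ('v, 'w) W_graph \<Rightarrow> bool" where
  "W_graph_iso \<Gamma> \<Gamma>' \<longleftrightarrow> (\<exists>\<phi>. bij_betw \<phi> (verts \<Gamma>) (verts \<Gamma>') \<and>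
     (\<forall>u \<in> verts \<Gamma>. \<forall>v \<in> verts \<Gamma>. mu \<Gamma>' (\<phi> u) (\<phi> v) = mu \<Gamma> u v) \<and>
     (\<forall>u \<in> verts \<Gamma>. tau \<Gamma>' (\<phi> u) = tau \<Gamma> u))"


section \<open>\<open>W\<close>-graph ideals\<close>

definition SA :: "('w, 'g) monoid_scheme \<Rightarrow> 'w set \<Rightarrow> 'w set \<Rightarrow> 'w \<Rightarrow> 'w set" where
  "SA W S I w = {s \<in> S. bruhat_less W S w (s \<otimes>\<^bsub>W\<^esub> w) \<and> s \<otimes>\<^bsub>W\<^esub> w \<in> I}"

definition SD :: "('w, 'g) monoid_scheme \<Rightarrow> 'w set \<Rightarrow> 'w \<Rightarrow> 'w set" where
  "SD W S w = {s \<in> S. bruhat_less W S (s \<otimes>\<^bsub>W\<^esub> w) w}"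

definition WA :: "('w, 'g) monoid_scheme \<Rightarrow> 'w set \<Rightarrow> 'w set \<Rightarrow> 'w set \<Rightarrow> 'w \<Rightarrow> 'w set" where
  "WA W S J I w = {s \<in> S. bruhat_less W S w (s \<otimes>\<^bsub>W\<^esub> w) \<and> s \<otimes>\<^bsub>W\<^esub> w \<in> D_set W S J - I}"

definition WD :: "('w, 'g) monoid_scheme \<Rightarrow> 'w set \<Rightarrow> 'w set \<Rightarrow> 'w \<Rightarrow> 'w set" where
  "WD W S J w = {s \<in> S. bruhat_less W S w (s \<otimes>\<^bsub>W\<^esub> w) \<and> s \<otimes>\<^bsub>W\<^esub> w \<notin> D_set W S J}"

definition descents :: "('w, 'g) monoid_scheme \<Rightarrow> 'w set \<Rightarrow> 'w set \<Rightarrow> 'w \<Rightarrow> 'w set" where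
  "descents W S J w = SD W S w \<union> WD W S J w"

text \<open>
  Condition (i) of the definition of a \<open>W\<close>-graph ideal. For fixed \<open>s\<close> and \<open>w\<close>, the coefficients
  \<open>r\<^sup>s\<^sub>y\<^sub>,\<^sub>w\<close> form a finitely supported function of \<open>y\<close>, as Bruhat intervals are finite.
\<close>
definition ideal_module ::
    "('w, 'g) monoid_scheme \<Rightarrow> 'w set \<Rightarrow> 'w set \<Rightarrow> 'w set \<Rightarrow>
      ('w hecke_elt, 'm) module \<Rightarrow> ('w \<Rightarrow> 'm) \<Rightarrow> bool" where
  "ideal_module W S J I M b \<longleftrightarrow>
     left_module (hecke W S) M \<and>
     is_basis W S M I b \<and>
     (\<forall>w \<in> I.
       (\<forall>s \<in> SA W S I w. act W S M s (b w) = b (s \<otimes>\<^bsub>W\<^esub> w)) \<and>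
       (\<forall>s \<in> SD W S w. act W S M s (b w) = b (s \<otimes>\<^bsub>W\<^esub> w) \<oplus>\<^bsub>M\<^esub> scal W S M (q_var - q_inv) (b w)) \<and>
       (\<forall>s \<in> WD W S J w. act W S M s (b w) = scal W S M (- q_inv) (b w)) \<and>
       (\<forall>s \<in> WA W S J I w. \<exists>r :: 'w \<Rightarrow>\<^sub>0 laurent.
          Poly_Mapping.keys r \<subseteq> {y \<in> I. bruhat_less W S y (s \<otimes>\<^bsub>W\<^esub> w)} \<and>
          (\<forall>y. Poly_Mapping.lookup r y \<in> (*) q_var ` laurent_pos) \<and>
          act W S M s (b w) = scal W S M q_var (b w) \<ominus>\<^bsub>M\<^esub> lin_comb W S M b r))"

text \<open>Condition (ii).\<close>
definition ideal_involution ::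
    "('w, 'g) monoid_scheme \<Rightarrow> 'w set \<Rightarrow> 'w set \<Rightarrow>
      ('w hecke_elt, 'm) module \<Rightarrow> ('w \<Rightarrow> 'm) \<Rightarrow> ('m \<Rightarrow> 'm) \<Rightarrow> bool" where
  "ideal_involution W S I M b \<iota> \<longleftrightarrow>
     \<iota> \<in> carrier M \<rightarrow> carrier M \<and>
     (\<forall>x \<in> carrier M. \<forall>y \<in> carrier M. \<iota> (x \<oplus>\<^bsub>M\<^esub> y) = \<iota> x \<oplus>\<^bsub>M\<^esub> \<iota> y) \<and>
     (\<forall>a. \<forall>x \<in> carrier M. \<iota> (scal W S M a x) = scal W S M (laurent_bar a) (\<iota> x)) \<and>
     (\<forall>x \<in> carrier M. \<iota> (\<iota> x) = x) \<and>
     (\<one>\<^bsub>W\<^esub> \<in> I \<longrightarrow> \<iota> (b \<one>\<^bsub>W\<^esub>) = b \<one>\<^bsub>W\<^esub>) \<and>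
     (\<forall>h \<in> carrier (hecke W S). \<forall>x \<in> carrier M. \<iota> (h \<odot>\<^bsub>M\<^esub> x) = hecke_bar W S h \<odot>\<^bsub>M\<^esub> \<iota> x)"

text \<open>
  The element type of the module is no restriction: a module with a basis indexed by \<open>I\<close> is
  isomorphic to one carried by finitely supported functions.
\<close>
definition W_graph_ideal :: "('w, 'g) monoid_scheme \<Rightarrow> 'w set \<Rightarrow> 'w set \<Rightarrow> 'w set \<Rightarrow> bool" where
  "W_graph_ideal W S J I \<longleftrightarrow>
     weak_ideal W S I \<and> J \<subseteq> Pos W S I \<and>
     (\<exists>(M :: ('w hecke_elt, 'w \<Rightarrow>\<^sub>0 laurent) module) b \<iota>.
        ideal_module W S J I M b \<and> ideal_involution W S I M b \<iota>)"

text \<open>\<open>c\<close> is the \<open>W\<close>-graph basis, and \<open>Q w\<close> is the family of coefficients \<open>q\<^sub>y\<^sub>,\<^sub>w\<close> indexed by \<open>y\<close>.\<close>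
definition W_graph_basis ::
    "('w, 'g) monoid_scheme \<Rightarrow> 'w set \<Rightarrow> 'w set \<Rightarrow> ('w hecke_elt, 'm) module \<Rightarrow>
      ('w \<Rightarrow> 'm) \<Rightarrow> ('m \<Rightarrow> 'm) \<Rightarrow> ('w \<Rightarrow> 'm) \<Rightarrow> ('w \<Rightarrow> 'w \<Rightarrow>\<^sub>0 laurent) \<Rightarrow> bool" where
  "W_graph_basis W S I M b \<iota> c Q \<longleftrightarrow>
     is_basis W S M I c \<and>
     (\<forall>w \<in> I.
       \<iota> (c w) = c w \<and>
       Poly_Mapping.keys (Q w) \<subseteq> {y \<in> I. bruhat_less W S y w} \<and>
       (\<forall>y. Poly_Mapping.lookup (Q w) y \<in> laurent_pos) \<and>
       b w = c w \<oplus>\<^bsub>M\<^esub> scal W S M q_var (lin_comb W S M c (Q w)))"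

definition mu_coeff :: "('w \<Rightarrow> 'w \<Rightarrow>\<^sub>0 laurent) \<Rightarrow> 'w \<Rightarrow> 'w \<Rightarrow> int" where
  "mu_coeff Q y w = Poly_Mapping.lookup (Poly_Mapping.lookup (Q w) y) 0"

text \<open>The \<open>W\<close>-graph on the vertex set \<open>{c\<^sub>w | w \<in> I}\<close>; a basis is injective on its index set.\<close>
definition basis_graph ::
    "('w, 'g) monoid_scheme \<Rightarrow> 'w set \<Rightarrow> 'w set \<Rightarrow> 'w set \<Rightarrow>
      ('w \<Rightarrow> 'm) \<Rightarrow> ('w \<Rightarrow> 'w \<Rightarrow>\<^sub>0 laurent) \<Rightarrow> ('m, 'w) W_graph" where
  "basis_graph W S J I c Q =
     \<lparr>verts = c ` I,
      mu = (\<lambda>u v. let y = inv_into I c u; w = inv_into I c v in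
        if bruhat_less W S y w then mu_coeff Q y w
        else if bruhat_less W S w y then mu_coeff Q w y
        else 0),
      tau = (\<lambda>u. descents W S J (inv_into I c u))\<rparr>"

text \<open>\<open>\<Gamma>\<close> is the \<open>W\<close>-graph corresponding to \<open>(I, J)\<close>, obtained from some choice of the module.
  Different choices of the module give isomorphic graphs.\<close>
definition corresponding_W_graph ::
    "('w, 'g) monoid_scheme \<Rightarrow> 'w set \<Rightarrow> 'w set \<Rightarrow> 'w set \<Rightarrow> ('m, 'w) W_graph \<Rightarrow> bool" where
  "corresponding_W_graph W S J I \<Gamma> \<longleftrightarrow>
     (\<exists>(M :: ('w hecke_elt, 'm) module) b \<iota> c Q.
        ideal_module W S J I M b \<and> ideal_involution W S I M b \<iota> \<and>
        W_graph_basis W S I M b \<iota> c Q \<and> \<Gamma> = basis_graph W S J I c Q)"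

end

theory Submission
  imports Defs
begin

text \<open>
  Let \<open>(c\<^sub>w)\<close> be the \<open>W\<close>-graph basis of the module of \<open>I\<^sub>0\<close>. A Kazhdan--Lusztig argument shows that \<open>T\<^sub>s\<close> acts on
  the \<open>c\<^sub>w\<close> by the formulas of the \<open>W\<close>-graph: \<open>(T\<^sub>s - q) c\<^sub>w\<close> is bar-invariant, and its coordinates
  are determined by their coefficients at nonpositive powers of \<open>q\<close>. Hence the span of the \<open>c\<^sub>w\<close> with
  \<open>w \<in> I\<^sub>0 - I\<close> is a submodule stable under the involution, and in the quotient the images of the
  \<open>b\<^sub>w\<close> with \<open>w \<in> I\<close> satisfy the axioms, because for \<open>w \<notin> I\<close> the image of \<open>b\<^sub>w\<close> is a combination
  of the images of \<open>b\<^sub>y\<close> with \<open>y < w\<close>, \<open>y \<in> I\<close> and coefficients in \<open>q\<int>[q]\<close>. Finally, the action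
  formulas determine the polynomials \<open>q\<^sub>y\<^sub>,\<^sub>w\<close> from \<open>(I, J)\<close> by recursion on the length of \<open>w\<close>, since
  \<open>b\<^sub>s\<^sub>w = T\<^sub>s b\<^sub>w\<close> for a strong ascent \<open>s\<close>; so every \<open>W\<close>-graph corresponding to \<open>(I, J)\<close> is the one
  obtained from the quotient.
\<close>

section \<open>Laurent polynomials and finitely supported functions\<close>

text \<open>Bar sends T_s to its inverse T_s - (q - q^-1) and q to q^-1, hence it fixes T_s - q;
  this is why the argument works with T_s - q. The c_w are fixed too, so in their coordinates the
  involution is bar on each coefficient, and every coordinate of (T_s - q) c_w is symmetric under q
  -> q^-1. Its nonpositive part can be read off from b_w, because b_w and c_w agree modulo
  q\<int>[q].

  The case that shapes the quotient is a weak ascent s of w for I with s w in I_0: there T_s b_w is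
  simply b_sw, and the relation required of a weak ascent has to be produced. Passing to the
  quotient kills c_sw, and what remains of b_sw is q times a combination of lower c_y over
  \<int>[q]; this is where the factor q of the coefficients r comes from.

  In the quotient the old polynomials, restricted to indices in I, serve as the new ones, which
  gives the inherited mu for that one module. A corresponding graph may come from any other module,
  so uniqueness must compare two modules that share nothing but (I, J).\<close>

lemma poly_mapping_sum_single:
  fixes f :: "'a \<Rightarrow>\<^sub>0 'b::comm_monoid_add"
  shows "(\<Sum>k\<in>Poly_Mapping.keys f. Poly_Mapping.single k (Poly_Mapping.lookup f k)) = f"
  by (rule poly_mapping_eqI) (auto simp: lookup_sum lookup_single when_def in_keys_iff)

text \<open>Reduces additive statements to monomials. The support is confined to \<open>A\<close>,
  so that the induction also applies to coordinates indexed by an ideal of the Coxeter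
  group.\<close>

lemma poly_mapping_add_induct [consumes 1, case_names zero single add]:
  fixes f :: "'a \<Rightarrow>\<^sub>0 'b::comm_monoid_add"
  assumes "Poly_Mapping.keys f \<subseteq> A"
    and "P 0"
    and "\<And>k v. k \<in> A \<Longrightarrow> P (Poly_Mapping.single k v)"
    and add: "\<And>f g. Poly_Mapping.keys f \<subseteq> A \<Longrightarrow> Poly_Mapping.keys g \<subseteq> A \<Longrightarrow> P f \<Longrightarrow> P g \<Longrightarrow> P (f + g)"
  shows "P f"
proof -
  define F where "F K = (\<Sum>k\<in>K. Poly_Mapping.single k (Poly_Mapping.lookup f k))" for K
  have "Poly_Mapping.keys (F K) \<subseteq> A \<and> P (F K)" if "finite K" "K \<subseteq> A" for K
    using that
  proof (induction K)
    case empty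
    then show ?case using assms(2) by (simp add: F_def)
  next
    case (insert k K)
    have eq: "F (insert k K) = Poly_Mapping.single k (Poly_Mapping.lookup f k) + F K"
      using insert.hyps by (simp add: F_def)
    have "Poly_Mapping.keys (Poly_Mapping.single k (Poly_Mapping.lookup f k)) \<subseteq> A"
      using insert.prems by auto
    then show ?case
      unfolding eq using insert assms(3) add keys_add by (meson Un_least insert_subset subset_trans)
  qed
  from this[of "Poly_Mapping.keys f"] show ?thesis
    using assms(1) by (simp add: F_def poly_mapping_sum_single)
qed

lemma keys_minus_subset:
  "Poly_Mapping.keys (f - g) \<subseteq> Poly_Mapping.keys f \<union> Poly_Mapping.keys (g :: 'a \<Rightarrow>\<^sub>0 'b::ab_group_add)"
  by (auto simp: in_keys_iff lookup_minus)

lemma lookup_laurent_bar [simp]: "Poly_Mapping.lookup (laurent_bar a) k = Poly_Mapping.lookup a (- k)"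
  by (simp add: laurent_bar_def map_key.rep_eq)

lemma laurent_bar_single [simp]: "laurent_bar (Poly_Mapping.single k v) = Poly_Mapping.single (- k) v"
  by (rule poly_mapping_eqI) (auto simp: lookup_single when_def)

lemma laurent_bar_add [simp]: "laurent_bar (a + b) = laurent_bar a + laurent_bar b"
  by (rule poly_mapping_eqI) (simp add: lookup_add)

lemma laurent_bar_diff [simp]: "laurent_bar (a - b) = laurent_bar a - laurent_bar b"
  by (rule poly_mapping_eqI) (simp add: lookup_minus)

lemma laurent_bar_uminus [simp]: "laurent_bar (- a) = - laurent_bar a"
  by (rule poly_mapping_eqI) simp

lemma laurent_bar_zero [simp]: "laurent_bar 0 = 0"
  by (rule poly_mapping_eqI) simp

lemma laurent_bar_bar [simp]: "laurent_bar (laurent_bar a) = a"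
  by (rule poly_mapping_eqI) simp

lemma laurent_bar_mult [simp]: "laurent_bar (a * b) = laurent_bar a * laurent_bar b"
proof (induction a rule: poly_mapping_add_induct[OF subset_UNIV, case_names zero single add])
  case (single k v)
  show ?case
    by (induction b rule: poly_mapping_add_induct[OF subset_UNIV, case_names zero single add]) (auto simp: mult_single algebra_simps)
qed (auto simp: algebra_simps)

lemma laurent_bar_one [simp]: "laurent_bar 1 = 1"
  using laurent_bar_single[of 0 1] by (simp del: laurent_bar_single)

lemma laurent_bar_q [simp]: "laurent_bar q_var = q_inv" "laurent_bar q_inv = q_var"
  by (simp_all add: q_var_def q_inv_def)

lemma q_var_inv [simp]: "q_var * q_inv = 1" "q_inv * q_var = 1"
  by (simp_all add: q_var_def q_inv_def mult_single)

section \<open>The Hecke algebra and its bar involution\<close>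

instantiation list :: (type) monoid_add
begin
definition plus_list :: "'a list \<Rightarrow> 'a list \<Rightarrow> 'a list" where "plus_list = (@)"
definition zero_list :: "'a list" where "zero_list = []"
instance by standard (auto simp: plus_list_def zero_list_def)
end

text \<open>With concatenation as addition of words, the free algebra carries the convolution product of
  \<^typ>\<open>'w list \<Rightarrow>\<^sub>0 laurent\<close>, so that the ring structure of that type can be used.\<close>

lemma free_algebra_simps [simp]:
  "carrier (free_algebra S) = {f. Poly_Mapping.keys f \<subseteq> lists S}"
  "f \<otimes>\<^bsub>free_algebra S\<^esub> g = f * g"
  "\<one>\<^bsub>free_algebra S\<^esub> = 1"
  "\<zero>\<^bsub>free_algebra S\<^esub> = 0"
  "f \<oplus>\<^bsub>free_algebra S\<^esub> g = f + g"
proof -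
  have "f * g = (\<Sum>u\<in>Poly_Mapping.keys f. Poly_Mapping.single u (Poly_Mapping.lookup f u)) *
      (\<Sum>v\<in>Poly_Mapping.keys g. Poly_Mapping.single v (Poly_Mapping.lookup g v))"
    by (simp add: poly_mapping_sum_single)
  then show "f \<otimes>\<^bsub>free_algebra S\<^esub> g = f * g"
    by (simp add: free_algebra_def sum_product mult_single plus_list_def)
  show "\<one>\<^bsub>free_algebra S\<^esub> = 1"
    by (simp add: free_algebra_def zero_list_def[symmetric])
qed (simp_all add: free_algebra_def)

lemma keys_mult_lists:
  assumes "Poly_Mapping.keys f \<subseteq> lists S" "Poly_Mapping.keys g \<subseteq> lists S"
  shows "Poly_Mapping.keys (f * g :: 'w list \<Rightarrow>\<^sub>0 laurent) \<subseteq> lists S"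
  using keys_mult[of f g] assms by (fastforce simp: plus_list_def)

lemma ring_free_algebra: "ring (free_algebra S)"
proof (rule ringI)
  show "abelian_group (free_algebra S)"
  proof (rule abelian_groupI)
    fix x assume "x \<in> carrier (free_algebra S)"
    then show "\<exists>y\<in>carrier (free_algebra S). y \<oplus>\<^bsub>free_algebra S\<^esub> x = \<zero>\<^bsub>free_algebra S\<^esub>"
      by (intro bexI[of _ "- x"]) auto
  qed (use keys_add in \<open>fastforce simp: add_ac\<close>)+
  show "Group.monoid (free_algebra S)"
    by (rule monoidI) (auto simp: mult.assoc zero_list_def dest: keys_mult_lists[THEN subsetD, rotated 2])
qed (auto simp: algebra_simps)

interpretation free_alg: ring "free_algebra S" for S :: "'w set"
  by (rule ring_free_algebra)

lemma free_algebra_a_inv [simp]: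
  assumes "Poly_Mapping.keys f \<subseteq> lists S"
  shows "\<ominus>\<^bsub>free_algebra S\<^esub> f = - f"
  using assms by (intro free_alg.minus_equality) auto

lemma set_alternating: "set (alternating n s t) \<subseteq> {s, t}"
  by (induction n arbitrary: s t) auto

lemma alternating_in_lists: "\<lbrakk>s \<in> S; t \<in> S\<rbrakk> \<Longrightarrow> alternating n s t \<in> lists S"
  by (induction n arbitrary: s t) auto

lemma free_algebra_closed:
  assumes "f \<in> carrier (free_algebra S)" "g \<in> carrier (free_algebra S)"
  shows "f + g \<in> carrier (free_algebra S)" "f * g \<in> carrier (free_algebra S)"
    "f - g \<in> carrier (free_algebra S)" "- f \<in> carrier (free_algebra S)"
  using assms keys_add[of f g] keys_minus_subset[of f g] keys_mult_lists[of f S g]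
  by auto

lemma single_in_free_algebra:
  "w \<in> lists S \<Longrightarrow> Poly_Mapping.single w a \<in> carrier (free_algebra S)"
  "1 \<in> carrier (free_algebra S)"
  by (auto simp: zero_list_def)

lemma hecke_relators_carrier: "hecke_relators W S \<subseteq> carrier (free_algebra S)"
  unfolding hecke_relators_def
  by (auto simp del: free_algebra_simps intro!: free_algebra_closed single_in_free_algebra
      dest: set_alternating[THEN subsetD])

section \<open>The ideal of Hecke relations and the quotient ring\<close>

lemma hecke_ideal: "ideal (hecke_ideal W S) (free_algebra S)"
  unfolding hecke_ideal_def by (rule free_alg.genideal_ideal[OF hecke_relators_carrier])

lemma hecke_ideal_closed:
  assumes "f \<in> hecke_ideal W S"
  shows "f \<in> carrier (free_algebra S)" "- f \<in> hecke_ideal W S"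
    "g \<in> hecke_ideal W S \<Longrightarrow> f + g \<in> hecke_ideal W S"
    "g \<in> hecke_ideal W S \<Longrightarrow> f - g \<in> hecke_ideal W S"
    "g \<in> carrier (free_algebra S) \<Longrightarrow> f * g \<in> hecke_ideal W S"
    "g \<in> carrier (free_algebra S) \<Longrightarrow> g * f \<in> hecke_ideal W S"
proof -
  interpret ideal "hecke_ideal W S" "free_algebra S" by (rule hecke_ideal)
  show c: "f \<in> carrier (free_algebra S)" by (rule a_Hcarr[OF assms])
  have n: "- f \<in> hecke_ideal W S" if "f \<in> hecke_ideal W S" for f
    using a_inv_closed[OF that] a_Hcarr[OF that] by simp
  show "- f \<in> hecke_ideal W S" by (rule n[OF assms])
  have a: "f + g \<in> hecke_ideal W S" if "g \<in> hecke_ideal W S" for g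
    using a_closed[OF assms that] by simp
  show "g \<in> hecke_ideal W S \<Longrightarrow> f + g \<in> hecke_ideal W S" by (rule a)
  show "f - g \<in> hecke_ideal W S" if "g \<in> hecke_ideal W S"
    using a[OF n[OF that]] by simp
  show "g \<in> carrier (free_algebra S) \<Longrightarrow> f * g \<in> hecke_ideal W S"
    using I_r_closed[OF assms] by simp
  show "g \<in> carrier (free_algebra S) \<Longrightarrow> g * f \<in> hecke_ideal W S"
    using I_l_closed[OF assms] by simp
qed

lemma hecke_ideal_zero: "0 \<in> hecke_ideal W S"
proof -
  interpret ideal "hecke_ideal W S" "free_algebra S" by (rule hecke_ideal)
  show ?thesis using additive_subgroup.zero_closed[OF additive_subgroup_axioms] by simp
qed

lemma hecke_ring: "ring (hecke W S)"
  unfolding hecke_def by (rule ideal.quotient_is_ring[OF hecke_ideal])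

definition hecke_proj :: "('w, 'g) monoid_scheme \<Rightarrow> 'w set \<Rightarrow> ('w list \<Rightarrow>\<^sub>0 laurent) \<Rightarrow> 'w hecke_elt" where
  "hecke_proj W S f = hecke_ideal W S +>\<^bsub>free_algebra S\<^esub> f"

lemma hecke_proj_hom: "hecke_proj W S \<in> ring_hom (free_algebra S) (hecke W S)"
  using ideal.rcos_ring_hom[OF hecke_ideal] unfolding hecke_def hecke_proj_def[abs_def] .

lemma hecke_proj_simps:
  assumes "f \<in> carrier (free_algebra S)"
  shows "hecke_proj W S f \<in> carrier (hecke W S)"
    "g \<in> carrier (free_algebra S) \<Longrightarrow>
      hecke_proj W S f \<oplus>\<^bsub>hecke W S\<^esub> hecke_proj W S g = hecke_proj W S (f + g)"
    "g \<in> carrier (free_algebra S) \<Longrightarrow>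
      hecke_proj W S f \<otimes>\<^bsub>hecke W S\<^esub> hecke_proj W S g = hecke_proj W S (f * g)"
    "\<one>\<^bsub>hecke W S\<^esub> = hecke_proj W S 1"
    "g \<in> carrier (free_algebra S) \<Longrightarrow>
      hecke_proj W S f = hecke_proj W S g \<longleftrightarrow> f - g \<in> hecke_ideal W S"
proof -
  note h = ring_hom_memE[OF hecke_proj_hom[of W S]]
  show "hecke_proj W S f \<in> carrier (hecke W S)" by (rule h(1)[OF assms])
  show "\<one>\<^bsub>hecke W S\<^esub> = hecke_proj W S 1" using h(4) by simp
  assume g: "g \<in> carrier (free_algebra S)"
  show "hecke_proj W S f \<oplus>\<^bsub>hecke W S\<^esub> hecke_proj W S g = hecke_proj W S (f + g)"
    using h(3)[OF assms g] by simp
  show "hecke_proj W S f \<otimes>\<^bsub>hecke W S\<^esub> hecke_proj W S g = hecke_proj W S (f * g)"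
    using h(2)[OF assms g] by simp
  show "hecke_proj W S f = hecke_proj W S g \<longleftrightarrow> f - g \<in> hecke_ideal W S"
    using free_alg.quotient_eq_iff_same_a_r_cos[OF hecke_ideal[of W S] assms g] g
    by (simp add: hecke_proj_def a_minus_def)
qed

lemma hecke_carrierE:
  assumes "h \<in> carrier (hecke W S)"
  obtains f where "f \<in> carrier (free_algebra S)" "h = hecke_proj W S f"
  using assms unfolding hecke_def hecke_proj_def FactRing_def by (auto simp: A_RCOSETS_def')

text \<open>An element is the class of a sum of monomials, and a monomial is a scalar times its
  letters. Letters are split off on the right, so that the coefficient stays with the shorter
  word.\<close>

lemma hecke_induct [consumes 1, case_names scalar gen add mult]:
  assumes "h \<in> carrier (hecke W S)"
    and sc: "\<And>a. P (hecke_scalar W S a)"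
    and gen: "\<And>s. s \<in> S \<Longrightarrow> P (hecke_gen W S s)"
    and add: "\<And>x y. x \<in> carrier (hecke W S) \<Longrightarrow> y \<in> carrier (hecke W S) \<Longrightarrow> P x \<Longrightarrow> P y \<Longrightarrow> P (x \<oplus>\<^bsub>hecke W S\<^esub> y)"
    and mult: "\<And>x y. x \<in> carrier (hecke W S) \<Longrightarrow> y \<in> carrier (hecke W S) \<Longrightarrow> P x \<Longrightarrow> P y \<Longrightarrow> P (x \<otimes>\<^bsub>hecke W S\<^esub> y)"
  shows "P h"
proof -
  obtain f where f: "f \<in> carrier (free_algebra S)" and h: "h = hecke_proj W S f"
    using assms(1) by (rule hecke_carrierE)
  have "Poly_Mapping.keys f \<subseteq> lists S" using f by simp
  then have "P (hecke_proj W S f)"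
  proof (induction f rule: poly_mapping_add_induct)
    case zero
    show ?case using sc[of 0] by (simp add: hecke_scalar_def hecke_proj_def)
  next
    case (add f g)
    then show ?case
      using assms(4)[of "hecke_proj W S f" "hecke_proj W S g"] by (simp add: hecke_proj_simps)
  next
    case (single w a)
    then show ?case
    proof (induction w rule: rev_induct)
      case Nil
      show ?case using sc[of a] by (simp add: hecke_scalar_def hecke_proj_def)
    next
      case (snoc s w)
      have "P (hecke_proj W S (Poly_Mapping.single w a) \<otimes>\<^bsub>hecke W S\<^esub> hecke_proj W S (Poly_Mapping.single [s] 1))"
        using snoc gen[of s]
        by (intro mult) (auto simp: hecke_gen_def hecke_proj_def[symmetric] intro!: hecke_proj_simps)
      then show ?case
        using snoc.prems by (simp add: hecke_proj_simps mult_single plus_list_def)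
    qed
  qed
  then show ?thesis by (simp add: h)
qed

lemma hecke_scalar_proj: "hecke_scalar W S a = hecke_proj W S (Poly_Mapping.single [] a)"
  and hecke_gen_proj: "hecke_gen W S s = hecke_proj W S (Poly_Mapping.single [s] 1)"
  by (simp_all add: hecke_scalar_def hecke_gen_def hecke_proj_def)

lemma hecke_scalar_closed: "hecke_scalar W S a \<in> carrier (hecke W S)"
  and hecke_gen_closed: "s \<in> S \<Longrightarrow> hecke_gen W S s \<in> carrier (hecke W S)"
  by (auto simp: hecke_scalar_proj hecke_gen_proj intro!: hecke_proj_simps)

lemma hecke_scalar_hom:
  "hecke_scalar W S 1 = \<one>\<^bsub>hecke W S\<^esub>"
  "hecke_scalar W S (a + b) = hecke_scalar W S a \<oplus>\<^bsub>hecke W S\<^esub> hecke_scalar W S b"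
  "hecke_scalar W S (a * b) = hecke_scalar W S a \<otimes>\<^bsub>hecke W S\<^esub> hecke_scalar W S b"
  "hecke_scalar W S 0 = \<zero>\<^bsub>hecke W S\<^esub>"
proof -
  interpret H: ring "hecke W S" by (rule hecke_ring)
  show "hecke_scalar W S 1 = \<one>\<^bsub>hecke W S\<^esub>"
    by (simp add: hecke_scalar_proj hecke_proj_simps(4)[of 0] zero_list_def[symmetric])
  show add: "hecke_scalar W S (a + b) = hecke_scalar W S a \<oplus>\<^bsub>hecke W S\<^esub> hecke_scalar W S b" for a b
    by (simp add: hecke_scalar_proj hecke_proj_simps single_add)
  show "hecke_scalar W S (a * b) = hecke_scalar W S a \<otimes>\<^bsub>hecke W S\<^esub> hecke_scalar W S b"
    by (simp add: hecke_scalar_proj hecke_proj_simps mult_single plus_list_def)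
  show "hecke_scalar W S 0 = \<zero>\<^bsub>hecke W S\<^esub>"
    using add[of 0 0] hecke_scalar_closed[of W S 0] by (metis H.add.r_cancel_one' add_0)
qed

lemma single_Nil_commute:
  "Poly_Mapping.single [] a * f = f * (Poly_Mapping.single [] a :: 'w list \<Rightarrow>\<^sub>0 laurent)"
  by (induction f rule: poly_mapping_add_induct[OF subset_UNIV, case_names zero single add])
    (auto simp: mult_single plus_list_def algebra_simps)

lemma hecke_scalar_commute:
  assumes "h \<in> carrier (hecke W S)"
  shows "hecke_scalar W S a \<otimes>\<^bsub>hecke W S\<^esub> h = h \<otimes>\<^bsub>hecke W S\<^esub> hecke_scalar W S a"
proof -
  obtain f where f: "f \<in> carrier (free_algebra S)" and h: "h = hecke_proj W S f"
    using assms by (rule hecke_carrierE)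
  have a: "Poly_Mapping.single [] a \<in> carrier (free_algebra S)"
    by (simp add: single_in_free_algebra)
  show ?thesis
    unfolding h hecke_scalar_proj hecke_proj_simps(3)[OF f a] hecke_proj_simps(3)[OF a f]
    by (simp add: single_Nil_commute)
qed

lemma hecke_gen_square:
  assumes "s \<in> S"
  shows "hecke_gen W S s \<otimes>\<^bsub>hecke W S\<^esub> hecke_gen W S s =
    \<one>\<^bsub>hecke W S\<^esub> \<oplus>\<^bsub>hecke W S\<^esub> hecke_scalar W S (q_var - q_inv) \<otimes>\<^bsub>hecke W S\<^esub> hecke_gen W S s"
proof -
  have "Poly_Mapping.single [s, s] 1 - (Poly_Mapping.single [] 1 + Poly_Mapping.single [s] (q_var - q_inv))
      \<in> hecke_relators W S"
    unfolding hecke_relators_def using assms by blast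
  then have "Poly_Mapping.single [s, s] 1 - (Poly_Mapping.single [] 1 + Poly_Mapping.single [s] (q_var - q_inv))
      \<in> hecke_ideal W S"
    unfolding hecke_ideal_def using free_alg.genideal_self[OF hecke_relators_carrier] by blast
  then have "hecke_proj W S (Poly_Mapping.single [s, s] 1) =
      hecke_proj W S (Poly_Mapping.single [] 1 + Poly_Mapping.single [s] (q_var - q_inv))"
    using assms by (subst hecke_proj_simps(5)) (auto simp del: free_algebra_simps 
        intro!: free_algebra_closed single_in_free_algebra)
  also have "\<dots> = hecke_proj W S (Poly_Mapping.single [] 1) \<oplus>\<^bsub>hecke W S\<^esub>
      hecke_proj W S (Poly_Mapping.single [] (q_var - q_inv)) \<otimes>\<^bsub>hecke W S\<^esub> hecke_proj W S (Poly_Mapping.single [s] 1)"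
    using assms by (simp add: hecke_proj_simps mult_single plus_list_def)
  also have "hecke_proj W S (Poly_Mapping.single [s, s] 1) =
      hecke_proj W S (Poly_Mapping.single [s] 1) \<otimes>\<^bsub>hecke W S\<^esub> hecke_proj W S (Poly_Mapping.single [s] 1)"
    using assms by (simp add: hecke_proj_simps mult_single plus_list_def)
  finally show ?thesis
    by (simp add: hecke_gen_proj hecke_scalar_proj[symmetric] hecke_scalar_hom(1))
qed

text \<open>The generators have no inverses in the free algebra. By the quadratic relation the
  inverse of T_s is T_s - (q - q^-1), an expression that makes sense there; each letter is replaced
  by it, in the same order.\<close>

definition bar_word :: "'w list \<Rightarrow> 'w list \<Rightarrow>\<^sub>0 laurent" where
  "bar_word w = prod_list (map (\<lambda>s. Poly_Mapping.single [s] 1 - Poly_Mapping.single [] (q_var - q_inv)) w)"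

definition free_bar :: "('w list \<Rightarrow>\<^sub>0 laurent) \<Rightarrow> 'w list \<Rightarrow>\<^sub>0 laurent" where
  "free_bar f = (\<Sum>w\<in>Poly_Mapping.keys f.
     Poly_Mapping.single [] (laurent_bar (Poly_Mapping.lookup f w)) * bar_word w)"

lemma bar_word_simps:
  "bar_word [] = 1"
  "bar_word (s # w) = (Poly_Mapping.single [s] 1 - Poly_Mapping.single [] (q_var - q_inv)) * bar_word w"
  "bar_word (u @ w) = bar_word u * bar_word w"
  by (simp_all add: bar_word_def)

lemma free_bar_single:
  "free_bar (Poly_Mapping.single w a) = Poly_Mapping.single [] (laurent_bar a) * bar_word w"
  by (simp add: free_bar_def)

lemma free_bar_zero [simp]: "free_bar 0 = 0"
  by (simp add: free_bar_def)

lemma free_bar_add: "free_bar (f + g) = free_bar f + free_bar g"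
  unfolding free_bar_def
  by (rule setsum_keys_plus_distrib) (auto simp: single_add algebra_simps)

lemma free_bar_uminus: "free_bar (- f) = - free_bar f"
  using free_bar_add[of f "- f"] by (simp add: minus_unique)

lemma free_bar_diff: "free_bar (f - g) = free_bar f - free_bar g"
  using free_bar_add[of f "- g"] by (simp add: free_bar_uminus)

text \<open>On monomials, the barred coefficient of the second factor has to pass the barred word of
  the first; multiples of the empty word are central.\<close>

lemma free_bar_mult: "free_bar (f * g) = free_bar f * free_bar g"
proof (induction f rule: poly_mapping_add_induct[OF subset_UNIV, case_names zero single add])
  case (single u a)
  show ?case
  proof (induction g rule: poly_mapping_add_induct[OF subset_UNIV, case_names zero single add])
    case (single w b)
    have "free_bar (Poly_Mapping.single u a * Poly_Mapping.single w b) =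
        Poly_Mapping.single [] (laurent_bar a) * (Poly_Mapping.single [] (laurent_bar b) * bar_word u) * bar_word w"
      by (simp add: mult_single free_bar_single plus_list_def bar_word_simps mult.assoc[symmetric])
    also have "\<dots> = free_bar (Poly_Mapping.single u a) * free_bar (Poly_Mapping.single w b)"
      by (simp only: free_bar_single single_Nil_commute[of "laurent_bar b" "bar_word u"] mult.assoc)
    finally show ?case .
  qed (auto simp: free_bar_add algebra_simps)
qed (auto simp: free_bar_add algebra_simps)

lemma single_Nil_one: "Poly_Mapping.single [] 1 = (1 :: 'w list \<Rightarrow>\<^sub>0 laurent)"
  by (simp add: zero_list_def[symmetric])

lemma free_bar_one: "free_bar 1 = (1 :: 'w list \<Rightarrow>\<^sub>0 laurent)"
  using free_bar_single[of "[] :: 'w list" 1] by (simp add: bar_word_simps single_Nil_one)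

text \<open>Involutivity holds before passing to the quotient: with z = q - q^-1 a letter s goes to
  s - z, and bar z = -z, so the second application adds z back.\<close>

lemma free_bar_bar: "free_bar (free_bar f) = f"
proof -
  have scal: "free_bar (Poly_Mapping.single [] a) = (Poly_Mapping.single [] (laurent_bar a) :: 'a list \<Rightarrow>\<^sub>0 laurent)" for a
    by (simp add: free_bar_single bar_word_simps)
  have word: "free_bar (bar_word w) = Poly_Mapping.single w 1" for w :: "'a list"
  proof (induction w)
    case Nil
    show ?case using scal[of 1] by (simp add: bar_word_simps single_Nil_one)
  next
    case (Cons s w)
    have "free_bar (Poly_Mapping.single [s] 1 - Poly_Mapping.single [] (q_var - q_inv)) =
        (Poly_Mapping.single [s] 1 :: 'a list \<Rightarrow>\<^sub>0 laurent)"
      by (simp add: free_bar_diff scal free_bar_single[of "[s]"] bar_word_simps single_Nil_one single_diff)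
    then show ?case
      by (simp only: bar_word_simps free_bar_mult Cons) (simp add: mult_single plus_list_def)
  qed
  show ?thesis
    by (induction f rule: poly_mapping_add_induct[OF subset_UNIV, case_names zero single add])
      (auto simp: free_bar_add free_bar_mult scal word free_bar_single mult_single plus_list_def bar_word_simps)
qed

lemma bar_word_closed: "w \<in> lists S \<Longrightarrow> bar_word w \<in> carrier (free_algebra S)"
  by (induction w rule: list.induct) (simp_all del: free_algebra_simps add: bar_word_simps free_algebra_closed single_in_free_algebra)

lemma free_bar_closed:
  assumes "f \<in> carrier (free_algebra S)"
  shows "free_bar f \<in> carrier (free_algebra S)"
proof -
  have "Poly_Mapping.keys f \<subseteq> lists S" using assms by simp
  then show ?thesis
    by (induction f rule: poly_mapping_add_induct)
      (auto simp del: free_algebra_simps simp: free_bar_add free_bar_single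
        intro!: free_algebra_closed bar_word_closed single_in_free_algebra, simp)
qed

section \<open>Descent of the bar map to the Hecke algebra\<close>

lemma hecke_relators_in_ideal: "hecke_relators W S \<subseteq> hecke_ideal W S"
  unfolding hecke_ideal_def by (rule free_alg.genideal_self[OF hecke_relators_carrier])

text \<open>The defect of a letter and its barred letter from being mutually inverse is exactly the
  quadratic relator, on either side.\<close>

lemma single_mult_bar_single:
  "Poly_Mapping.single [s] 1 * (Poly_Mapping.single [s] 1 - Poly_Mapping.single [] (q_var - q_inv)) - 1 =
     Poly_Mapping.single [s, s] 1 - (Poly_Mapping.single [] 1 + Poly_Mapping.single [s] (q_var - q_inv))"
  "(Poly_Mapping.single [s] 1 - Poly_Mapping.single [] (q_var - q_inv)) * Poly_Mapping.single [s] 1 - 1 =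
     Poly_Mapping.single [s, s] 1 - (Poly_Mapping.single [] 1 + Poly_Mapping.single [s] (q_var - q_inv))"
  for s :: 'w
  by (simp_all add: right_diff_distrib left_diff_distrib mult_single plus_list_def single_Nil_one)

text \<open>\<open>bar_word\<close> keeps the order of the letters whereas inversion reverses it,
  hence the \<open>rev\<close>. The induction cancels the innermost pair of factors modulo the
  ideal.\<close>

lemma bar_word_inverse:
  assumes "w \<in> lists S"
  shows "Poly_Mapping.single w 1 * bar_word (rev w) - 1 \<in> hecke_ideal W S"
    and "bar_word (rev w) * Poly_Mapping.single w 1 - 1 \<in> hecke_ideal W S"
proof -
  have rel: "Poly_Mapping.single [s, s] 1 - (Poly_Mapping.single [] 1 + Poly_Mapping.single [s] (q_var - q_inv))
      \<in> hecke_ideal W S" if "s \<in> S" for s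
    using that hecke_relators_in_ideal[of W S] unfolding hecke_relators_def by blast
  have "Poly_Mapping.single w 1 * bar_word (rev w) - 1 \<in> hecke_ideal W S \<and>
    bar_word (rev w) * Poly_Mapping.single w 1 - 1 \<in> hecke_ideal W S"
    using assms
  proof (induction w rule: list.induct)
    case Nil
    then show ?case by (simp add: bar_word_simps single_Nil_one hecke_ideal_zero)
  next
    case (Cons s w)
    let ?s = "Poly_Mapping.single [s] 1 :: 'a list \<Rightarrow>\<^sub>0 laurent"
    let ?w = "Poly_Mapping.single w 1 :: 'a list \<Rightarrow>\<^sub>0 laurent"
    let ?z = "Poly_Mapping.single [] (q_var - q_inv) :: 'a list \<Rightarrow>\<^sub>0 laurent"
    have sw: "Poly_Mapping.single (s # w) 1 = ?s * ?w" by (simp add: mult_single plus_list_def)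
    have bar: "bar_word (rev (s # w)) = bar_word (rev w) * (?s - ?z)"
      by (simp add: bar_word_simps)
    have sS: "s \<in> S" "set w \<subseteq> S" using Cons.prems by auto
    have car: "?s \<in> carrier (free_algebra S)" "?s - ?z \<in> carrier (free_algebra S)"
        "?w \<in> carrier (free_algebra S)" "bar_word (rev w) \<in> carrier (free_algebra S)"
      using sS by (auto simp del: free_algebra_simps intro!: bar_word_closed free_algebra_closed single_in_free_algebra)
    have r1: "?s * (?s - ?z) - 1 \<in> hecke_ideal W S" "(?s - ?z) * ?s - 1 \<in> hecke_ideal W S"
      using rel[of s] sS by (simp_all add: single_mult_bar_single)
    have e1: "?s * ?w * (bar_word (rev w) * (?s - ?z)) - 1 =
        ?s * (?w * bar_word (rev w) - 1) * (?s - ?z) + (?s * (?s - ?z) - 1)"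
      by (simp add: algebra_simps)
    have e2: "bar_word (rev w) * (?s - ?z) * (?s * ?w) - 1 =
        bar_word (rev w) * ((?s - ?z) * ?s - 1) * ?w + (bar_word (rev w) * ?w - 1)"
      by (simp add: algebra_simps)
    show ?case
      unfolding sw bar e1 e2 using Cons sS car r1
      by (auto intro!: hecke_ideal_closed(3) intro: hecke_ideal_closed(5,6) simp del: free_algebra_simps)
  qed
  then show "Poly_Mapping.single w 1 * bar_word (rev w) - 1 \<in> hecke_ideal W S"
    "bar_word (rev w) * Poly_Mapping.single w 1 - 1 \<in> hecke_ideal W S" by auto
qed

lemma alternating_Suc_right:
  "alternating (Suc n) s t = alternating n s t @ [if even n then s else t]"
  by (induction n arbitrary: s t) auto

lemma rev_alternating:
  "rev (alternating n s t) = (if even n then alternating n t s else alternating n s t)"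
proof (induction n arbitrary: s t)
  case (Suc n)
  have "rev (alternating (Suc n) s t) = rev (alternating n t s) @ [s]" by simp
  also have "\<dots> = (if even (Suc n) then alternating (Suc n) t s else alternating (Suc n) s t)"
    unfolding Suc alternating_Suc_right by (cases "even n") auto
  finally show ?case .
qed simp

text \<open>The quadratic relator is fixed, since bar exchanges s and s - z in s (s - z) - 1. For a
  braid relator, the reversal of an alternating word is the same word or the one with the letters
  exchanged, according to parity. Thus the two barred words are, modulo the ideal, inverses of the
  two original words, and the original words are congruent.\<close>

lemma free_bar_relator:
  assumes "f \<in> hecke_relators W S"
  shows "free_bar f \<in> hecke_ideal W S"
proof -
  consider (quad) s where "s \<in> S" "f = Poly_Mapping.single [s, s] 1
        - (Poly_Mapping.single [] 1 + Poly_Mapping.single [s] (q_var - q_inv))"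
    | (braid) s t m where "s \<in> S" "t \<in> S" "s \<noteq> t" "m = group.ord W (s \<otimes>\<^bsub>W\<^esub> t)"
        "f = Poly_Mapping.single (alternating m s t) 1 - Poly_Mapping.single (alternating m t s) 1"
    using assms unfolding hecke_relators_def by auto
  then show ?thesis
  proof cases
    case quad
    let ?s = "Poly_Mapping.single [s] 1 :: 'a list \<Rightarrow>\<^sub>0 laurent"
    let ?z = "Poly_Mapping.single [] (q_var - q_inv) :: 'a list \<Rightarrow>\<^sub>0 laurent"
    have f: "f = ?s * (?s - ?z) - 1" by (simp add: single_mult_bar_single quad)
    have s: "free_bar ?s = ?s - ?z"
      by (simp add: free_bar_single bar_word_simps single_Nil_one)
    have z: "free_bar ?z = - ?z"
      by (simp add: free_bar_single bar_word_simps single_uminus[symmetric])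
    have "free_bar f = (?s - ?z) * ?s - 1"
      unfolding f free_bar_diff free_bar_mult s z free_bar_one by simp
    also have "\<dots> = f" by (simp add: single_mult_bar_single quad)
    finally show ?thesis using assms hecke_relators_in_ideal[of W S] by auto
  next
    case braid
    define a b A B where "a = (Poly_Mapping.single (alternating m s t) 1 :: 'a list \<Rightarrow>\<^sub>0 laurent)"
      and "b = (Poly_Mapping.single (alternating m t s) 1 :: 'a list \<Rightarrow>\<^sub>0 laurent)"
      and "A = bar_word (alternating m s t)" and "B = bar_word (alternating m t s)"
    have ab: "a - b \<in> hecke_ideal W S"
      using assms hecke_relators_in_ideal[of W S] braid by (auto simp: a_def b_def)
    have car: "A \<in> carrier (free_algebra S)" "B \<in> carrier (free_algebra S)"
      unfolding A_def B_def using braid by (auto simp del: free_algebra_simps intro!: bar_word_closed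
          dest: set_alternating[THEN subsetD])
    have inv: "a * bar_word (rev (alternating m s t)) - 1 \<in> hecke_ideal W S"
      "bar_word (rev (alternating m s t)) * a - 1 \<in> hecke_ideal W S"
      "b * bar_word (rev (alternating m t s)) - 1 \<in> hecke_ideal W S"
      "bar_word (rev (alternating m t s)) * b - 1 \<in> hecke_ideal W S"
      unfolding a_def b_def using braid(1,2) alternating_in_lists by (metis bar_word_inverse)+
    have "A - B \<in> hecke_ideal W S"
    proof (cases "even m")
      case True
      \<comment> \<open>For even \<open>m\<close>, \<open>A\<close> inverts \<open>b\<close> and
        \<open>B\<close> inverts \<open>a\<close>. This is b^-1 - a^-1 = b^-1 (a - b) a^-1 with the
        error terms of the two inverses written out, so that each summand lies in the ideal.\<close>
      have eq: "A - B = A * (a - b) * B - A * (a * B - 1) + (A * b - 1) * B"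
        by (simp add: algebra_simps)
      have "a * B - 1 \<in> hecke_ideal W S" "A * b - 1 \<in> hecke_ideal W S"
        using True inv by (simp_all add: rev_alternating A_def B_def)
      then show ?thesis unfolding eq using ab car
        by (intro hecke_ideal_closed(3)[OF hecke_ideal_closed(4)]) (blast intro: hecke_ideal_closed(5,6))+
    next
      case False
      have eq: "A - B = (A * a - 1) * B - A * (a - b) * B - A * (b * B - 1)"
        by (simp add: algebra_simps)
      have "A * a - 1 \<in> hecke_ideal W S" "b * B - 1 \<in> hecke_ideal W S"
        using False inv by (simp_all add: rev_alternating A_def B_def)
      then show ?thesis unfolding eq using ab car
        by (intro hecke_ideal_closed(4)) (blast intro: hecke_ideal_closed(5,6))+
    qed
    then show ?thesis
      unfolding braid(5) by (simp add: free_bar_diff free_bar_single A_def B_def single_Nil_one)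
  qed
qed

lemma free_bar_ideal:
  assumes "f \<in> hecke_ideal W S"
  shows "free_bar f \<in> hecke_ideal W S"
proof -
  \<comment> \<open>The preimage of the ideal under a ring endomorphism is an ideal; by minimality
    of the generated ideal only the relators need checking.\<close>
  define K where "K = {f \<in> carrier (free_algebra S). free_bar f \<in> hecke_ideal W S}"
  have "ideal K (free_algebra S)"
  proof (rule idealI[OF ring_free_algebra])
    show "subgroup K (add_monoid (free_algebra S))"
    proof (rule group.subgroupI)
      show "Group.group (add_monoid (free_algebra S))" by (rule free_alg.a_group)
      show "inv\<^bsub>add_monoid (free_algebra S)\<^esub> a \<in> K" if "a \<in> K" for a
      proof -
        have "inv\<^bsub>add_monoid (free_algebra S)\<^esub> a = - a"
          using that free_algebra_a_inv[of a S] by (simp add: K_def a_inv_def)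
        then show ?thesis
          using that hecke_ideal_closed(2)[of "free_bar a" W S]
          by (simp add: K_def free_bar_uminus)
      qed
      show "a \<otimes>\<^bsub>add_monoid (free_algebra S)\<^esub> b \<in> K" if "a \<in> K" "b \<in> K" for a b
        using that unfolding K_def
        by (auto simp: free_bar_add hecke_ideal_closed simp del: free_algebra_simps(1) intro!: free_algebra_closed)
      have "0 \<in> K" by (simp add: K_def hecke_ideal_zero)
      then show "K \<noteq> {}" by blast
    qed (auto simp: K_def)
    show "x \<otimes>\<^bsub>free_algebra S\<^esub> a \<in> K" "a \<otimes>\<^bsub>free_algebra S\<^esub> x \<in> K"
      if "a \<in> K" "x \<in> carrier (free_algebra S)" for a x
      using that free_bar_closed[of x] unfolding K_def
      by (auto simp: free_bar_mult hecke_ideal_closed simp del: free_algebra_simps(1) intro!: free_algebra_closed)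
  qed
  moreover have "hecke_relators W S \<subseteq> K"
    using hecke_relators_carrier free_bar_relator by (fastforce simp: K_def)
  ultimately have "hecke_ideal W S \<subseteq> K"
    unfolding hecke_ideal_def by (rule free_alg.genideal_minimal)
  then show ?thesis using assms by (auto simp: K_def)
qed

lemma hecke_gen_inv:
  assumes "s \<in> S"
  shows "inv\<^bsub>hecke W S\<^esub> (hecke_gen W S s) =
    hecke_proj W S (Poly_Mapping.single [s] 1 - Poly_Mapping.single [] (q_var - q_inv))"
proof -
  interpret H: ring "hecke W S" by (rule hecke_ring)
  let ?g = "Poly_Mapping.single [s] 1 - Poly_Mapping.single [] (q_var - q_inv)"
  have car: "Poly_Mapping.single [s] 1 \<in> carrier (free_algebra S)" "?g \<in> carrier (free_algebra S)"
    using assms by (simp_all del: free_algebra_simps add: free_algebra_closed single_in_free_algebra)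
  have "[s] \<in> lists S" using assms by simp
  from bar_word_inverse[OF this, of W]
  have "Poly_Mapping.single [s] 1 * ?g - 1 \<in> hecke_ideal W S" "?g * Poly_Mapping.single [s] 1 - 1 \<in> hecke_ideal W S"
    by (simp_all add: bar_word_simps)
  then have "hecke_gen W S s \<otimes>\<^bsub>hecke W S\<^esub> hecke_proj W S ?g = \<one>\<^bsub>hecke W S\<^esub>"
    "hecke_proj W S ?g \<otimes>\<^bsub>hecke W S\<^esub> hecke_gen W S s = \<one>\<^bsub>hecke W S\<^esub>"
    using car unfolding hecke_gen_proj
    by (simp_all del: free_algebra_simps add: hecke_proj_simps free_algebra_closed single_in_free_algebra
        hecke_proj_simps(4)[OF car(1)])
  then show ?thesis
    using H.inv_char[of "hecke_gen W S s" "hecke_proj W S ?g"] hecke_gen_closed[OF assms, of W]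
      hecke_proj_simps(1)[OF car(2), of W]
    by simp
qed

text \<open>The bar involution is induced by \<^const>\<open>free_bar\<close>; this shows that the definite description
  in \<^const>\<open>hecke_bar\<close> is well defined.\<close>

lemma hecke_bar_gen:
  assumes "s \<in> S"
  shows "hecke_bar W S (hecke_gen W S s) =
    hecke_proj W S (Poly_Mapping.single [s] 1 - Poly_Mapping.single [] (q_var - q_inv))"
proof -
  interpret H: ring "hecke W S" by (rule hecke_ring)
  define P where "P \<beta> \<longleftrightarrow> \<beta> \<in> extensional (carrier (hecke W S)) \<and>
     \<beta> \<in> ring_hom (hecke W S) (hecke W S) \<and>
     (\<forall>h \<in> carrier (hecke W S). \<beta> (\<beta> h) = h) \<and>
     (\<forall>a. \<beta> (hecke_scalar W S a) = hecke_scalar W S (laurent_bar a)) \<and>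
     (\<forall>s \<in> S. \<beta> (hecke_gen W S s) = inv\<^bsub>hecke W S\<^esub> (hecke_gen W S s))" for \<beta>
  define \<beta> where "\<beta> = restrict (\<lambda>X. hecke_proj W S (free_bar
    (SOME f. f \<in> carrier (free_algebra S) \<and> hecke_proj W S f = X))) (carrier (hecke W S))"
  have \<beta>: "\<beta> (hecke_proj W S f) = hecke_proj W S (free_bar f)" if f: "f \<in> carrier (free_algebra S)" for f
  proof -
    define g where "g = (SOME g. g \<in> carrier (free_algebra S) \<and> hecke_proj W S g = hecke_proj W S f)"
    have g: "g \<in> carrier (free_algebra S) \<and> hecke_proj W S g = hecke_proj W S f"
      unfolding g_def by (rule someI[of _ f]) (use f in simp)
    then have "g - f \<in> hecke_ideal W S" using hecke_proj_simps(5) f by blast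
    then have "free_bar g - free_bar f \<in> hecke_ideal W S"
      using free_bar_ideal[of "g - f" W S] by (simp add: free_bar_diff)
    then have "hecke_proj W S (free_bar g) = hecke_proj W S (free_bar f)"
      using hecke_proj_simps(5)[OF free_bar_closed[of g S] free_bar_closed[OF f]] g by blast
    then show ?thesis
      using hecke_proj_simps(1)[OF f, of W] by (simp add: \<beta>_def g_def)
  qed
  have "P \<beta>"
    unfolding P_def
  proof (intro conjI ballI allI)
    show "\<beta> \<in> extensional (carrier (hecke W S))" by (simp add: \<beta>_def)
    have [simp]: "Poly_Mapping.single [] a \<in> carrier (free_algebra S)" for a
      by (simp add: single_in_free_algebra)
    show "\<beta> \<in> ring_hom (hecke W S) (hecke W S)"
    proof (rule ring_hom_memI)
      fix x assume "x \<in> carrier (hecke W S)"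
      then obtain f where f: "f \<in> carrier (free_algebra S)" "x = hecke_proj W S f" by (rule hecke_carrierE)
      then show "\<beta> x \<in> carrier (hecke W S)" by (simp add: \<beta> hecke_proj_simps(1) free_bar_closed del: free_algebra_simps)
      fix y assume "y \<in> carrier (hecke W S)"
      then obtain g where g: "g \<in> carrier (free_algebra S)" "y = hecke_proj W S g" by (rule hecke_carrierE)
      show "\<beta> (x \<otimes>\<^bsub>hecke W S\<^esub> y) = \<beta> x \<otimes>\<^bsub>hecke W S\<^esub> \<beta> y" "\<beta> (x \<oplus>\<^bsub>hecke W S\<^esub> y) = \<beta> x \<oplus>\<^bsub>hecke W S\<^esub> \<beta> y"
        using f g by (simp_all add: \<beta> hecke_proj_simps(2,3) free_bar_closed free_algebra_closed free_bar_add free_bar_mult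
            del: free_algebra_simps)
    next
      show "\<beta> \<one>\<^bsub>hecke W S\<^esub> = \<one>\<^bsub>hecke W S\<^esub>"
        using \<beta>[of 1] hecke_proj_simps(4)[of 1 S W] single_in_free_algebra(2)[of S]
        by (simp del: free_algebra_simps add: free_bar_one)
    qed
    show "\<beta> (\<beta> h) = h" if "h \<in> carrier (hecke W S)" for h
      using that by (rule hecke_carrierE) (simp add: \<beta> free_bar_closed free_bar_bar del: free_algebra_simps)
    show "\<beta> (hecke_scalar W S a) = hecke_scalar W S (laurent_bar a)" for a
      by (simp add: hecke_scalar_proj \<beta> free_bar_single bar_word_simps)
    show "\<beta> (hecke_gen W S s) = inv\<^bsub>hecke W S\<^esub> (hecke_gen W S s)" if "s \<in> S" for s
      using that by (subst hecke_gen_inv)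
        (simp_all add: hecke_gen_proj \<beta> free_bar_single bar_word_simps single_Nil_one)
  qed
  \<comment> \<open>Two candidates agree on scalars and generators, hence on the carrier;
    extensionality fixes the values outside it.\<close>
  moreover have "\<gamma> = \<beta>" if "P \<gamma>" for \<gamma>
  proof -
    have hom: "\<gamma> \<in> ring_hom (hecke W S) (hecke W S)" "\<beta> \<in> ring_hom (hecke W S) (hecke W S)"
      using that \<open>P \<beta>\<close> by (auto simp: P_def)
    have "\<gamma> h = \<beta> h" if "h \<in> carrier (hecke W S)" for h
      using that
      by (induction h rule: hecke_induct)
        (use \<open>P \<gamma>\<close> \<open>P \<beta>\<close> in \<open>auto simp: P_def ring_hom_add[OF hom(1)] ring_hom_add[OF hom(2)]
          ring_hom_mult[OF hom(1)] ring_hom_mult[OF hom(2)]\<close>)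
    then show ?thesis
      using that \<open>P \<beta>\<close> by (intro extensionalityI[of _ "carrier (hecke W S)"]) (auto simp: P_def)
  qed
  ultimately have "hecke_bar W S = \<beta>"
    unfolding hecke_bar_def P_def[symmetric] by (rule the_equality)
  then show ?thesis
    using \<open>P \<beta>\<close> assms hecke_gen_inv[OF assms, of W] by (auto simp: P_def)
qed

section \<open>Coxeter systems\<close>

text \<open>Every relator (s t)^m has even length. This is the sign character, and it is the reason
  why left multiplication by a generator always changes the length.\<close>

lemma coxeter_cong_parity:
  assumes "coxeter_cong W S xs ys"
  shows "even (length xs) \<longleftrightarrow> even (length ys)"
  using assms
proof induction
  case (rel xs ys s t)
  have "even (length (concat (replicate n [s, t])))" for n
    by (induction n) auto
  then show ?case by simp
qed auto

context coxeter_system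
begin

abbreviation len :: "'a \<Rightarrow> nat" where "len \<equiv> cox_length W S"

lemma S_closed: "s \<in> S \<Longrightarrow> s \<in> carrier W"
  using S_carrier by auto

lemma S_square: "s \<in> S \<Longrightarrow> s \<otimes> s = \<one>"
  using S_order_two by auto

lemma S_cancel: "\<lbrakk>s \<in> S; w \<in> carrier W\<rbrakk> \<Longrightarrow> s \<otimes> (s \<otimes> w) = w"
  by (simp add: m_assoc[symmetric] S_closed S_square)

lemma S_inv: "s \<in> S \<Longrightarrow> inv s = s"
  using S_square S_closed by (intro inv_equality) auto

lemma word_prod_simps [simp]:
  "word_prod W [] = \<one>" "word_prod W (x # xs) = x \<otimes> word_prod W xs"
  by (simp_all add: word_prod_def)

lemma word_prod_closed: "set xs \<subseteq> S \<Longrightarrow> word_prod W xs \<in> carrier W"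
  by (induction xs) (auto simp: S_closed)

lemma word_prod_append:
  "set xs \<subseteq> S \<Longrightarrow> set ys \<subseteq> S \<Longrightarrow> word_prod W (xs @ ys) = word_prod W xs \<otimes> word_prod W ys"
  by (induction xs) (auto simp: S_closed word_prod_closed m_assoc)

lemma ex_word:
  assumes "w \<in> carrier W"
  shows "\<exists>xs. set xs \<subseteq> S \<and> word_prod W xs = w"
proof -
  have "w \<in> generate W S" using assms S_generates by simp
  then show ?thesis
  proof induction
    case one
    show ?case by (rule exI[of _ "[]"]) simp
  next
    case (incl h)
    then show ?case by (intro exI[of _ "[h]"]) (simp add: S_closed)
  next
    case (inv h)
    then show ?case by (intro exI[of _ "[h]"]) (simp add: S_closed S_inv)
  next
    case (eng h1 h2)
    then obtain xs ys where "set xs \<subseteq> S" "word_prod W xs = h1" "set ys \<subseteq> S" "word_prod W ys = h2" by blast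
    then show ?case by (intro exI[of _ "xs @ ys"]) (simp add: word_prod_append)
  qed
qed

lemma ex_reduced_word:
  assumes "w \<in> carrier W"
  obtains xs where "set xs \<subseteq> S" "word_prod W xs = w" "length xs = len w"
proof -
  have "\<exists>n. \<exists>xs\<in>lists S. length xs = n \<and> word_prod W xs = w"
    using ex_word[OF assms] by (auto simp: lists_eq_set)
  from LeastI_ex[OF this] show ?thesis
    using that unfolding cox_length_def by (auto simp: lists_eq_set)
qed

lemma len_word_prod_le: "set xs \<subseteq> S \<Longrightarrow> len (word_prod W xs) \<le> length xs"
  unfolding cox_length_def by (rule Least_le) (auto simp: lists_eq_set)

lemma len_word_prod_parity:
  assumes "set xs \<subseteq> S"
  shows "even (len (word_prod W xs)) \<longleftrightarrow> even (length xs)"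
proof -
  obtain ys where ys: "set ys \<subseteq> S" "word_prod W ys = word_prod W xs" "length ys = len (word_prod W xs)"
    using ex_reduced_word[OF word_prod_closed[OF assms]] .
  then have "coxeter_cong W S ys xs" using assms by (intro S_presentation) auto
  then show ?thesis using coxeter_cong_parity ys(3) by metis
qed

lemma len_mult_gen_le:
  assumes "s \<in> S" "w \<in> carrier W"
  shows "len (s \<otimes> w) \<le> Suc (len w)"
proof -
  obtain xs where "set xs \<subseteq> S" "word_prod W xs = w" "length xs = len w"
    using ex_reduced_word[OF assms(2)] .
  then show ?thesis using len_word_prod_le[of "s # xs"] assms(1) by simp
qed

lemma len_mult_gen_parity:
  assumes "s \<in> S" "w \<in> carrier W"
  shows "even (len (s \<otimes> w)) \<longleftrightarrow> odd (len w)"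
proof -
  obtain xs where "set xs \<subseteq> S" "word_prod W xs = w" "length xs = len w"
    using ex_reduced_word[OF assms(2)] .
  then show ?thesis using len_word_prod_parity[of "s # xs"] assms(1) by simp
qed

lemma len_mult_gen_neq: "\<lbrakk>s \<in> S; w \<in> carrier W\<rbrakk> \<Longrightarrow> len (s \<otimes> w) \<noteq> len w"
  using len_mult_gen_parity[of s w] by auto

lemma len_one [simp]: "len \<one> = 0"
  using len_word_prod_le[of "[]"] by simp

lemma len_eq_0: "\<lbrakk>w \<in> carrier W; len w = 0\<rbrakk> \<Longrightarrow> w = \<one>"
  by (erule ex_reduced_word) simp

lemma ex_left_descent:
  assumes "w \<in> carrier W" "len w > 0"
  obtains s where "s \<in> S" "len (s \<otimes> w) < len w"
proof -
  obtain xs where xs: "set xs \<subseteq> S" "word_prod W xs = w" "length xs = len w"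
    using ex_reduced_word[OF assms(1)] .
  then obtain s ys where "xs = s # ys" using assms(2) by (cases xs) auto
  then have s: "s \<in> S" "set ys \<subseteq> S" "w = s \<otimes> word_prod W ys" "Suc (length ys) = len w" using xs by auto
  have "s \<otimes> w = word_prod W ys" using s S_cancel word_prod_closed by simp
  then have "len (s \<otimes> w) < len w" using len_word_prod_le[OF s(2)] s(4) by simp
  then show ?thesis using that s(1) by blast
qed

section \<open>Bruhat order and left weak order compared with length\<close>

lemma bruhat_le_len:
  assumes "bruhat_le W S u w"
  shows "len u \<le> len w" "u \<noteq> w \<Longrightarrow> len u < len w"
proof -
  have "(\<lambda>x y. \<exists>t\<in>reflections W S. y = x \<otimes> t \<and> len x < len y)\<^sup>*\<^sup>* u w"
    using assms by (simp add: bruhat_le_def)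
  then have "u = w \<or> len u < len w"
    by (induction rule: rtranclp_induct) auto
  then show "len u \<le> len w" "u \<noteq> w \<Longrightarrow> len u < len w" by auto
qed

lemma bruhat_less_len: "bruhat_less W S u w \<Longrightarrow> len u < len w"
  using bruhat_le_len by (auto simp: bruhat_less_def)

lemma bruhat_less_trans:
  assumes "bruhat_less W S u v" "bruhat_less W S v w"
  shows "bruhat_less W S u w"
proof -
  have "bruhat_le W S u w"
    using assms unfolding bruhat_less_def bruhat_le_def by (blast intro: rtranclp_trans)
  moreover have "len u < len w"
    using bruhat_less_len[OF assms(1)] bruhat_less_len[OF assms(2)] by simp
  ultimately show ?thesis by (auto simp: bruhat_less_def)
qed

lemma bruhat_less_gen_iff:
  assumes "s \<in> S" "w \<in> carrier W"
  shows "bruhat_less W S w (s \<otimes> w) \<longleftrightarrow> len w < len (s \<otimes> w)"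
proof
  assume *: "len w < len (s \<otimes> w)"
  \<comment> \<open>Bruhat steps multiply by reflections on the right, so s w is rewritten as w
    (w^-1 s w).\<close>
  have "inv w \<otimes> s \<otimes> inv (inv w) \<in> reflections W S"
    unfolding reflections_def using assms by blast
  moreover have "s \<otimes> w = w \<otimes> (inv w \<otimes> s \<otimes> inv (inv w))"
    using assms by (simp add: S_closed m_assoc[symmetric])
  ultimately have "bruhat_le W S w (s \<otimes> w)"
    unfolding bruhat_le_def using assms * by (intro conjI r_into_rtranclp) auto
  then show "bruhat_less W S w (s \<otimes> w)" using * by (auto simp: bruhat_less_def)
qed (rule bruhat_less_len)

lemma bruhat_less_gen_iff':
  assumes "s \<in> S" "w \<in> carrier W"
  shows "bruhat_less W S (s \<otimes> w) w \<longleftrightarrow> len (s \<otimes> w) < len w"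
  using bruhat_less_gen_iff[OF assms(1), of "s \<otimes> w"] assms S_cancel[OF assms] S_closed[OF assms(1)] by simp

lemma left_weak_le_gen:
  assumes "s \<in> S" "w \<in> carrier W" "len (s \<otimes> w) < len w"
  shows "left_weak_le W S (s \<otimes> w) w"
proof -
  have "w \<otimes> inv (s \<otimes> w) = s"
    using assms by (simp add: inv_mult_group S_closed m_assoc[symmetric] S_inv)
  moreover have "len w \<le> Suc (len (s \<otimes> w))"
    using len_mult_gen_le[OF assms(1), of "s \<otimes> w"] assms S_cancel[OF assms(1,2)] S_closed[OF assms(1)] by simp
  moreover have "len s = 1"
    using len_mult_gen_le[OF assms(1) one_closed] len_mult_gen_neq[OF assms(1) one_closed]
    unfolding r_one[OF S_closed[OF assms(1)]] len_one by linarith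
  ultimately show ?thesis
    using assms by (simp add: left_weak_le_def S_closed)
qed

end

section \<open>Ascents and descents for an ideal of the left weak order\<close>

locale coxeter_ideal = coxeter_system +
  fixes J I :: "'a set"
  assumes weak_ideal: "weak_ideal W S I"
    and J_Pos: "J \<subseteq> Pos W S I"
begin

lemma I_carrier: "w \<in> I \<Longrightarrow> w \<in> carrier W"
  using weak_ideal by (auto simp: weak_ideal_def)

lemma I_D_set: "w \<in> I \<Longrightarrow> w \<in> D_set W S J"
  using J_Pos I_carrier by (auto simp: D_set_def Pos_def)

lemma I_lower:
  assumes "s \<in> S" "w \<in> I" "len (s \<otimes> w) < len w"
  shows "s \<otimes> w \<in> I"
  using weak_ideal left_weak_le_gen[OF assms(1) I_carrier[OF assms(2)] assms(3)] assms(2)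
  by (auto simp: weak_ideal_def)

lemma SD_iff: "w \<in> carrier W \<Longrightarrow> s \<in> SD W S w \<longleftrightarrow> s \<in> S \<and> len (s \<otimes> w) < len w"
  by (auto simp: SD_def bruhat_less_gen_iff')

lemma SA_iff: "w \<in> carrier W \<Longrightarrow> s \<in> SA W S I w \<longleftrightarrow> s \<in> S \<and> len w < len (s \<otimes> w) \<and> s \<otimes> w \<in> I"
  by (auto simp: SA_def bruhat_less_gen_iff)

lemma WA_iff: "w \<in> carrier W \<Longrightarrow>
    s \<in> WA W S J I w \<longleftrightarrow> s \<in> S \<and> len w < len (s \<otimes> w) \<and> s \<otimes> w \<in> D_set W S J \<and> s \<otimes> w \<notin> I"
  by (auto simp: WA_def bruhat_less_gen_iff)

lemma WD_iff: "w \<in> carrier W \<Longrightarrow>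
    s \<in> WD W S J w \<longleftrightarrow> s \<in> S \<and> len w < len (s \<otimes> w) \<and> s \<otimes> w \<notin> D_set W S J"
  by (auto simp: WD_def bruhat_less_gen_iff)

text \<open>An element s w outside D_J is automatically longer than w: a shorter one is a suffix of
  w, so it lies in \<open>I\<close> and hence in D_J.\<close>

lemma descents_iff:
  assumes "w \<in> I"
  shows "s \<in> descents W S J w \<longleftrightarrow> s \<in> S \<and> (len (s \<otimes> w) < len w \<or> s \<otimes> w \<notin> D_set W S J)"
proof (cases "s \<in> S")
  case True
  note w = I_carrier[OF assms]
  have "s \<otimes> w \<in> D_set W S J" if "len (s \<otimes> w) < len w"
    using I_D_set[OF I_lower[OF True assms that]] .
  then show ?thesis
    using len_mult_gen_neq[OF True w] True unfolding descents_def Un_iff SD_iff[OF w] WD_iff[OF w] by linarith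
qed (auto simp: descents_def SD_def WD_def)

lemma ascent_cases:
  assumes "w \<in> I" "s \<in> S" "s \<notin> descents W S J w"
  shows "s \<in> SA W S I w \<or> s \<in> WA W S J I w"
  using assms(2,3) len_mult_gen_neq[OF assms(2) I_carrier[OF assms(1)]]
  unfolding descents_iff[OF assms(1)] SA_iff[OF I_carrier[OF assms(1)]] WA_iff[OF I_carrier[OF assms(1)]]
  by linarith

lemma SD_lower:
  assumes "w \<in> I" "s \<in> SD W S w"
  shows "s \<in> S" "s \<otimes> w \<in> I" "s \<in> SA W S I (s \<otimes> w)" "s \<otimes> (s \<otimes> w) = w" "len (s \<otimes> w) < len w"
proof -
  note w = I_carrier[OF assms(1)]
  show s: "s \<in> S" and l: "len (s \<otimes> w) < len w" using assms(2) by (auto simp: SD_iff[OF w])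
  show sw: "s \<otimes> w \<in> I" by (rule I_lower[OF s assms(1) l])
  show c: "s \<otimes> (s \<otimes> w) = w" by (rule S_cancel[OF s w])
  show "s \<in> SA W S I (s \<otimes> w)" unfolding SA_iff[OF I_carrier[OF sw]] c using s l assms(1) by blast
qed

lemma SA_upper:
  assumes "w \<in> I" "s \<in> SA W S I w"
  shows "s \<in> S" "s \<otimes> w \<in> I" "s \<in> SD W S (s \<otimes> w)" "s \<in> descents W S J (s \<otimes> w)"
    "s \<notin> descents W S J w" "s \<otimes> (s \<otimes> w) = w"
proof -
  note w = I_carrier[OF assms(1)]
  show s: "s \<in> S" and sw: "s \<otimes> w \<in> I" using assms(2) by (auto simp: SA_iff[OF w])
  have l: "len w < len (s \<otimes> w)" using assms(2) by (auto simp: SA_iff[OF w])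
  show c: "s \<otimes> (s \<otimes> w) = w" by (rule S_cancel[OF s w])
  show "s \<in> SD W S (s \<otimes> w)" unfolding SD_iff[OF I_carrier[OF sw]] c using s l by blast
  then show "s \<in> descents W S J (s \<otimes> w)" by (simp add: descents_def)
  show "s \<notin> descents W S J w" unfolding descents_iff[OF assms(1)] using l I_D_set[OF sw] by auto
qed

lemma ex_SD:
  assumes "w \<in> I" "w \<noteq> \<one>"
  obtains s where "s \<in> SD W S w"
proof -
  note w = I_carrier[OF assms(1)]
  then have "len w > 0" using assms(2) len_eq_0 by blast
  from ex_left_descent[OF w this] show ?thesis using that unfolding SD_iff[OF w] by blast
qed

end

section \<open>The action on the \<open>W\<close>-graph basis in coordinates\<close>

definition smul :: "laurent \<Rightarrow> ('i \<Rightarrow>\<^sub>0 laurent) \<Rightarrow> 'i \<Rightarrow>\<^sub>0 laurent" where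
  "smul a f = Poly_Mapping.map ((*) a) f"

lemma lookup_smul [simp]: "Poly_Mapping.lookup (smul a f) i = a * Poly_Mapping.lookup f i"
  by (simp add: smul_def map.rep_eq when_def)

lemma smul_simps [simp]:
  "smul a 0 = 0" "smul 0 f = 0" "smul 1 f = f"
  "smul a (smul b f) = smul (a * b) f"
  "smul a (Poly_Mapping.single i b) = Poly_Mapping.single i (a * b)"
  by (rule poly_mapping_eqI, simp add: mult.assoc lookup_single when_def)+

lemma smul_distribs:
  "smul a (f + g) = smul a f + smul a g" "smul a (f - g) = smul a f - smul a g"
  "smul (a + b) f = smul a f + smul b f" "smul (a - b) f = smul a f - smul b f"
  "smul (- a) f = - smul a f" "smul a (- f) = - smul a f"
  by (rule poly_mapping_eqI, simp add: lookup_add lookup_minus algebra_simps)+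

lemma smul_sum: "smul a (\<Sum>x\<in>A. f x) = (\<Sum>x\<in>A. smul a (f x))"
  by (induction A rule: infinite_finite_induct) (simp_all add: smul_distribs)

lemma keys_smul: "Poly_Mapping.keys (smul a f) \<subseteq> Poly_Mapping.keys f"
  by (auto simp: in_keys_iff)

definition vbar :: "('i \<Rightarrow>\<^sub>0 laurent) \<Rightarrow> 'i \<Rightarrow>\<^sub>0 laurent" where
  "vbar f = Poly_Mapping.map laurent_bar f"

lemma lookup_vbar [simp]: "Poly_Mapping.lookup (vbar f) i = laurent_bar (Poly_Mapping.lookup f i)"
  by (simp add: vbar_def map.rep_eq when_def)

lemma vbar_simps [simp]:
  "vbar (f + g) = vbar f + vbar g" "vbar (f - g) = vbar f - vbar g" "vbar (smul a f) = smul (laurent_bar a) (vbar f)"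
  "vbar (Poly_Mapping.single i a) = Poly_Mapping.single i (laurent_bar a)" "vbar (vbar f) = f"
  by (rule poly_mapping_eqI, simp add: lookup_add lookup_minus lookup_single when_def)+

lemma keys_vbar: "Poly_Mapping.keys (vbar f) \<subseteq> Poly_Mapping.keys f"
  by (auto simp: in_keys_iff)

section \<open>The subring \<int>[q], its ideal q\<int>[q], and bar-invariant elements\<close>

lemma laurent_pos_iff: "a \<in> laurent_pos \<longleftrightarrow> (\<forall>k<0. Poly_Mapping.lookup a k = 0)"
  unfolding laurent_pos_def mem_Collect_eq by (metis in_keys_iff not_le)

lemma lookup_single_mult:
  "Poly_Mapping.lookup (Poly_Mapping.single k 1 * a) n = Poly_Mapping.lookup (a :: laurent) (n - k)"
  by (induction a rule: poly_mapping_add_induct[OF subset_UNIV, case_names zero single add])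
    (auto simp: mult_single lookup_add lookup_single when_def distrib_left)

lemma lookup_q_mult [simp]:
  "Poly_Mapping.lookup (q_var * a) n = Poly_Mapping.lookup a (n - 1)"
  "Poly_Mapping.lookup (q_inv * a) n = Poly_Mapping.lookup a (n + 1)"
  by (simp_all add: q_var_def q_inv_def lookup_single_mult)

definition laurent_qpos :: "laurent set" where
  "laurent_qpos = (*) q_var ` laurent_pos"

lemma laurent_qpos_iff: "a \<in> laurent_qpos \<longleftrightarrow> (\<forall>k\<le>0. Poly_Mapping.lookup a k = 0)"
proof
  assume *: "\<forall>k\<le>0. Poly_Mapping.lookup a k = 0"
  have "a = q_var * (q_inv * a)" by (simp add: mult.assoc[symmetric])
  moreover have "q_inv * a \<in> laurent_pos" using * by (simp add: laurent_pos_iff)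
  ultimately show "a \<in> laurent_qpos" unfolding laurent_qpos_def by (rule image_eqI)
qed (auto simp: laurent_qpos_def laurent_pos_iff)

lemma laurent_pos_closed:
  "0 \<in> laurent_pos" "1 \<in> laurent_pos" "q_var \<in> laurent_pos" "of_int n \<in> laurent_pos"
  "a \<in> laurent_pos \<Longrightarrow> b \<in> laurent_pos \<Longrightarrow> a + b \<in> laurent_pos"
  "a \<in> laurent_pos \<Longrightarrow> b \<in> laurent_pos \<Longrightarrow> a * b \<in> laurent_pos"
  "a \<in> laurent_qpos \<Longrightarrow> a \<in> laurent_pos"
proof -
  show "a * b \<in> laurent_pos" if "a \<in> laurent_pos" "b \<in> laurent_pos"
    using keys_mult[of a b] that unfolding laurent_pos_def by fastforce
qed (auto simp: laurent_pos_iff laurent_qpos_iff lookup_add lookup_of_int q_var_def lookup_single lookup_one when_def)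

lemma laurent_pos_minus: "a \<in> laurent_pos \<Longrightarrow> b \<in> laurent_pos \<Longrightarrow> a - b \<in> laurent_pos"
  by (simp add: laurent_pos_iff lookup_minus)

lemma laurent_qpos_closed:
  "0 \<in> laurent_qpos"
  "a \<in> laurent_pos \<Longrightarrow> q_var * a \<in> laurent_qpos"
  "a \<in> laurent_qpos \<Longrightarrow> b \<in> laurent_qpos \<Longrightarrow> a + b \<in> laurent_qpos"
  "a \<in> laurent_qpos \<Longrightarrow> b \<in> laurent_qpos \<Longrightarrow> a - b \<in> laurent_qpos"
  "a \<in> laurent_qpos \<Longrightarrow> - a \<in> laurent_qpos"
  "a \<in> laurent_qpos \<Longrightarrow> b \<in> laurent_pos \<Longrightarrow> a * b \<in> laurent_qpos"
proof -
  show "a * b \<in> laurent_qpos" if ab: "a \<in> laurent_qpos" "b \<in> laurent_pos"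
  proof -
    obtain c where "a = q_var * c" "c \<in> laurent_pos" using ab(1) by (auto simp: laurent_qpos_def)
    then show ?thesis using laurent_pos_closed(6)[of c b] ab(2) by (auto simp: laurent_qpos_def mult.assoc)
  qed
qed (auto simp: laurent_qpos_iff laurent_pos_iff lookup_add lookup_minus)

lemma laurent_pos_minus_const:
  "a \<in> laurent_pos \<Longrightarrow> a - of_int (Poly_Mapping.lookup a 0) \<in> laurent_qpos"
  by (auto simp: laurent_qpos_iff laurent_pos_iff lookup_minus lookup_of_int when_def order_le_less)

lemma sum_laurent_qpos: "(\<And>x. x \<in> A \<Longrightarrow> f x \<in> laurent_qpos) \<Longrightarrow> sum f A \<in> laurent_qpos"
  by (induction A rule: infinite_finite_induct) (auto intro: laurent_qpos_closed)

lemma sum_laurent_pos: "(\<And>x. x \<in> A \<Longrightarrow> f x \<in> laurent_pos) \<Longrightarrow> sum f A \<in> laurent_pos"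
  by (induction A rule: infinite_finite_induct) (auto intro: laurent_pos_closed)

lemma laurent_bar_of_int [simp]: "laurent_bar (of_int n) = of_int n"
  by (rule poly_mapping_eqI) (auto simp: lookup_of_int when_def)

text \<open>Bar invariance makes the coefficients symmetric about exponent 0. This is the rigidity
  behind all Kazhdan--Lusztig uniqueness arguments.\<close>

lemma bar_invariant_qpos_zero:
  assumes "a \<in> laurent_qpos" "laurent_bar a = a"
  shows "a = 0"
proof (rule poly_mapping_eqI)
  fix k
  have "Poly_Mapping.lookup a k = Poly_Mapping.lookup a (- k)"
    using lookup_laurent_bar[of a k] assms(2) by simp
  then show "Poly_Mapping.lookup a k = Poly_Mapping.lookup 0 k"
    using assms(1) by (cases "k \<le> 0") (auto simp: laurent_qpos_iff)
qed

lemma bar_invariant_eq_of_int: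
  assumes "a - of_int n \<in> laurent_qpos" "laurent_bar a = a"
  shows "a = of_int n"
  using bar_invariant_qpos_zero[OF assms(1)] assms(2) by simp

text \<open>A bar-invariant element of \<open>\<int>[q]\<close> is constant, and \<open>(q\<^sup>2 + 1) a\<close> has positive degree
  unless \<open>a = 0\<close>.\<close>

lemma q_square_mult_bar_invariant:
  assumes a: "a \<in> laurent_pos" and bar: "laurent_bar ((q_var * q_var + 1) * a) = (q_var * q_var + 1) * a"
  shows "a = 0"
proof (rule ccontr)
  assume "a \<noteq> 0"
  then have ne: "Poly_Mapping.keys a \<noteq> {}" by simp
  define m where "m = Max (Poly_Mapping.keys a)"
  have m: "m \<in> Poly_Mapping.keys a" unfolding m_def using ne by (intro Max_in) auto
  have "m \<ge> 0" using m a by (simp add: laurent_pos_def)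
  have "m + 2 \<notin> Poly_Mapping.keys a"
  proof
    assume "m + 2 \<in> Poly_Mapping.keys a"
    then have "m + 2 \<le> m" unfolding m_def by (intro Max_ge) auto
    then show False by simp
  qed
  moreover have "- (m + 2) \<notin> Poly_Mapping.keys a" "- (m + 2) - 2 \<notin> Poly_Mapping.keys a"
    using a \<open>m \<ge> 0\<close> by (auto simp: laurent_pos_def)
  moreover have look: "Poly_Mapping.lookup ((q_var * q_var + 1) * a) k =
      Poly_Mapping.lookup a (k - 2) + Poly_Mapping.lookup a k" for k
    by (simp add: distrib_right lookup_add mult.assoc)
  moreover have "Poly_Mapping.lookup ((q_var * q_var + 1) * a) (m + 2) =
      Poly_Mapping.lookup ((q_var * q_var + 1) * a) (- (m + 2))"
    using lookup_laurent_bar[of "(q_var * q_var + 1) * a" "m + 2"] unfolding bar by simp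
  ultimately show False using m unfolding look by (simp add: in_keys_iff)
qed

text \<open>Coordinates of \<open>b\<^sub>w\<close> in the \<open>W\<close>-graph basis.\<close>

definition bcoord :: "('w \<Rightarrow> 'w \<Rightarrow>\<^sub>0 laurent) \<Rightarrow> 'w \<Rightarrow> 'w \<Rightarrow>\<^sub>0 laurent" where
  "bcoord Q w = Poly_Mapping.single w 1 + smul q_var (Q w)"

lemma lookup_bcoord:
  "Poly_Mapping.lookup (bcoord Q w) z = (if z = w then 1 else 0) + q_var * Poly_Mapping.lookup (Q w) z"
  by (simp add: bcoord_def lookup_add lookup_single when_def)

definition edge_sum :: "('w, 'g) monoid_scheme \<Rightarrow> 'w set \<Rightarrow> 'w set \<Rightarrow> 'w set \<Rightarrow>
    ('w \<Rightarrow> 'w \<Rightarrow>\<^sub>0 laurent) \<Rightarrow> 'w \<Rightarrow> 'w \<Rightarrow> 'w \<Rightarrow>\<^sub>0 laurent" where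
  "edge_sum W S J I Q s w =
     (if s \<in> SA W S I w then Poly_Mapping.single (s \<otimes>\<^bsub>W\<^esub> w) 1 else 0) +
     (\<Sum>y \<in> {y \<in> Poly_Mapping.keys (Q w). s \<in> descents W S J y}.
        Poly_Mapping.single y (of_int (mu_coeff Q y w)))"

lemma lookup_edge_sum:
  "Poly_Mapping.lookup (edge_sum W S J I Q s w) z =
     of_int ((if s \<in> SA W S I w \<and> z = s \<otimes>\<^bsub>W\<^esub> w then 1 else 0) +
       (if s \<in> descents W S J z then mu_coeff Q z w else 0))"
proof -
  have "Poly_Mapping.lookup (\<Sum>y \<in> {y \<in> Poly_Mapping.keys (Q w). s \<in> descents W S J y}.
        Poly_Mapping.single y (of_int (mu_coeff Q y w) :: laurent)) z =
      (\<Sum>y \<in> {y \<in> Poly_Mapping.keys (Q w). s \<in> descents W S J y}.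
        if y = z then of_int (mu_coeff Q y w) else 0)"
    unfolding lookup_sum by (rule sum.cong) (auto simp: lookup_single when_def)
  also have "\<dots> = (if s \<in> descents W S J z then of_int (mu_coeff Q z w) else 0)"
    by (auto simp: in_keys_iff mu_coeff_def)
  finally show ?thesis
    by (auto simp: edge_sum_def lookup_add lookup_single when_def)
qed

text \<open>The data of a \<open>W\<close>-graph ideal module, transported to finitely supported functions on \<open>I\<close> by means
  of its \<open>W\<close>-graph basis: \<open>T s\<close> is the action of \<open>T\<^sub>s\<close>, and the involution becomes \<^const>\<open>vbar\<close>.\<close>

locale W_graph_coords = coxeter_ideal +
  fixes T :: "'a \<Rightarrow> ('a \<Rightarrow>\<^sub>0 laurent) \<Rightarrow> 'a \<Rightarrow>\<^sub>0 laurent" and Q :: "'a \<Rightarrow> 'a \<Rightarrow>\<^sub>0 laurent"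
  assumes T_closed: "\<lbrakk>s \<in> S; Poly_Mapping.keys f \<subseteq> I\<rbrakk> \<Longrightarrow> Poly_Mapping.keys (T s f) \<subseteq> I"
    and T_add: "\<lbrakk>s \<in> S; Poly_Mapping.keys f \<subseteq> I; Poly_Mapping.keys g \<subseteq> I\<rbrakk> \<Longrightarrow> T s (f + g) = T s f + T s g"
    and T_smul: "\<lbrakk>s \<in> S; Poly_Mapping.keys f \<subseteq> I\<rbrakk> \<Longrightarrow> T s (smul a f) = smul a (T s f)"
    and T_square: "\<lbrakk>s \<in> S; Poly_Mapping.keys f \<subseteq> I\<rbrakk> \<Longrightarrow> T s (T s f) = f + smul (q_var - q_inv) (T s f)"
    and T_bar: "\<lbrakk>s \<in> S; Poly_Mapping.keys f \<subseteq> I\<rbrakk> \<Longrightarrow>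
      vbar (T s f) = T s (vbar f) - smul (q_var - q_inv) (vbar f)"
    and Q_keys: "w \<in> I \<Longrightarrow> Poly_Mapping.keys (Q w) \<subseteq> {y \<in> I. bruhat_less W S y w}"
    and Q_pos: "w \<in> I \<Longrightarrow> Poly_Mapping.lookup (Q w) y \<in> laurent_pos"
    and T_SA: "\<lbrakk>w \<in> I; s \<in> SA W S I w\<rbrakk> \<Longrightarrow> T s (bcoord Q w) = bcoord Q (s \<otimes> w)"
    and T_WD: "\<lbrakk>w \<in> I; s \<in> WD W S J w\<rbrakk> \<Longrightarrow> T s (bcoord Q w) = smul (- q_inv) (bcoord Q w)"
    and T_WA: "\<lbrakk>w \<in> I; s \<in> WA W S J I w\<rbrakk> \<Longrightarrow> \<exists>r. Poly_Mapping.keys r \<subseteq> I \<and>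
      (\<forall>y. Poly_Mapping.lookup r y \<in> laurent_qpos) \<and>
      T s (bcoord Q w) = smul q_var (bcoord Q w) -
        (\<Sum>y\<in>Poly_Mapping.keys r. smul (Poly_Mapping.lookup r y) (bcoord Q y))"
begin

section \<open>The bar-invariant operator T_s - q\<close>

definition U :: "'a \<Rightarrow> ('a \<Rightarrow>\<^sub>0 laurent) \<Rightarrow> 'a \<Rightarrow>\<^sub>0 laurent" where
  "U s f = T s f - smul q_var f"

lemma keys_add_I: "Poly_Mapping.keys f \<subseteq> I \<Longrightarrow> Poly_Mapping.keys g \<subseteq> I \<Longrightarrow> Poly_Mapping.keys (f + g) \<subseteq> I"
  and keys_minus_I: "Poly_Mapping.keys f \<subseteq> I \<Longrightarrow> Poly_Mapping.keys g \<subseteq> I \<Longrightarrow> Poly_Mapping.keys (f - g) \<subseteq> I"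
  and keys_smul_I: "Poly_Mapping.keys f \<subseteq> I \<Longrightarrow> Poly_Mapping.keys (smul a f) \<subseteq> I"
  and keys_vbar_I: "Poly_Mapping.keys f \<subseteq> I \<Longrightarrow> Poly_Mapping.keys (vbar f) \<subseteq> I"
  and keys_single_I: "w \<in> I \<Longrightarrow> Poly_Mapping.keys (Poly_Mapping.single w a) \<subseteq> I"
  for f g :: "'a \<Rightarrow>\<^sub>0 laurent" and a :: laurent
  using keys_add[of f g] keys_minus_subset[of f g] keys_smul[of a f] keys_vbar[of f] by auto

lemma keys_Q_I: "w \<in> I \<Longrightarrow> Poly_Mapping.keys (Q w) \<subseteq> I"
  using Q_keys by blast

lemma keys_bcoord_I: "w \<in> I \<Longrightarrow> Poly_Mapping.keys (bcoord Q w) \<subseteq> I"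
  unfolding bcoord_def by (intro keys_add_I keys_smul_I keys_single_I keys_Q_I)

lemma keys_sum_I:
  fixes F :: "'i \<Rightarrow> 'a \<Rightarrow>\<^sub>0 laurent"
  shows "(\<And>x. x \<in> A \<Longrightarrow> Poly_Mapping.keys (F x) \<subseteq> I) \<Longrightarrow> Poly_Mapping.keys (sum F A) \<subseteq> I"
proof (induction A rule: infinite_finite_induct)
  case (insert x A)
  then show ?case using keys_add_I[of "F x" "sum F A"] by simp
qed auto

lemmas keys_I = keys_add_I keys_minus_I keys_smul_I keys_vbar_I keys_single_I keys_Q_I keys_bcoord_I
  keys_sum_I T_closed

lemma U_closed: "\<lbrakk>s \<in> S; Poly_Mapping.keys f \<subseteq> I\<rbrakk> \<Longrightarrow> Poly_Mapping.keys (U s f) \<subseteq> I"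
  unfolding U_def by (intro keys_I)

lemma T_zero: "s \<in> S \<Longrightarrow> T s 0 = 0"
  using T_add[of s 0 0] by simp

lemma U_add: "\<lbrakk>s \<in> S; Poly_Mapping.keys f \<subseteq> I; Poly_Mapping.keys g \<subseteq> I\<rbrakk> \<Longrightarrow> U s (f + g) = U s f + U s g"
  by (simp add: U_def T_add smul_distribs)

lemma U_smul: "\<lbrakk>s \<in> S; Poly_Mapping.keys f \<subseteq> I\<rbrakk> \<Longrightarrow> U s (smul a f) = smul a (U s f)"
  by (simp add: U_def T_smul smul_distribs mult.commute)

lemma U_diff:
  assumes "s \<in> S" "Poly_Mapping.keys f \<subseteq> I" "Poly_Mapping.keys g \<subseteq> I"
  shows "U s (f - g) = U s f - U s g"
  using U_add[OF assms(1) keys_minus_I[OF assms(2,3)] assms(3)] by simp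

lemma U_sum:
  assumes "s \<in> S" "\<And>x. x \<in> A \<Longrightarrow> Poly_Mapping.keys (F x) \<subseteq> I"
  shows "U s (sum F A) = (\<Sum>x\<in>A. U s (F x))"
  using assms(2)
proof (induction A rule: infinite_finite_induct)
  case (insert x A)
  have "Poly_Mapping.keys (F x) \<subseteq> I" "Poly_Mapping.keys (sum F A) \<subseteq> I"
    using insert.prems keys_sum_I[of A F] by blast+
  then show ?case using insert U_add[OF assms(1)] by simp
qed (simp_all add: U_def T_zero assms(1))

lemma U_single:
  assumes "s \<in> S" "w \<in> I"
  shows "U s (Poly_Mapping.single w a) = smul a (U s (Poly_Mapping.single w 1))"
  using U_smul[OF assms(1) keys_single_I[OF assms(2)], of a 1] by simp

lemma U_expand:
  assumes "s \<in> S" "Poly_Mapping.keys f \<subseteq> I"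
  shows "U s f = (\<Sum>k\<in>Poly_Mapping.keys f. smul (Poly_Mapping.lookup f k) (U s (Poly_Mapping.single k 1)))"
proof -
  have "U s f = U s (\<Sum>k\<in>Poly_Mapping.keys f. Poly_Mapping.single k (Poly_Mapping.lookup f k))"
    by (simp add: poly_mapping_sum_single)
  also have "\<dots> = (\<Sum>k\<in>Poly_Mapping.keys f. U s (Poly_Mapping.single k (Poly_Mapping.lookup f k)))"
    by (rule U_sum[OF assms(1)]) (use assms(2) in auto)
  also have "\<dots> = (\<Sum>k\<in>Poly_Mapping.keys f. smul (Poly_Mapping.lookup f k) (U s (Poly_Mapping.single k 1)))"
    by (rule sum.cong[OF HOL.refl], rule U_single) (use assms in auto)
  finally show ?thesis .
qed

text \<open>The quadratic relation reads (T_s - q)(T_s + q^-1) = 0, so on its own image T_s - q acts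
  by -(q + q^-1).\<close>

lemma U_U:
  assumes "s \<in> S" "Poly_Mapping.keys f \<subseteq> I"
  shows "U s (U s f) = smul (- (q_var + q_inv)) (U s f)"
proof -
  have "U s (U s f) = U s (T s f) - smul q_var (U s f)"
    using assms U_diff[of s "T s f" "smul q_var f"] U_smul[of s f q_var] by (simp add: U_def[of s f] keys_I)
  also have "\<dots> = smul (- (q_var + q_inv)) (U s f)"
    using assms by (simp add: U_def T_square smul_distribs distrib_right left_diff_distrib)
  finally show ?thesis .
qed

lemma U_bar:
  assumes "s \<in> S" "w \<in> I"
  shows "vbar (U s (Poly_Mapping.single w 1)) = U s (Poly_Mapping.single w 1)"
  using T_bar[OF assms(1) keys_single_I[OF assms(2)], of 1]
  by (simp add: U_def single_diff)

lemma U_bar_lookup: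
  assumes "s \<in> S" "w \<in> I"
  shows "laurent_bar (Poly_Mapping.lookup (U s (Poly_Mapping.single w 1)) z) = Poly_Mapping.lookup (U s (Poly_Mapping.single w 1)) z"
  using arg_cong[OF U_bar[OF assms], of "\<lambda>f. Poly_Mapping.lookup f z"] by simp

text \<open>Obtained by solving b_w = c_w + q (sum of q_{y,w} c_y) for c_w. It drives the recursion:
  the axioms govern b_w, and the correction involves only y below w.\<close>

lemma U_basis_eq:
  assumes "s \<in> S" "w \<in> I"
  shows "U s (Poly_Mapping.single w 1) = U s (bcoord Q w) -
    (\<Sum>y\<in>Poly_Mapping.keys (Q w). smul (q_var * Poly_Mapping.lookup (Q w) y) (U s (Poly_Mapping.single y 1)))"
proof -
  have "U s (bcoord Q w) = U s (Poly_Mapping.single w 1) + smul q_var (U s (Q w))"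
    unfolding bcoord_def using assms keys_smul_I[OF keys_Q_I[OF assms(2)], of q_var]
    by (subst U_add) (simp_all add: U_smul keys_Q_I)
  also have "smul q_var (U s (Q w)) =
      (\<Sum>y\<in>Poly_Mapping.keys (Q w). smul (q_var * Poly_Mapping.lookup (Q w) y) (U s (Poly_Mapping.single y 1)))"
    by (subst U_expand[OF assms(1) keys_Q_I[OF assms(2)]]) (simp add: smul_sum)
  finally show ?thesis by simp
qed

lemma edge_sum_descent:
  assumes "w \<in> I" "Poly_Mapping.lookup (edge_sum W S J I Q s w) z \<noteq> 0"
  shows "s \<in> descents W S J z"
proof (rule ccontr)
  assume "s \<notin> descents W S J z"
  then show False using assms SA_upper(4)[of w s] by (auto simp: lookup_edge_sum split: if_splits)
qed

lemma bcoord_pos: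
  assumes "w \<in> I"
  shows "Poly_Mapping.lookup (bcoord Q w) z \<in> laurent_pos"
  unfolding lookup_bcoord using Q_pos[OF assms] by (auto intro!: laurent_pos_closed(1-6))

text \<open>Modulo q\<int>[q] the coordinate vector of each b_y is the unit vector at y. For a
  strong ascent the value is b_sw - q b_w; for a weak ascent it is minus the sum of the r b_y, whose
  coefficients r lie in q\<int>[q].\<close>

lemma U_bcoord_ascent:
  assumes "w \<in> I" "s \<in> S" "s \<notin> descents W S J w"
  shows "Poly_Mapping.lookup (U s (bcoord Q w)) z - of_int (if s \<in> SA W S I w \<and> z = s \<otimes> w then 1 else 0)
    \<in> laurent_qpos"
  using ascent_cases[OF assms]
proof
  assume SA: "s \<in> SA W S I w"
  have "Poly_Mapping.lookup (U s (bcoord Q w)) z - of_int (if s \<in> SA W S I w \<and> z = s \<otimes> w then 1 else 0) =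
      q_var * Poly_Mapping.lookup (Q (s \<otimes> w)) z - q_var * Poly_Mapping.lookup (bcoord Q w) z"
    using SA unfolding U_def T_SA[OF assms(1) SA] by (simp add: lookup_minus lookup_bcoord[of Q "s \<otimes> w"])
  then show ?thesis
    using Q_pos[OF SA_upper(2)[OF assms(1) SA]] bcoord_pos[OF assms(1)] by (auto intro!: laurent_qpos_closed)
next
  assume WA: "s \<in> WA W S J I w"
  then have "s \<notin> SA W S I w" by (auto simp: WA_def SA_def)
  moreover obtain r where r: "Poly_Mapping.keys r \<subseteq> I" "\<And>y. Poly_Mapping.lookup r y \<in> laurent_qpos"
      "T s (bcoord Q w) = smul q_var (bcoord Q w) -
        (\<Sum>y\<in>Poly_Mapping.keys r. smul (Poly_Mapping.lookup r y) (bcoord Q y))"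
    using T_WA[OF assms(1) WA] by blast
  have "Poly_Mapping.lookup (U s (bcoord Q w)) z =
      - (\<Sum>y\<in>Poly_Mapping.keys r. Poly_Mapping.lookup r y * Poly_Mapping.lookup (bcoord Q y) z)"
    unfolding U_def r(3) by (simp add: lookup_sum)
  moreover have "\<dots> \<in> laurent_qpos"
    using r(1,2) bcoord_pos by (intro laurent_qpos_closed(5,6) sum_laurent_qpos) auto
  ultimately show ?thesis by simp
qed

text \<open>In the coordinate \<open>z\<close> the ascent case holds up to an element of \<open>q\<int>[q]\<close>, and both sides are
  bar-invariant. For a strong descent \<open>s\<close>, the basis element \<open>c\<^sub>w\<close> is by induction, up to elements on which
  \<open>T\<^sub>s\<close> acts by \<open>-q\<^sup>-\<^sup>1\<close>, of the form \<open>(T\<^sub>s - q) c\<^sub>s\<^sub>w\<close>. For a weak descent, the coefficients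
  \<open>q\<^sub>z\<^sub>,\<^sub>w\<close> at vertices \<open>z\<close> without the descent \<open>s\<close> have to vanish.\<close>

theorem U_basis:
  assumes "w \<in> I" "s \<in> S"
  shows "U s (Poly_Mapping.single w 1) =
    (if s \<in> descents W S J w then Poly_Mapping.single w (- (q_var + q_inv)) else edge_sum W S J I Q s w)"
  using assms(1)
proof (induction "len w" arbitrary: w rule: less_induct)
  case less
  note w = less.prems
  let ?X = "\<lambda>w. U s (Poly_Mapping.single w 1)"
  let ?D = "\<lambda>w. s \<in> descents W S J w"
  have IH: "?X y = (if ?D y then Poly_Mapping.single y (- (q_var + q_inv)) else edge_sum W S J I Q s y)"
    if "y \<in> Poly_Mapping.keys (Q w)" for y
    using less.hyps[of y] Q_keys[OF w] that bruhat_less_len by auto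
  have keyI: "y \<in> I" if "y \<in> Poly_Mapping.keys (Q w)" for y using that keys_Q_I[OF w] by auto
  note Xeq = U_basis_eq[OF \<open>s \<in> S\<close> w]
  consider (A) "\<not> ?D w" | (SD) "s \<in> SD W S w" | (WD) "s \<in> WD W S J w"
    by (auto simp: descents_def)
  then show ?case
  proof cases
    case A
    have "Poly_Mapping.lookup (?X w) z = Poly_Mapping.lookup (edge_sum W S J I Q s w) z" for z
    proof -
      let ?Qz = "Poly_Mapping.lookup (Q w) z"
      let ?c = "\<lambda>y. q_var * Poly_Mapping.lookup (Q w) y * Poly_Mapping.lookup (?X y) z"
      let ?\<mu> = "if ?D z then mu_coeff Q z w else 0"
      have split: "Poly_Mapping.lookup (?X w) z = Poly_Mapping.lookup (U s (bcoord Q w)) z - sum ?c (Poly_Mapping.keys (Q w))"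
        by (subst Xeq) (simp add: lookup_minus lookup_sum)
      \<comment> \<open>Modulo q\<int>[q] only y = z with descent s contributes: there q q_{z,w} is
        multiplied by -(q + q^-1), giving -q^2 q_{z,w} - q_{z,w}, whose constant term is -mu. If s
        is not a descent of y, the coordinate is an integer and the factor q survives.\<close>
      have c: "?c y + (if y = z then of_int ?\<mu> else 0) \<in> laurent_qpos" if y: "y \<in> Poly_Mapping.keys (Q w)" for y
      proof (cases "?D y")
        case True
        show ?thesis
        proof (cases "y = z")
          case False
          then show ?thesis using IH[OF y] True by (simp add: lookup_single when_def laurent_qpos_closed)
        next
          case z: True
          have "?c y + (if y = z then of_int ?\<mu> else 0) = - (q_var * (q_var * ?Qz)) - (?Qz - of_int (Poly_Mapping.lookup ?Qz 0))"
            using IH[OF y] True z by (simp add: mu_coeff_def algebra_simps)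
          then show ?thesis
            using laurent_pos_minus_const[OF Q_pos[OF w, of z]] Q_pos[OF w, of z]
            by (auto intro!: laurent_qpos_closed laurent_pos_closed)
        qed
      next
        case False
        then have "?c y \<in> laurent_qpos"
          using IH[OF y] Q_pos[OF w]
          by (auto simp: lookup_edge_sum intro!: laurent_qpos_closed(1,2,6) laurent_pos_closed(1-6))
        moreover have "(if y = z then of_int ?\<mu> else 0) = (0 :: laurent)" using False by auto
        ultimately show ?thesis by simp
      qed
      \<comment> \<open>This includes z outside the support of \<open>Q w\<close>, where both sides
        vanish because \<open>mu_coeff\<close> does.\<close>
      have \<mu>: "(\<Sum>y\<in>Poly_Mapping.keys (Q w). if y = z then of_int ?\<mu> else 0) = (of_int ?\<mu> :: laurent)"
        by (auto simp: in_keys_iff mu_coeff_def)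
      have "sum ?c (Poly_Mapping.keys (Q w)) +
          (\<Sum>y\<in>Poly_Mapping.keys (Q w). if y = z then of_int ?\<mu> else 0) \<in> laurent_qpos"
        unfolding sum.distrib[symmetric] using c by (rule sum_laurent_qpos)
      then have low: "sum ?c (Poly_Mapping.keys (Q w)) + of_int ?\<mu> \<in> laurent_qpos"
        unfolding \<mu> .
      have regroup: "a - of_int m - (b + of_int n) = (a - b) - of_int (m + n)" for a b :: laurent and m n
        by simp
      from laurent_qpos_closed(4)[OF U_bcoord_ascent[OF w \<open>s \<in> S\<close> A, of z] low]
      have "Poly_Mapping.lookup (?X w) z -
          of_int ((if s \<in> SA W S I w \<and> z = s \<otimes> w then 1 else 0) + ?\<mu>) \<in> laurent_qpos"
        unfolding regroup split .
      from bar_invariant_eq_of_int[OF this U_bar_lookup[OF \<open>s \<in> S\<close> w]]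
      show ?thesis by (simp only: lookup_edge_sum)
    qed
    then show ?thesis using A by (simp add: poly_mapping_eqI)
  next
    case SD
    let ?v = "s \<otimes> w"
    note v = SD_lower[OF w SD]
    have Xv: "?X ?v = edge_sum W S J I Q s ?v"
      using less.hyps[OF v(5) v(2)] SA_upper(5)[OF v(2,3)] by simp
    let ?K = "{y \<in> Poly_Mapping.keys (Q ?v). ?D y}"
    let ?R = "\<Sum>y\<in>?K. Poly_Mapping.single y (of_int (mu_coeff Q y ?v) :: laurent)"
    have K: "y \<in> I" "len y < len w" if "y \<in> ?K" for y
      using that Q_keys[OF v(2)] bruhat_less_len[of y ?v] v(5) by auto
    have RI: "Poly_Mapping.keys ?R \<subseteq> I" by (rule keys_sum_I) (use K in auto)
    have "U s ?R = (\<Sum>y\<in>?K. smul (of_int (mu_coeff Q y ?v)) (?X y))"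
      using \<open>s \<in> S\<close> K by (subst U_sum) (auto simp: U_single[of s _ "of_int _"] intro!: sum.cong)
    also have "\<dots> = smul (- (q_var + q_inv)) ?R"
      unfolding smul_sum using K less.hyps by (intro sum.cong) (auto simp: mult.commute)
    finally have UR: "U s ?R = smul (- (q_var + q_inv)) ?R" .
    \<comment> \<open>s is a strong ascent of the shorter element s w, and its upper neighbour there
      is w itself with weight 1.\<close>
    have eq: "Poly_Mapping.single w 1 = ?X ?v - ?R"
      unfolding Xv edge_sum_def using v by simp
    have "?X w = U s (?X ?v) - U s ?R"
      unfolding eq using v RI by (intro U_diff U_closed keys_single_I)
    also have "\<dots> = smul (- (q_var + q_inv)) (?X ?v - ?R)"
      unfolding UR using U_U[OF v(1) keys_single_I[OF v(2)]] by (simp add: smul_distribs)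
    also have "\<dots> = Poly_Mapping.single w (- (q_var + q_inv))"
      unfolding eq[symmetric] by simp
    finally show ?thesis using SD by (simp add: descents_def)
  next
    case WD
    have D: "?D w" using WD by (simp add: descents_def)
    have UB: "U s (bcoord Q w) = smul (- (q_var + q_inv)) (bcoord Q w)"
      unfolding U_def T_WD[OF w WD] by (simp add: smul_distribs)
    \<comment> \<open>By induction no (T_s - q) c_y with y below w has a component at a vertex z
      without descent s. So this coordinate of (T_s - q) c_w comes from b_w alone: it is -(q^2 + 1)
      q_{z,w}, and it is bar-invariant.\<close>
    have zero: "Poly_Mapping.lookup (Q w) z = 0" if z: "\<not> ?D z" for z
    proof -
      have "Poly_Mapping.lookup (?X y) z = 0" if y: "y \<in> Poly_Mapping.keys (Q w)" for y
        using IH[OF y] z edge_sum_descent[OF keyI[OF y], of s z] by (auto simp: lookup_single when_def)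
      then have "Poly_Mapping.lookup (?X w) z = - (q_var + q_inv) * (q_var * Poly_Mapping.lookup (Q w) z)"
        using z D by (subst Xeq) (auto simp: UB lookup_minus lookup_sum lookup_bcoord)
      also have "\<dots> = - ((q_var * q_var + 1) * Poly_Mapping.lookup (Q w) z)"
        by (simp add: algebra_simps)
      finally have "(q_var * q_var + 1) * Poly_Mapping.lookup (Q w) z = - Poly_Mapping.lookup (?X w) z" by simp
      then have "laurent_bar ((q_var * q_var + 1) * Poly_Mapping.lookup (Q w) z) =
          (q_var * q_var + 1) * Poly_Mapping.lookup (Q w) z"
        using U_bar_lookup[OF \<open>s \<in> S\<close> w, of z] by (simp only: laurent_bar_uminus)
      then show ?thesis by (rule q_square_mult_bar_invariant[OF Q_pos[OF w]])
    qed
    have "smul (q_var * Poly_Mapping.lookup (Q w) y) (?X y) =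
        smul (- (q_var + q_inv) * q_var) (Poly_Mapping.single y (Poly_Mapping.lookup (Q w) y))"
      if y: "y \<in> Poly_Mapping.keys (Q w)" for y
      using IH[OF y] y zero[of y] by (auto simp: in_keys_iff mult_ac)
    then have "(\<Sum>y\<in>Poly_Mapping.keys (Q w). smul (q_var * Poly_Mapping.lookup (Q w) y) (?X y)) =
        smul (- (q_var + q_inv) * q_var) (Q w)"
      by (simp only: sum.cong[OF HOL.refl] smul_sum[symmetric] poly_mapping_sum_single)
    then have "?X w = smul (- (q_var + q_inv)) (bcoord Q w) - smul (- (q_var + q_inv) * q_var) (Q w)"
      unfolding Xeq UB by simp
    also have "\<dots> = Poly_Mapping.single w (- (q_var + q_inv))"
      unfolding bcoord_def smul_distribs(1) smul_simps(4,5) by simp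
    finally show ?thesis using D by simp
  qed
qed

end

text \<open>Nothing relates \<open>T\<close> and \<open>T'\<close> directly. But
  \<open>U_basis\<close> expresses both actions on c_k through the polynomials of k alone, so
  agreement on elements shorter than w makes T_s b_v agree for v = s w < w, and this vector is
  b_w.\<close>

lemma W_graph_coords_unique:
  assumes "W_graph_coords W S J I T Q" "W_graph_coords W S J I T' Q'" "w \<in> I"
  shows "Q w = Q' w"
proof -
  interpret A: W_graph_coords W S J I T Q by fact
  interpret B: W_graph_coords W S J I T' Q' by fact
  show ?thesis
    using assms(3)
  proof (induction "A.len w" arbitrary: w rule: less_induct)
    case less
    show ?case
    proof (cases "w = \<one>\<^bsub>W\<^esub>")
      case True
      have "Poly_Mapping.keys (Q w) = {}" "Poly_Mapping.keys (Q' w) = {}"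
        using A.Q_keys[OF less.prems] B.Q_keys[OF less.prems] A.bruhat_less_len[of _ w] True by fastforce+
      then show ?thesis by simp
    next
      case False
      then obtain s where s: "s \<in> SD W S w" using A.ex_SD[OF less.prems] by blast
      note v = A.SD_lower[OF less.prems s]
      let ?v = "s \<otimes>\<^bsub>W\<^esub> w"
      have Qv: "Q ?v = Q' ?v" using less.hyps v by blast
      have "A.U s (Poly_Mapping.single k 1) = B.U s (Poly_Mapping.single k 1)"
        if "k \<in> Poly_Mapping.keys (bcoord Q ?v)" for k
      proof -
        have "k \<in> I" using that A.keys_bcoord_I[OF v(2)] by blast
        moreover have "A.len k < A.len w"
          using that A.Q_keys[OF v(2)] A.bruhat_less_len[of k ?v] v(5)
          \<comment> \<open>The support of b_v consists of v and elements below v, all shorter than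
            w, so the induction hypothesis applies to every k.\<close>
          by (auto simp: in_keys_iff lookup_bcoord split: if_splits)
        ultimately show ?thesis
          using less.hyps[of k] by (simp add: A.U_basis B.U_basis v(1) edge_sum_def mu_coeff_def)
      qed
      then have "A.U s (bcoord Q ?v) = B.U s (bcoord Q ?v)"
        using v by (simp add: A.U_expand[OF _ A.keys_bcoord_I] B.U_expand[OF _ A.keys_bcoord_I])
      then have "bcoord Q w = bcoord Q' w"
        using A.T_SA[OF v(2,3)] B.T_SA[OF v(2,3)] v(4) by (simp add: A.U_def B.U_def bcoord_def Qv)
      then have "smul q_inv (smul q_var (Q w)) = smul q_inv (smul q_var (Q' w))" by (simp add: bcoord_def)
      then show ?thesis by simp
    qed
  qed
qed

section \<open>Hecke modules with a basis\<close>

text \<open>The linear map whose matrix has the columns \<open>B k\<close>; on function modules it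
  takes the place of \<open>lin_comb\<close>.\<close>

definition comb :: "('i \<Rightarrow> 'j \<Rightarrow>\<^sub>0 laurent) \<Rightarrow> ('i \<Rightarrow>\<^sub>0 laurent) \<Rightarrow> 'j \<Rightarrow>\<^sub>0 laurent" where
  "comb B f = (\<Sum>k\<in>Poly_Mapping.keys f. smul (Poly_Mapping.lookup f k) (B k))"

lemma comb_add: "comb B (f + g) = comb B f + comb B g"
  unfolding comb_def by (rule setsum_keys_plus_distrib) (simp_all add: smul_distribs)

lemma comb_diff: "comb B (f - g) = comb B f - comb B g"
  using comb_add[of B "f - g" g] by (simp add: eq_diff_eq)

lemma comb_single: "comb B (Poly_Mapping.single k a) = smul a (B k)"
  by (simp add: comb_def)

lemma comb_zero [simp]: "comb B 0 = 0"
  by (simp add: comb_def)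

lemma comb_smul: "comb B (smul a f) = smul a (comb B f)"
  by (induction f rule: poly_mapping_add_induct[OF subset_UNIV, case_names zero single add])
    (simp_all add: comb_add comb_single smul_distribs)

lemma comb_comb: "comb B (comb G f) = comb (\<lambda>k. comb B (G k)) f"
  by (induction f rule: poly_mapping_add_induct[OF subset_UNIV, case_names zero single add])
    (simp_all add: comb_add comb_single comb_smul)

lemma comb_basis: "comb (\<lambda>k. Poly_Mapping.single k 1) f = f"
  by (simp add: comb_def poly_mapping_sum_single)

lemma comb_cong: "(\<And>k. k \<in> Poly_Mapping.keys f \<Longrightarrow> B k = B' k) \<Longrightarrow> comb B f = comb B' f"
  by (simp add: comb_def)

lemma lookup_comb:
  "Poly_Mapping.lookup (comb B f) z = (\<Sum>k\<in>Poly_Mapping.keys f. Poly_Mapping.lookup f k * Poly_Mapping.lookup (B k) z)"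
  by (simp add: comb_def lookup_sum)

lemma keys_comb:
  assumes "z \<in> Poly_Mapping.keys (comb B f)"
  obtains k where "k \<in> Poly_Mapping.keys f" "z \<in> Poly_Mapping.keys (B k)"
proof -
  have "(\<Sum>k\<in>Poly_Mapping.keys f. Poly_Mapping.lookup f k * Poly_Mapping.lookup (B k) z) \<noteq> 0"
    using assms by (simp add: in_keys_iff lookup_comb)
  then obtain k where "k \<in> Poly_Mapping.keys f" "Poly_Mapping.lookup f k * Poly_Mapping.lookup (B k) z \<noteq> 0"
    by (meson sum.neutral)
  then show ?thesis using that[of k] by (auto simp: in_keys_iff)
qed

section \<open>Scalars, generators and linear combinations in a Hecke module\<close>

locale hecke_module = left_module "hecke W S" M
  for W :: "('w, 'g) monoid_scheme" and S :: "'w set" and M :: "('w hecke_elt, 'm) module"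
begin

lemma scal_closed: "x \<in> carrier M \<Longrightarrow> scal W S M a x \<in> carrier M"
  by (simp add: scal_def smult_closed hecke_scalar_closed)

lemma act_closed: "\<lbrakk>s \<in> S; x \<in> carrier M\<rbrakk> \<Longrightarrow> act W S M s x \<in> carrier M"
  by (simp add: act_def smult_closed hecke_gen_closed)

lemma scal_simps:
  assumes "x \<in> carrier M"
  shows "scal W S M (a + b) x = scal W S M a x \<oplus>\<^bsub>M\<^esub> scal W S M b x"
    "scal W S M (a * b) x = scal W S M a (scal W S M b x)"
    "scal W S M 1 x = x"
    "y \<in> carrier M \<Longrightarrow> scal W S M a (x \<oplus>\<^bsub>M\<^esub> y) = scal W S M a x \<oplus>\<^bsub>M\<^esub> scal W S M a y"
  using assms
  by (simp_all add: scal_def hecke_scalar_hom smult_l_distr smult_r_distr smult_assoc smult_one hecke_scalar_closed)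

lemma scal_zero_left:
  assumes "x \<in> carrier M"
  shows "scal W S M 0 x = \<zero>\<^bsub>M\<^esub>"
  using scal_simps(1)[OF assms, of 0 0] scal_closed[OF assms, of 0]
  by (metis M.add.r_cancel_one' add_0)

lemma act_add: "\<lbrakk>s \<in> S; x \<in> carrier M; y \<in> carrier M\<rbrakk> \<Longrightarrow>
    act W S M s (x \<oplus>\<^bsub>M\<^esub> y) = act W S M s x \<oplus>\<^bsub>M\<^esub> act W S M s y"
  by (simp add: act_def smult_r_distr hecke_gen_closed)

lemma act_scal:
  assumes "s \<in> S" "x \<in> carrier M"
  shows "act W S M s (scal W S M a x) = scal W S M a (act W S M s x)"
  using assms hecke_scalar_commute[OF hecke_gen_closed[OF assms(1), of W], of a]
  by (simp add: act_def scal_def smult_assoc[symmetric] hecke_gen_closed hecke_scalar_closed)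

lemma act_square:
  assumes "s \<in> S" "x \<in> carrier M"
  shows "act W S M s (act W S M s x) = x \<oplus>\<^bsub>M\<^esub> scal W S M (q_var - q_inv) (act W S M s x)"
proof -
  have "act W S M s (act W S M s x) = (hecke_gen W S s \<otimes>\<^bsub>hecke W S\<^esub> hecke_gen W S s) \<odot>\<^bsub>M\<^esub> x"
    using assms by (simp add: act_def smult_assoc hecke_gen_closed)
  also have "\<dots> = x \<oplus>\<^bsub>M\<^esub> scal W S M (q_var - q_inv) (act W S M s x)"
    unfolding hecke_gen_square[OF assms(1)]
    using assms by (simp add: act_def scal_def smult_l_distr smult_assoc smult_one hecke_gen_closed hecke_scalar_closed)
  finally show ?thesis .
qed

text \<open>Sums over different supports are brought to one index set; the additional coefficients
  are 0.\<close>

lemma lin_comb_superset: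
  assumes "b ` A \<subseteq> carrier M" "finite A" "Poly_Mapping.keys f \<subseteq> A"
  shows "lin_comb W S M b f = (\<Oplus>\<^bsub>M\<^esub>i\<in>A. scal W S M (Poly_Mapping.lookup f i) (b i))"
  unfolding lin_comb_def
  using assms by (intro M.add.finprod_mono_neutral_cong_left)
    (auto simp: in_keys_iff image_subset_iff intro!: scal_closed scal_zero_left)

lemma lin_comb_closed:
  "b ` Poly_Mapping.keys f \<subseteq> carrier M \<Longrightarrow> lin_comb W S M b f \<in> carrier M"
  unfolding lin_comb_def by (intro M.finsum_closed) (auto intro!: scal_closed)

lemma lin_comb_zero [simp]: "lin_comb W S M b 0 = \<zero>\<^bsub>M\<^esub>"
  by (simp add: lin_comb_def)

lemma lin_comb_add:
  assumes "b ` Poly_Mapping.keys f \<subseteq> carrier M" "b ` Poly_Mapping.keys g \<subseteq> carrier M"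
  shows "lin_comb W S M b (f + g) = lin_comb W S M b f \<oplus>\<^bsub>M\<^esub> lin_comb W S M b g"
proof -
  let ?A = "Poly_Mapping.keys f \<union> Poly_Mapping.keys g"
  have A: "b ` ?A \<subseteq> carrier M" "finite ?A" using assms by auto
  have "lin_comb W S M b (f + g) = (\<Oplus>\<^bsub>M\<^esub>i\<in>?A. scal W S M (Poly_Mapping.lookup f i) (b i) \<oplus>\<^bsub>M\<^esub>
      scal W S M (Poly_Mapping.lookup g i) (b i))"
    unfolding lin_comb_superset[OF A keys_add]
    using A by (intro M.finsum_cong') (auto simp: lookup_add scal_simps image_subset_iff intro!: scal_closed)
  also have "\<dots> = lin_comb W S M b f \<oplus>\<^bsub>M\<^esub> lin_comb W S M b g"
    using A lin_comb_superset[OF A, of f] lin_comb_superset[OF A, of g]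
    by (subst M.finsum_addf) (auto simp: image_subset_iff intro!: scal_closed)
  finally show ?thesis .
qed

lemma lin_comb_single:
  assumes "b k \<in> carrier M"
  shows "lin_comb W S M b (Poly_Mapping.single k a) = scal W S M a (b k)"
  using assms by (subst lin_comb_superset[of _ "{k}"]) (auto simp: scal_closed)

lemma lin_comb_smul:
  assumes "b ` I \<subseteq> carrier M" "Poly_Mapping.keys f \<subseteq> I"
  shows "lin_comb W S M b (smul a f) = scal W S M a (lin_comb W S M b f)"
  using assms(2)
proof (induction f rule: poly_mapping_add_induct)
  case zero
  have "scal W S M a \<zero>\<^bsub>M\<^esub> = \<zero>\<^bsub>M\<^esub>"
    using scal_simps(2)[of "\<zero>\<^bsub>M\<^esub>" a 0] by (simp add: scal_zero_left)
  then show ?case by simp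
next
  case (single k v)
  then have "b k \<in> carrier M" using assms(1) by auto
  then show ?case by (simp add: lin_comb_single scal_simps(2))
next
  case (add f g)
  have c: "b ` Poly_Mapping.keys f \<subseteq> carrier M" "b ` Poly_Mapping.keys g \<subseteq> carrier M"
    "b ` Poly_Mapping.keys (smul a f) \<subseteq> carrier M" "b ` Poly_Mapping.keys (smul a g) \<subseteq> carrier M"
    using add.hyps assms(1) keys_smul[of a f] keys_smul[of a g] by blast+
  show ?case
    using add c by (simp add: smul_distribs(1) lin_comb_add scal_simps(4) lin_comb_closed)
qed

text \<open>Change of basis, with \<open>B\<close> as transition matrix: it turns the correction
  terms in the b_y into coordinates with respect to the c_y.\<close>

lemma lin_comb_comb:
  assumes "c ` I \<subseteq> carrier M" "Poly_Mapping.keys f \<subseteq> I"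
    and B: "\<And>k. k \<in> I \<Longrightarrow> Poly_Mapping.keys (B k) \<subseteq> I \<and> b k = lin_comb W S M c (B k)"
  shows "lin_comb W S M b f = lin_comb W S M c (comb B f)"
  using assms(2)
proof (induction f rule: poly_mapping_add_induct)
  case (single k v)
  then have "Poly_Mapping.keys (B k) \<subseteq> I" "b k = lin_comb W S M c (B k)" using B by auto
  moreover from this have "b k \<in> carrier M" using assms(1) by (auto intro!: lin_comb_closed)
  ultimately show ?case using assms(1) by (simp add: lin_comb_single comb_single lin_comb_smul)
next
  case (add f g)
  have *: "c ` Poly_Mapping.keys (comb B f) \<subseteq> carrier M" if "Poly_Mapping.keys f \<subseteq> I" for f
    using assms(1) B that by (force elim!: keys_comb)
  have **: "b ` Poly_Mapping.keys f \<subseteq> carrier M" if f: "Poly_Mapping.keys f \<subseteq> I" for f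
  proof
    fix x assume "x \<in> b ` Poly_Mapping.keys f"
    then obtain k where "k \<in> I" "x = b k" using f by auto
    then have "x = lin_comb W S M c (B k)" "Poly_Mapping.keys (B k) \<subseteq> I" using B by auto
    then show "x \<in> carrier M" using assms(1) by (auto intro!: lin_comb_closed)
  qed
  show ?case
    using add by (simp add: comb_add lin_comb_add * **)
qed simp

end

section \<open>Coordinates with respect to a basis\<close>

locale hecke_based_module = hecke_module +
  fixes I :: "'i set" and c :: "'i \<Rightarrow> 'c"
  assumes basis: "is_basis W S M I c"
begin

lemma c_closed: "c ` I \<subseteq> carrier M"
  using basis by (simp add: is_basis_def)

definition coord :: "'c \<Rightarrow> 'i \<Rightarrow>\<^sub>0 laurent" where
  "coord x = (SOME f. Poly_Mapping.keys f \<subseteq> I \<and> lin_comb W S M c f = x)"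

abbreviation lift :: "('i \<Rightarrow>\<^sub>0 laurent) \<Rightarrow> 'c" where
  "lift \<equiv> lin_comb W S M c"

lemma coord:
  assumes "x \<in> carrier M"
  shows "Poly_Mapping.keys (coord x) \<subseteq> I" "lift (coord x) = x"
proof -
  have "\<exists>f. Poly_Mapping.keys f \<subseteq> I \<and> lift f = x" using basis assms by (auto simp: is_basis_def)
  from someI_ex[OF this] show "Poly_Mapping.keys (coord x) \<subseteq> I" "lift (coord x) = x"
    unfolding coord_def by auto
qed

lemma image_keys: "Poly_Mapping.keys f \<subseteq> I \<Longrightarrow> c ` Poly_Mapping.keys f \<subseteq> carrier M"
  using c_closed by blast

lemma lift_closed: "Poly_Mapping.keys f \<subseteq> I \<Longrightarrow> lift f \<in> carrier M"
  by (intro lin_comb_closed image_keys)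

lemma lift_add: "\<lbrakk>Poly_Mapping.keys f \<subseteq> I; Poly_Mapping.keys g \<subseteq> I\<rbrakk> \<Longrightarrow> lift (f + g) = lift f \<oplus>\<^bsub>M\<^esub> lift g"
  by (intro lin_comb_add image_keys)

lemma lift_smul: "Poly_Mapping.keys f \<subseteq> I \<Longrightarrow> lift (smul a f) = scal W S M a (lift f)"
  by (rule lin_comb_smul[OF c_closed])

lemma lift_single: "k \<in> I \<Longrightarrow> lift (Poly_Mapping.single k a) = scal W S M a (c k)"
  using c_closed by (intro lin_comb_single) auto

lemma lift_basis: "k \<in> I \<Longrightarrow> lift (Poly_Mapping.single k 1) = c k"
  using c_closed by (auto simp: lift_single intro!: scal_simps(3))

lemma lift_inj:
  assumes "Poly_Mapping.keys f \<subseteq> I" "Poly_Mapping.keys g \<subseteq> I" "lift f = lift g"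
  shows "f = g"
proof -
  have k: "Poly_Mapping.keys (f - g) \<subseteq> I" using keys_minus_subset[of f g] assms(1,2) by blast
  have "lift (f - g) \<oplus>\<^bsub>M\<^esub> lift g = lift f" using lift_add[OF k assms(2)] by simp
  then have "lift (f - g) \<oplus>\<^bsub>M\<^esub> lift g = \<zero>\<^bsub>M\<^esub> \<oplus>\<^bsub>M\<^esub> lift g"
    using assms(3) lift_closed[OF assms(2)] by simp
  then have "lift (f - g) = \<zero>\<^bsub>M\<^esub>"
    using lift_closed[OF k] lift_closed[OF assms(2)] M.add.right_cancel by blast
  then have "f - g = 0" using basis k by (auto simp: is_basis_def)
  then show ?thesis by simp
qed

lemma coord_lift:
  assumes "Poly_Mapping.keys f \<subseteq> I"
  shows "coord (lift f) = f"
proof -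
  have x: "lift f \<in> carrier M" by (rule lift_closed[OF assms])
  show ?thesis by (rule lift_inj[OF coord(1)[OF x] assms coord(2)[OF x]])
qed

lemma coord_add:
  assumes "x \<in> carrier M" "y \<in> carrier M"
  shows "coord (x \<oplus>\<^bsub>M\<^esub> y) = coord x + coord y"
proof -
  have k: "Poly_Mapping.keys (coord x + coord y) \<subseteq> I"
    using keys_add[of "coord x" "coord y"] coord(1)[OF assms(1)] coord(1)[OF assms(2)] by blast
  have "lift (coord x + coord y) = x \<oplus>\<^bsub>M\<^esub> y"
    using assms by (simp add: lift_add coord)
  then show ?thesis using coord_lift[OF k] by simp
qed

lemma coord_scal:
  assumes "x \<in> carrier M"
  shows "coord (scal W S M a x) = smul a (coord x)"
proof -
  have k: "Poly_Mapping.keys (smul a (coord x)) \<subseteq> I"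
    using keys_smul[of a "coord x"] coord(1)[OF assms] by blast
  have "lift (smul a (coord x)) = scal W S M a x"
    using assms by (simp add: lift_smul coord)
  then show ?thesis using coord_lift[OF k] by simp
qed

lemma coord_minus:
  assumes "x \<in> carrier M" "y \<in> carrier M"
  shows "coord (x \<ominus>\<^bsub>M\<^esub> y) = coord x - coord y"
proof -
  have "(x \<ominus>\<^bsub>M\<^esub> y) \<oplus>\<^bsub>M\<^esub> y = x"
    using M.minus_closed[OF assms] assms unfolding M.minus_eq
    by (subst M.a_assoc) (simp_all add: M.l_neg)
  then have "coord (x \<ominus>\<^bsub>M\<^esub> y) + coord y = coord x"
    using coord_add[of "x \<ominus>\<^bsub>M\<^esub> y" y] assms by simp
  then show ?thesis by (simp add: eq_diff_eq)
qed

lemma c_inj: "inj_on c I"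
proof (rule inj_onI)
  fix x y assume xy: "x \<in> I" "y \<in> I" "c x = c y"
  then have "(Poly_Mapping.single x 1 :: 'i \<Rightarrow>\<^sub>0 laurent) = Poly_Mapping.single y 1"
    by (intro lift_inj) (simp_all add: lift_basis)
  then have "Poly_Mapping.lookup (Poly_Mapping.single x (1 :: laurent)) y = 1" by simp
  then show "x = y" by (simp add: lookup_single when_def split: if_splits)
qed

end

lemma (in abelian_group) a_minus_eqI:
  assumes "x \<in> carrier G" "y \<in> carrier G" "x \<oplus> y = z"
  shows "x = z \<ominus> y"
proof -
  have "z \<ominus> y = x \<oplus> (y \<oplus> \<ominus> y)" using assms by (auto simp: a_minus_def a_assoc)
  then show ?thesis using assms by (simp add: r_neg)
qed

section \<open>Transport of the module of a W-graph ideal to coordinates\<close>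

locale ideal_basis = coxeter_ideal W S J I + H: hecke_based_module W S M I c
  for W :: "('w, 'g) monoid_scheme" (structure) and S J I :: "'w set"
    and M :: "('w hecke_elt, 'm) module" and c :: "'w \<Rightarrow> 'm" +
  fixes b :: "'w \<Rightarrow> 'm" and \<iota> :: "'m \<Rightarrow> 'm" and Q :: "'w \<Rightarrow> 'w \<Rightarrow>\<^sub>0 laurent"
  assumes ideal_module: "ideal_module W S J I M b"
    and involution: "ideal_involution W S I M b \<iota>"
    and W_graph_basis: "W_graph_basis W S I M b \<iota> c Q"
begin

definition T :: "'w \<Rightarrow> ('w \<Rightarrow>\<^sub>0 laurent) \<Rightarrow> 'w \<Rightarrow>\<^sub>0 laurent" where
  "T s f = H.coord (act W S M s (H.lift f))"

lemma Q_keys: "w \<in> I \<Longrightarrow> Poly_Mapping.keys (Q w) \<subseteq> {y \<in> I. bruhat_less W S y w}"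
  and Q_pos: "w \<in> I \<Longrightarrow> Poly_Mapping.lookup (Q w) y \<in> laurent_pos"
  and \<iota>_c: "w \<in> I \<Longrightarrow> \<iota> (c w) = c w"
  using W_graph_basis by (auto simp: W_graph_basis_def)

lemma keys_bcoord: "w \<in> I \<Longrightarrow> Poly_Mapping.keys (bcoord Q w) \<subseteq> {y \<in> I. y = w \<or> bruhat_less W S y w}"
  using Q_keys[of w] by (auto simp: in_keys_iff lookup_bcoord split: if_splits)

lemma keys_bcoord_I: "w \<in> I \<Longrightarrow> Poly_Mapping.keys (bcoord Q w) \<subseteq> I"
  using keys_bcoord by blast

lemma b_lift:
  assumes "w \<in> I"
  shows "b w = H.lift (bcoord Q w)"
proof -
  have Q: "Poly_Mapping.keys (Q w) \<subseteq> I" using Q_keys[OF assms] by blast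
  then have "Poly_Mapping.keys (smul q_var (Q w)) \<subseteq> I" using keys_smul[of q_var "Q w"] by blast
  then have "H.lift (bcoord Q w) = c w \<oplus>\<^bsub>M\<^esub> scal W S M q_var (H.lift (Q w))"
    using assms Q by (simp add: bcoord_def H.lift_add H.lift_smul H.lift_basis)
  also have "\<dots> = b w" using W_graph_basis assms by (simp add: W_graph_basis_def)
  finally show ?thesis by simp
qed

lemma b_closed: "w \<in> I \<Longrightarrow> b w \<in> carrier M"
  by (simp add: b_lift H.lift_closed keys_bcoord_I)

lemma \<iota>_closed: "x \<in> carrier M \<Longrightarrow> \<iota> x \<in> carrier M"
  and \<iota>_add: "\<lbrakk>x \<in> carrier M; y \<in> carrier M\<rbrakk> \<Longrightarrow> \<iota> (x \<oplus>\<^bsub>M\<^esub> y) = \<iota> x \<oplus>\<^bsub>M\<^esub> \<iota> y"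
  and \<iota>_scal: "x \<in> carrier M \<Longrightarrow> \<iota> (scal W S M a x) = scal W S M (laurent_bar a) (\<iota> x)"
  and \<iota>_hecke: "\<lbrakk>h \<in> carrier (hecke W S); x \<in> carrier M\<rbrakk> \<Longrightarrow> \<iota> (h \<odot>\<^bsub>M\<^esub> x) = hecke_bar W S h \<odot>\<^bsub>M\<^esub> \<iota> x"
  and \<iota>_b_one: "\<one> \<in> I \<Longrightarrow> \<iota> (b \<one>) = b \<one>"
  using involution by (auto simp: ideal_involution_def)

text \<open>The c_w are fixed, so semilinearity leaves only bar on the coefficients.\<close>

lemma \<iota>_lift:
  assumes "Poly_Mapping.keys f \<subseteq> I"
  shows "\<iota> (H.lift f) = H.lift (vbar f)"
  using assms
proof (induction f rule: poly_mapping_add_induct)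
  case zero
  have "\<iota> (scal W S M 0 \<zero>\<^bsub>M\<^esub>) = \<zero>\<^bsub>M\<^esub>"
    unfolding \<iota>_scal[OF H.M.zero_closed] laurent_bar_zero
    by (rule H.scal_zero_left[OF \<iota>_closed[OF H.M.zero_closed]])
  moreover have "vbar 0 = (0 :: 'w \<Rightarrow>\<^sub>0 laurent)" by (rule poly_mapping_eqI) simp
  ultimately show ?case by (simp add: H.scal_zero_left)
next
  case (single k a)
  then show ?case using H.c_closed by (auto simp: H.lift_single \<iota>_scal \<iota>_c)
next
  case (add f g)
  have "Poly_Mapping.keys (vbar f) \<subseteq> I" "Poly_Mapping.keys (vbar g) \<subseteq> I"
    using add.hyps keys_vbar[of f] keys_vbar[of g] by blast+
  then show ?case using add by (simp add: H.lift_add \<iota>_add H.lift_closed)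
qed

text \<open>Compatibility with \<open>hecke_bar\<close>, specialised to T_s, whose bar is its
  inverse T_s - (q - q^-1).\<close>

lemma \<iota>_act:
  assumes "s \<in> S" "x \<in> carrier M"
  shows "\<iota> (act W S M s x) = act W S M s (\<iota> x) \<ominus>\<^bsub>M\<^esub> scal W S M (q_var - q_inv) (\<iota> x)"
proof -
  let ?T = "hecke_proj W S (Poly_Mapping.single [s] 1 - Poly_Mapping.single [] (q_var - q_inv))"
  have car: "Poly_Mapping.single [s] 1 - Poly_Mapping.single [] (q_var - q_inv) \<in> carrier (free_algebra S)"
    "Poly_Mapping.single [] (q_var - q_inv) \<in> carrier (free_algebra S)"
    using assms(1) by (simp_all del: free_algebra_simps add: free_algebra_closed single_in_free_algebra)
  have T: "?T \<in> carrier (hecke W S)" by (rule hecke_proj_simps(1)[OF car(1)])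
  have x: "\<iota> x \<in> carrier M" by (rule \<iota>_closed[OF assms(2)])
  have "?T \<oplus>\<^bsub>hecke W S\<^esub> hecke_scalar W S (q_var - q_inv) = hecke_gen W S s"
    by (simp add: hecke_scalar_proj hecke_gen_proj hecke_proj_simps(2)[OF car] del: free_algebra_simps)
  then have e1: "?T \<odot>\<^bsub>M\<^esub> \<iota> x \<oplus>\<^bsub>M\<^esub> scal W S M (q_var - q_inv) (\<iota> x) = act W S M s (\<iota> x)"
    unfolding scal_def act_def
    using H.smult_l_distr[OF T hecke_scalar_closed x, of "q_var - q_inv"] by simp
  have e2: "\<iota> (act W S M s x) = ?T \<odot>\<^bsub>M\<^esub> \<iota> x"
    unfolding act_def using assms by (simp add: \<iota>_hecke hecke_gen_closed hecke_bar_gen)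
  show ?thesis
    unfolding e2 by (rule H.M.a_minus_eqI[OF H.smult_closed[OF T x] H.scal_closed[OF x] e1])
qed

lemma act_lift_closed: "\<lbrakk>s \<in> S; Poly_Mapping.keys f \<subseteq> I\<rbrakk> \<Longrightarrow> act W S M s (H.lift f) \<in> carrier M"
  by (intro H.act_closed H.lift_closed)

lemma lift_T: "\<lbrakk>s \<in> S; Poly_Mapping.keys f \<subseteq> I\<rbrakk> \<Longrightarrow> H.lift (T s f) = act W S M s (H.lift f)"
  unfolding T_def by (rule H.coord(2)[OF act_lift_closed])

lemma T_bcoord: "\<lbrakk>s \<in> S; w \<in> I\<rbrakk> \<Longrightarrow> T s (bcoord Q w) = H.coord (act W S M s (b w))"
  by (simp add: T_def b_lift)

lemma coord_b: "w \<in> I \<Longrightarrow> H.coord (b w) = bcoord Q w"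
  by (simp add: b_lift H.coord_lift keys_bcoord_I)

lemma W_graph_coords: "W_graph_coords W S J I T Q"
proof (rule W_graph_coords.intro[OF coxeter_ideal_axioms], unfold_locales)
  fix s and f :: "'w \<Rightarrow>\<^sub>0 laurent"
  assume s: "s \<in> S" and f: "Poly_Mapping.keys f \<subseteq> I"
  note af = act_lift_closed[OF s f] and lf = H.lift_closed[OF f]
  show closed: "Poly_Mapping.keys (T s f) \<subseteq> I" unfolding T_def by (rule H.coord(1)[OF af])
  show "T s (smul a f) = smul a (T s f)" for a
    unfolding T_def H.lift_smul[OF f] H.act_scal[OF s lf] H.coord_scal[OF af] ..
  have "T s (T s f) = H.coord (act W S M s (H.lift (T s f)))" by (rule T_def)
  also have "\<dots> = f + smul (q_var - q_inv) (T s f)"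
    unfolding lift_T[OF s f] H.act_square[OF s lf] H.coord_add[OF lf H.scal_closed[OF af]]
      H.coord_scal[OF af] H.coord_lift[OF f] T_def[symmetric] ..
  finally show "T s (T s f) = f + smul (q_var - q_inv) (T s f)" .
  have vf: "Poly_Mapping.keys (vbar f) \<subseteq> I" using f keys_vbar[of f] by blast
  have "H.lift (vbar (T s f)) = act W S M s (H.lift (vbar f)) \<ominus>\<^bsub>M\<^esub> scal W S M (q_var - q_inv) (H.lift (vbar f))"
    unfolding \<iota>_lift[OF closed, symmetric] lift_T[OF s f] \<iota>_act[OF s lf] \<iota>_lift[OF f] ..
  moreover have "Poly_Mapping.keys (vbar (T s f)) \<subseteq> I" using closed keys_vbar[of "T s f"] by blast
  ultimately have "vbar (T s f) = H.coord (act W S M s (H.lift (vbar f)) \<ominus>\<^bsub>M\<^esub> scal W S M (q_var - q_inv) (H.lift (vbar f)))"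
    using H.coord_lift by metis
  also have "\<dots> = T s (vbar f) - smul (q_var - q_inv) (vbar f)"
    unfolding H.coord_minus[OF act_lift_closed[OF s vf] H.scal_closed[OF H.lift_closed[OF vf]]]
      H.coord_scal[OF H.lift_closed[OF vf]] H.coord_lift[OF vf] T_def ..
  finally show "vbar (T s f) = T s (vbar f) - smul (q_var - q_inv) (vbar f)" .
  fix g :: "'w \<Rightarrow>\<^sub>0 laurent"
  assume g: "Poly_Mapping.keys g \<subseteq> I"
  show "T s (f + g) = T s f + T s g"
    unfolding T_def H.lift_add[OF f g] H.act_add[OF s lf H.lift_closed[OF g]]
      H.coord_add[OF af act_lift_closed[OF s g]] ..
next
  fix w s assume w: "w \<in> I"
  show "Poly_Mapping.keys (Q w) \<subseteq> {y \<in> I. bruhat_less W S y w}" by (rule Q_keys[OF w])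
  show "Poly_Mapping.lookup (Q w) y \<in> laurent_pos" for y by (rule Q_pos[OF w])
  note bc = b_closed[OF w]
  {
    assume s: "s \<in> SA W S I w"
    then have "act W S M s (b w) = b (s \<otimes> w)" using ideal_module w by (auto simp: ideal_module_def)
    then show "T s (bcoord Q w) = bcoord Q (s \<otimes> w)"
      using SA_upper[OF w s] w by (simp add: T_bcoord coord_b)
  next
    assume s: "s \<in> WD W S J w"
    then have "act W S M s (b w) = scal W S M (- q_inv) (b w)" using ideal_module w by (auto simp: ideal_module_def)
    moreover have "s \<in> S" using s by (simp add: WD_def)
    ultimately show "T s (bcoord Q w) = smul (- q_inv) (bcoord Q w)"
      using w by (simp add: T_bcoord H.coord_scal[OF bc] coord_b)
  next
    assume s: "s \<in> WA W S J I w"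
    have sS: "s \<in> S" using s by (simp add: WA_def)
    obtain r where r: "Poly_Mapping.keys r \<subseteq> {y \<in> I. bruhat_less W S y (s \<otimes> w)}"
        "\<forall>y. Poly_Mapping.lookup r y \<in> (*) q_var ` laurent_pos"
        "act W S M s (b w) = scal W S M q_var (b w) \<ominus>\<^bsub>M\<^esub> lin_comb W S M b r"
      using ideal_module w s unfolding ideal_module_def by blast
    have rI: "Poly_Mapping.keys r \<subseteq> I" using r(1) by blast
    have "lin_comb W S M b r = H.lift (comb (bcoord Q) r)"
      by (rule H.lin_comb_comb[OF H.c_closed rI]) (simp add: keys_bcoord_I b_lift)
    moreover have k: "Poly_Mapping.keys (comb (bcoord Q) r) \<subseteq> I"
      using rI keys_bcoord_I by (blast elim: keys_comb)
    ultimately have "T s (bcoord Q w) = smul q_var (bcoord Q w) - comb (bcoord Q) r"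
      using H.lift_closed[OF k] r(3) bc w
      by (simp add: T_bcoord[OF sS w] H.coord_minus H.scal_closed H.coord_scal coord_b H.coord_lift)
    then show "\<exists>r. Poly_Mapping.keys r \<subseteq> I \<and> (\<forall>y. Poly_Mapping.lookup r y \<in> laurent_qpos) \<and>
      T s (bcoord Q w) = smul q_var (bcoord Q w) -
        (\<Sum>y\<in>Poly_Mapping.keys r. smul (Poly_Mapping.lookup r y) (bcoord Q y))"
      using rI r(2) unfolding comb_def laurent_qpos_def by blast
  }
qed

sublocale K: W_graph_coords W S J I T Q
  by (rule W_graph_coords)

end

lemma ideal_basisI:
  assumes "coxeter_ideal W S J I" "ideal_module W S J I M b" "ideal_involution W S I M b \<iota>"
    "W_graph_basis W S I M b \<iota> c Q"
  shows "ideal_basis W S J I M c b \<iota> Q"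
  using assms
  by (auto simp: ideal_basis_def ideal_basis_axioms_def hecke_based_module_def hecke_based_module_axioms_def
      hecke_module_def ideal_module_def W_graph_basis_def)

section \<open>Unitriangular changes of basis\<close>

context coxeter_ideal
begin

context
  fixes Q :: "'a \<Rightarrow> 'a \<Rightarrow>\<^sub>0 laurent"
  assumes Q_keys: "\<And>w. w \<in> I \<Longrightarrow> Poly_Mapping.keys (Q w) \<subseteq> {y \<in> I. bruhat_less W S y w}"
    and Q_pos: "\<And>w y. w \<in> I \<Longrightarrow> Poly_Mapping.lookup (Q w) y \<in> laurent_pos"
begin

text \<open>Unitriangularity by length: at an index w of maximal length in the support, b_w has
  coordinate 1 and every other b_k involved has coordinate 0.\<close>

lemma comb_bcoord_inj:
  assumes f: "Poly_Mapping.keys f \<subseteq> I" and zero: "comb (bcoord Q) f = 0"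
  shows "f = 0"
proof (rule ccontr)
  assume "f \<noteq> 0"
  then have ne: "Poly_Mapping.keys f \<noteq> {}" by simp
  let ?n = "Max (len ` Poly_Mapping.keys f)"
  have "?n \<in> len ` Poly_Mapping.keys f" by (rule Max_in) (use ne in auto)
  then obtain w where w: "w \<in> Poly_Mapping.keys f" "len w = ?n" by auto
  have "Poly_Mapping.lookup (bcoord Q k) w = 0" if k: "k \<in> Poly_Mapping.keys f" "k \<noteq> w" for k
  proof -
    have "len k \<le> len w" unfolding w(2) by (rule Max_ge) (use k in auto)
    then have "w \<notin> Poly_Mapping.keys (Q k)" using Q_keys[of k] bruhat_less_len[of w k] k f by auto
    then show ?thesis using k by (simp add: lookup_bcoord in_keys_iff)
  qed
  then have "Poly_Mapping.lookup (comb (bcoord Q) f) w =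
      (\<Sum>k\<in>Poly_Mapping.keys f. if k = w then Poly_Mapping.lookup f w * Poly_Mapping.lookup (bcoord Q w) w else 0)"
    unfolding lookup_comb by (intro sum.cong) auto
  moreover have "Poly_Mapping.lookup (bcoord Q w) w = 1"
  proof -
    have "w \<notin> Poly_Mapping.keys (Q w)" using Q_keys[of w] bruhat_less_len[of w w] w(1) f by blast
    then show ?thesis by (simp add: lookup_bcoord in_keys_iff)
  qed
  ultimately have "Poly_Mapping.lookup f w = 0" using zero w by simp
  then show False using w by (simp add: in_keys_iff)
qed

text \<open>The inverse of the unitriangular matrix, by recursion from c_w = b_w - q (sum of q_{y,w}
  c_y). Transitivity of the Bruhat order and closure of \<int>[q] under the operations carry the two
  bounds along.\<close>

lemma ex_comb_bcoord_single:
  assumes "w \<in> I"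
  shows "\<exists>g. Poly_Mapping.keys g \<subseteq> {y \<in> I. y = w \<or> bruhat_less W S y w} \<and>
    (\<forall>y. Poly_Mapping.lookup g y \<in> laurent_pos) \<and> comb (bcoord Q) g = Poly_Mapping.single w 1"
  using assms
proof (induction "len w" arbitrary: w rule: less_induct)
  case less
  define P where "P y g \<longleftrightarrow> Poly_Mapping.keys g \<subseteq> {z \<in> I. z = y \<or> bruhat_less W S z y} \<and>
      (\<forall>z. Poly_Mapping.lookup g z \<in> laurent_pos) \<and> comb (bcoord Q) g = Poly_Mapping.single y 1" for y g
  have "\<forall>y\<in>Poly_Mapping.keys (Q w). \<exists>g. P y g"
  proof
    fix y assume "y \<in> Poly_Mapping.keys (Q w)"
    then have "y \<in> I" "len y < len w" using Q_keys[OF less.prems] bruhat_less_len by auto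
    then show "\<exists>g. P y g" unfolding P_def using less.hyps by blast
  qed
  from bchoice[OF this] obtain G where "\<forall>y\<in>Poly_Mapping.keys (Q w). P y (G y)" by blast
  then have G: "Poly_Mapping.keys (G y) \<subseteq> {z \<in> I. z = y \<or> bruhat_less W S z y}"
      "Poly_Mapping.lookup (G y) z \<in> laurent_pos" "comb (bcoord Q) (G y) = Poly_Mapping.single y 1"
    if "y \<in> Poly_Mapping.keys (Q w)" for y z
    using that by (auto simp: P_def)
  let ?g = "Poly_Mapping.single w 1 - smul q_var (comb G (Q w))"
  have "comb (bcoord Q) ?g = bcoord Q w - smul q_var (comb (\<lambda>k. comb (bcoord Q) (G k)) (Q w))"
    by (simp add: comb_diff comb_single comb_smul comb_comb)
  also have "comb (\<lambda>k. comb (bcoord Q) (G k)) (Q w) = comb (\<lambda>k. Poly_Mapping.single k 1) (Q w)"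
    by (rule comb_cong) (use G(3) in blast)
  also have "bcoord Q w - smul q_var \<dots> = Poly_Mapping.single w 1"
    unfolding comb_basis bcoord_def by simp
  finally have eq: "comb (bcoord Q) ?g = Poly_Mapping.single w 1" .
  have "z \<in> I \<and> bruhat_less W S z w" if z: "z \<in> Poly_Mapping.keys (comb G (Q w))" for z
  proof -
    obtain y where y: "y \<in> Poly_Mapping.keys (Q w)" "z \<in> Poly_Mapping.keys (G y)"
      using z by (rule keys_comb)
    then have "z \<in> I" "z = y \<or> bruhat_less W S z y" "bruhat_less W S y w"
      using G(1)[OF y(1)] Q_keys[OF less.prems] by auto
    then show ?thesis using bruhat_less_trans by blast
  qed
  then have keys: "Poly_Mapping.keys ?g \<subseteq> {y \<in> I. y = w \<or> bruhat_less W S y w}"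
    using keys_minus_subset[of "Poly_Mapping.single w 1" "smul q_var (comb G (Q w))"]
      keys_smul[of q_var "comb G (Q w)"] less.prems by auto
  have "Poly_Mapping.lookup (comb G (Q w)) y \<in> laurent_pos" for y
    unfolding lookup_comb using G(2) Q_pos[OF less.prems] by (intro sum_laurent_pos laurent_pos_closed(6)) blast+
  then have "Poly_Mapping.lookup ?g y \<in> laurent_pos" for y
    unfolding lookup_minus lookup_single lookup_smul when_def
    by (intro laurent_pos_minus laurent_pos_closed(3,6)) (simp_all add: laurent_pos_closed(1,2))
  then show ?case using eq keys by blast
qed

text \<open>The last conclusion keeps divisibility by q under the change to the b_y, as demanded of
  the coefficients at a weak ascent; it holds because the inverse matrix has entries in
  \<int>[q].\<close>

lemma ex_comb_bcoord:
  assumes f: "Poly_Mapping.keys f \<subseteq> I"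
  obtains g where "comb (bcoord Q) g = f"
    "Poly_Mapping.keys g \<subseteq> {y \<in> I. \<exists>k\<in>Poly_Mapping.keys f. y = k \<or> bruhat_less W S y k}"
    "(\<forall>k. Poly_Mapping.lookup f k \<in> laurent_qpos) \<longrightarrow> (\<forall>k. Poly_Mapping.lookup g k \<in> laurent_qpos)"
proof -
  define P where "P y g \<longleftrightarrow> Poly_Mapping.keys g \<subseteq> {z \<in> I. z = y \<or> bruhat_less W S z y} \<and>
      (\<forall>z. Poly_Mapping.lookup g z \<in> laurent_pos) \<and> comb (bcoord Q) g = Poly_Mapping.single y 1" for y g
  have "\<forall>y\<in>I. \<exists>g. P y g" unfolding P_def using ex_comb_bcoord_single by blast
  from bchoice[OF this] obtain G where "\<forall>y\<in>I. P y (G y)" by blast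
  then have G: "Poly_Mapping.keys (G y) \<subseteq> {z \<in> I. z = y \<or> bruhat_less W S z y}"
      "Poly_Mapping.lookup (G y) z \<in> laurent_pos" "comb (bcoord Q) (G y) = Poly_Mapping.single y 1"
    if "y \<in> I" for y z
    using that by (auto simp: P_def)
  show ?thesis
  proof (rule that[of "comb G f"])
    have "comb (bcoord Q) (comb G f) = comb (\<lambda>k. Poly_Mapping.single k 1) f"
      unfolding comb_comb by (rule comb_cong) (use G(3) f in blast)
    then show "comb (bcoord Q) (comb G f) = f" by (simp add: comb_basis)
    show "Poly_Mapping.keys (comb G f) \<subseteq> {y \<in> I. \<exists>k\<in>Poly_Mapping.keys f. y = k \<or> bruhat_less W S y k}"
    proof
      fix z assume "z \<in> Poly_Mapping.keys (comb G f)"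
      then obtain k where k: "k \<in> Poly_Mapping.keys f" "z \<in> Poly_Mapping.keys (G k)" by (rule keys_comb)
      moreover have "k \<in> I" using k f by blast
      ultimately show "z \<in> {y \<in> I. \<exists>k\<in>Poly_Mapping.keys f. y = k \<or> bruhat_less W S y k}"
        using G(1)[of k] by blast
    qed
    show "(\<forall>k. Poly_Mapping.lookup f k \<in> laurent_qpos) \<longrightarrow> (\<forall>k. Poly_Mapping.lookup (comb G f) k \<in> laurent_qpos)"
      unfolding lookup_comb using G(2) f by (intro impI allI sum_laurent_qpos laurent_qpos_closed(6)) blast+
  qed
qed

end

end

section \<open>The quotient by a closed set of vertices\<close>

text \<open>In coordinates, the quotient map by the span of the unit vectors outside
  \<open>A\<close>.\<close>

definition prestrict :: "'i set \<Rightarrow> ('i \<Rightarrow>\<^sub>0 laurent) \<Rightarrow> 'i \<Rightarrow>\<^sub>0 laurent" where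
  "prestrict A f = (\<Sum>k\<in>Poly_Mapping.keys f \<inter> A. Poly_Mapping.single k (Poly_Mapping.lookup f k))"

lemma lookup_prestrict [simp]:
  "Poly_Mapping.lookup (prestrict A f) k = (if k \<in> A then Poly_Mapping.lookup f k else 0)"
  by (auto simp: prestrict_def lookup_sum lookup_single when_def in_keys_iff)

lemma keys_prestrict: "Poly_Mapping.keys (prestrict A f) = Poly_Mapping.keys f \<inter> A"
  by (auto simp: in_keys_iff split: if_splits)

lemma prestrict_simps:
  "prestrict A (f + g) = prestrict A f + prestrict A g" "prestrict A (f - g) = prestrict A f - prestrict A g"
  "prestrict A (smul a f) = smul a (prestrict A f)" "prestrict A (vbar f) = vbar (prestrict A f)"
  "prestrict A 0 = 0"
  by (rule poly_mapping_eqI, simp add: lookup_add lookup_minus)+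

lemma prestrict_id: "Poly_Mapping.keys f \<subseteq> A \<Longrightarrow> prestrict A f = f"
  by (rule poly_mapping_eqI) (auto simp: in_keys_iff)

lemma prestrict_eq_0_iff: "prestrict A f = 0 \<longleftrightarrow> Poly_Mapping.keys f \<inter> A = {}"
  by (metis keys_prestrict keys_eq_empty)

lemma prestrict_bcoord: "w \<in> A \<Longrightarrow> prestrict A (bcoord Q w) = bcoord (\<lambda>w. prestrict A (Q w)) w"
  by (rule poly_mapping_eqI) (auto simp: lookup_bcoord)

locale W_graph_quotient = ideal_basis W S J I0 M c b \<iota> Q
  for W :: "('w, 'g) monoid_scheme" (structure) and S J I0 :: "'w set"
    and M :: "('w hecke_elt, 'm) module" and c b :: "'w \<Rightarrow> 'm" and \<iota> :: "'m \<Rightarrow> 'm"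
    and Q :: "'w \<Rightarrow> 'w \<Rightarrow>\<^sub>0 laurent" +
  fixes I :: "'w set"
  assumes weak_ideal_I: "weak_ideal W S I" and I_sub: "I \<subseteq> I0"
    and closed: "W_graph_closed W S (basis_graph W S J I0 c Q) (c ` (I0 - I))"
begin

sublocale B: coxeter_ideal W S J I
proof unfold_locales
  show "weak_ideal W S I" by (rule weak_ideal_I)
  show "J \<subseteq> Pos W S I" using J_Pos I_sub by (auto simp: Pos_def)
qed

text \<open>The module \<open>N\<close> provided by closedness shares only the graph with
  \<open>M\<close>. In \<open>N\<close> the coefficient of T_s c_k at c_y is the edge weight; as it
  is nonzero, c_y must lie in the closed set.\<close>

lemma edge_stable:
  assumes k: "k \<in> I0 - I" "s \<in> S" "s \<notin> descents W S J k"
    and y: "y \<in> I0" "s \<in> descents W S J y" "bruhat_less W S y k" "mu_coeff Q y k \<noteq> 0"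
  shows "y \<notin> I"
proof -
  let ?\<Gamma> = "basis_graph W S J I0 c Q"
  let ?U = "c ` (I0 - I)"
  obtain N where N: "W_graph_module W S ?\<Gamma> N" "submodule {f. Poly_Mapping.keys f \<subseteq> ?U} (hecke W S) N"
    using closed by (auto simp: W_graph_closed_def)
  let ?Tv = "act W S N s (Poly_Mapping.single (c k) 1)"
  have inv: "inv_into I0 c (c z) = z" if "z \<in> I0" for z
    using H.c_inj that by simp
  have "?Tv \<in> {f. Poly_Mapping.keys f \<subseteq> ?U}"
    unfolding act_def using k(1)
    by (intro submodule.smult_closed[OF N(2)] hecke_gen_closed k(2)) auto
  moreover have "Poly_Mapping.lookup ?Tv (c y) = of_int (mu_coeff Q y k)"
  proof -
    have v: "c k \<in> verts ?\<Gamma>" "s \<notin> tau ?\<Gamma> (c k)" using k by (auto simp: basis_graph_def inv)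
    \<comment> \<open>The last conjunct of \<open>W_graph_module\<close>, in its \<open>else\<close>
      branch because s is not in \<open>tau\<close> of \<open>c k\<close>.\<close>
    have "\<forall>u. Poly_Mapping.lookup ?Tv u = (if u = c k then q_var else 0) +
        (if u \<in> verts ?\<Gamma> \<and> s \<in> tau ?\<Gamma> u then of_int (mu ?\<Gamma> u (c k)) else 0)"
      by (rule iffD1[OF if_not_P[OF v(2)] N(1)[unfolded W_graph_module_def, THEN conjunct2, THEN conjunct2,
          THEN conjunct2, THEN conjunct2, THEN bspec, OF k(2), THEN bspec, OF v(1)]])
    moreover have "c y \<noteq> c k"
    proof
      assume "c y = c k"
      then have "y = k" using inj_onD[OF H.c_inj] y(1) k(1) by blast
      then show False using k(3) y(2) by blast
    qed
    moreover have "c y \<in> verts ?\<Gamma>" "s \<in> tau ?\<Gamma> (c y)" using y by (auto simp: basis_graph_def inv)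
    moreover have "mu ?\<Gamma> (c y) (c k) = mu_coeff Q y k"
      using y k(1) by (simp add: basis_graph_def inv)
    ultimately show ?thesis by simp
  qed
  ultimately have "c y \<in> ?U" using y(4) by (auto simp: in_keys_iff)
  then show ?thesis using H.c_inj y(1) by (auto dest: inj_onD)
qed

definition proj :: "'m \<Rightarrow> 'w \<Rightarrow>\<^sub>0 laurent" where
  "proj x = prestrict I (H.coord x)"

text \<open>The quotient of \<open>M\<close> by the span of the c_k with k in \<open>I0 - I\<close>.
  A class is represented by its unique member with coordinates supported on \<open>I\<close>; the
  action lifts, acts in \<open>M\<close>, and projects back.\<close>

definition Mq :: "('w hecke_elt, 'w \<Rightarrow>\<^sub>0 laurent) module" where
  "Mq = \<lparr>carrier = {f. Poly_Mapping.keys f \<subseteq> I}, mult = (\<lambda>_ _. 0), one = 0, zero = 0, add = (+),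
     smult = (\<lambda>h f. proj (h \<odot>\<^bsub>M\<^esub> H.lift f))\<rparr>"

definition Qq :: "'w \<Rightarrow> 'w \<Rightarrow>\<^sub>0 laurent" where
  "Qq w = prestrict I (Q w)"

lemma Mq_simps [simp]:
  "carrier Mq = {f. Poly_Mapping.keys f \<subseteq> I}" "\<zero>\<^bsub>Mq\<^esub> = 0" "f \<oplus>\<^bsub>Mq\<^esub> g = f + g"
  "h \<odot>\<^bsub>Mq\<^esub> f = proj (h \<odot>\<^bsub>M\<^esub> H.lift f)"
  by (simp_all add: Mq_def)

lemma keys_I_sub: "Poly_Mapping.keys f \<subseteq> I \<Longrightarrow> Poly_Mapping.keys f \<subseteq> I0"
  using I_sub by blast

lemma lift_closed_I: "Poly_Mapping.keys f \<subseteq> I \<Longrightarrow> H.lift f \<in> carrier M"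
  by (intro H.lift_closed keys_I_sub)

lemma proj_closed: "Poly_Mapping.keys (proj x) \<subseteq> I"
  by (simp add: proj_def keys_prestrict)

lemma proj_add: "\<lbrakk>x \<in> carrier M; y \<in> carrier M\<rbrakk> \<Longrightarrow> proj (x \<oplus>\<^bsub>M\<^esub> y) = proj x + proj y"
  by (simp add: proj_def H.coord_add prestrict_simps)

lemma proj_minus: "\<lbrakk>x \<in> carrier M; y \<in> carrier M\<rbrakk> \<Longrightarrow> proj (x \<ominus>\<^bsub>M\<^esub> y) = proj x - proj y"
  by (simp add: proj_def H.coord_minus prestrict_simps)

lemma proj_scal: "x \<in> carrier M \<Longrightarrow> proj (scal W S M a x) = smul a (proj x)"
  by (simp add: proj_def H.coord_scal prestrict_simps)

lemma proj_lift: "Poly_Mapping.keys f \<subseteq> I0 \<Longrightarrow> proj (H.lift f) = prestrict I f"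
  by (simp add: proj_def H.coord_lift)

lemma proj_lift_I: "Poly_Mapping.keys f \<subseteq> I \<Longrightarrow> proj (H.lift f) = f"
  by (simp add: proj_lift keys_I_sub prestrict_id)

lemma proj_b: "w \<in> I0 \<Longrightarrow> proj (b w) = prestrict I (bcoord Q w)"
  by (simp add: proj_def coord_b)

lemma proj_b_I: "w \<in> I \<Longrightarrow> proj (b w) = bcoord Qq w"
  using I_sub by (auto simp: proj_b prestrict_bcoord Qq_def[abs_def])

text \<open>A component in \<open>I\<close> could arise in two ways. If s k were in \<open>I\<close>
  for a strong ascent s, its suffix k would be in \<open>I\<close> as well; a lower neighbour in
  \<open>I\<close> is excluded by \<open>edge_stable\<close>.\<close>

lemma prestrict_U_basis:
  assumes k: "k \<in> I0 - I" and s: "s \<in> S"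
  shows "prestrict I (K.U s (Poly_Mapping.single k 1)) = 0"
proof (cases "s \<in> descents W S J k")
  case True
  then show ?thesis using k by (simp add: K.U_basis[OF _ s] prestrict_eq_0_iff)
next
  case False
  have "Poly_Mapping.lookup (edge_sum W S J I0 Q s k) z = 0" if z: "z \<in> I" for z
  proof -
    have "\<not> (s \<in> SA W S I0 k \<and> z = s \<otimes> k)"
    proof
      assume *: "s \<in> SA W S I0 k \<and> z = s \<otimes> k"
      have "k \<in> I0" using k by simp
      note u = SA_upper[OF this conjunct1[OF *]]
      have "s \<in> SD W S z" "z \<in> I" using u(3) * z by auto
      from B.SD_lower(2)[OF this(2,1)] show False using u(6) * k by simp
    qed
    moreover have "mu_coeff Q z k = 0" if "s \<in> descents W S J z"
    proof (rule ccontr)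
      assume *: "mu_coeff Q z k \<noteq> 0"
      then have "z \<in> Poly_Mapping.keys (Q k)" by (auto simp: mu_coeff_def in_keys_iff)
      then have "z \<in> I0" "bruhat_less W S z k" using Q_keys[of k] k by auto
      from edge_stable[OF k s False this(1) that this(2) *] z show False by simp
    qed
    ultimately show ?thesis by (simp add: lookup_edge_sum)
  qed
  then show ?thesis
    using False k by (auto simp: K.U_basis[OF _ s] prestrict_eq_0_iff in_keys_iff)
qed

lemma prestrict_T:
  assumes s: "s \<in> S" and f: "Poly_Mapping.keys f \<subseteq> I0" and zero: "prestrict I f = 0"
  shows "prestrict I (T s f) = 0"
proof -
  have "Poly_Mapping.lookup (K.U s f) z = 0" if z: "z \<in> I" for z
  proof -
    have "Poly_Mapping.lookup (K.U s (Poly_Mapping.single k 1)) z = 0" if k: "k \<in> Poly_Mapping.keys f" for k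
    proof -
      have "k \<in> I0 - I" using k f zero by (auto simp: prestrict_eq_0_iff)
      from arg_cong[OF prestrict_U_basis[OF this s], of "\<lambda>g. Poly_Mapping.lookup g z"] show ?thesis
        using z by simp
    qed
    then show ?thesis by (simp add: K.U_expand[OF s f] lookup_sum)
  qed
  moreover have "Poly_Mapping.lookup f z = 0" if "z \<in> I" for z
    using zero that by (auto simp: prestrict_eq_0_iff in_keys_iff)
  moreover have "T s f = K.U s f + smul q_var f" by (simp add: K.U_def)
  ultimately show ?thesis by (intro poly_mapping_eqI) (simp add: lookup_add)
qed

text \<open>The kernel of \<open>proj\<close> is a submodule. The quantifier over \<open>x\<close>
  belongs to the induction claim because the product case applies one hypothesis to the image under
  the other factor.\<close>

lemma proj_hecke_zero:
  assumes "h \<in> carrier (hecke W S)"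
  shows "\<forall>x\<in>carrier M. proj x = 0 \<longrightarrow> proj (h \<odot>\<^bsub>M\<^esub> x) = 0"
  using assms
proof (induction h rule: hecke_induct)
  case (scalar a)
  show ?case
    using proj_scal by (simp add: scal_def)
next
  case (gen s)
  show ?case
  proof (intro ballI impI)
    fix x assume x: "x \<in> carrier M" "proj x = 0"
    have "H.coord (act W S M s x) = T s (H.coord x)" by (simp add: T_def H.coord(2)[OF x(1)])
    moreover have "prestrict I (T s (H.coord x)) = 0"
      by (rule prestrict_T[OF gen H.coord(1)[OF x(1)]]) (use x(2) in \<open>simp add: proj_def\<close>)
    ultimately show "proj (hecke_gen W S s \<odot>\<^bsub>M\<^esub> x) = 0" by (simp add: proj_def act_def)
  qed
next
  case (add g h)
  then show ?case by (simp add: H.smult_l_distr proj_add H.smult_closed)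
next
  case (mult g h)
  then show ?case by (simp add: H.smult_assoc H.smult_closed)
qed

text \<open>\<open>x\<close> and the lift of \<open>proj x\<close> differ by an element of the
  kernel, which \<open>h\<close> preserves. Associativity of the action on \<open>Mq\<close> rests
  on this.\<close>

lemma proj_hecke:
  assumes h: "h \<in> carrier (hecke W S)" and x: "x \<in> carrier M"
  shows "proj (h \<odot>\<^bsub>M\<^esub> x) = h \<odot>\<^bsub>Mq\<^esub> proj x"
proof -
  have l: "H.lift (proj x) \<in> carrier M" by (rule lift_closed_I[OF proj_closed])
  let ?y = "x \<ominus>\<^bsub>M\<^esub> H.lift (proj x)"
  have y: "?y \<in> carrier M" using x l by simp
  have "proj ?y = 0" using x l by (simp add: proj_minus proj_lift_I proj_closed)
  then have y0: "proj (h \<odot>\<^bsub>M\<^esub> ?y) = 0" using proj_hecke_zero[OF h] y by blast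
  have "?y \<oplus>\<^bsub>M\<^esub> H.lift (proj x) = x"
    unfolding H.M.minus_eq using x l by (subst H.M.a_assoc) (simp_all add: H.M.l_neg)
  then have "h \<odot>\<^bsub>M\<^esub> x = h \<odot>\<^bsub>M\<^esub> ?y \<oplus>\<^bsub>M\<^esub> h \<odot>\<^bsub>M\<^esub> H.lift (proj x)"
    using H.smult_r_distr[OF h y l] by simp
  then show ?thesis
    using y0 H.smult_closed[OF h y] H.smult_closed[OF h l] by (simp add: proj_add)
qed

lemma left_module_Mq: "left_module (hecke W S) Mq"
proof (intro left_module.intro left_module_axioms.intro hecke_ring)
  show "abelian_group Mq"
  proof (rule abelian_groupI)
    fix x assume "x \<in> carrier Mq"
    then show "\<exists>y\<in>carrier Mq. y \<oplus>\<^bsub>Mq\<^esub> x = \<zero>\<^bsub>Mq\<^esub>"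
      by (intro bexI[of _ "- x"]) auto
  qed (use keys_add in \<open>fastforce simp: add_ac\<close>)+
  show "\<one>\<^bsub>hecke W S\<^esub> \<odot>\<^bsub>Mq\<^esub> x = x" if "x \<in> carrier Mq" for x
    using that by (simp add: H.smult_one proj_lift_I lift_closed_I)
  fix a x assume a: "a \<in> carrier (hecke W S)" and x: "x \<in> carrier Mq"
  then have lx: "H.lift x \<in> carrier M" by (simp add: lift_closed_I)
  show "a \<odot>\<^bsub>Mq\<^esub> x \<in> carrier Mq" by (simp add: proj_closed)
  {
    fix d assume d: "d \<in> carrier (hecke W S)"
    show "(a \<oplus>\<^bsub>hecke W S\<^esub> d) \<odot>\<^bsub>Mq\<^esub> x = a \<odot>\<^bsub>Mq\<^esub> x \<oplus>\<^bsub>Mq\<^esub> d \<odot>\<^bsub>Mq\<^esub> x"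
      using a d lx by (simp add: H.smult_l_distr proj_add H.smult_closed)
    show "(a \<otimes>\<^bsub>hecke W S\<^esub> d) \<odot>\<^bsub>Mq\<^esub> x = a \<odot>\<^bsub>Mq\<^esub> (d \<odot>\<^bsub>Mq\<^esub> x)"
      using proj_hecke[OF a H.smult_closed[OF d lx]] a d lx by (simp add: H.smult_assoc)
  next
    fix y assume y: "y \<in> carrier Mq"
    then have ly: "H.lift y \<in> carrier M" by (simp add: lift_closed_I)
    show "a \<odot>\<^bsub>Mq\<^esub> (x \<oplus>\<^bsub>Mq\<^esub> y) = a \<odot>\<^bsub>Mq\<^esub> x \<oplus>\<^bsub>Mq\<^esub> a \<odot>\<^bsub>Mq\<^esub> y"
      using a x y lx ly by (simp add: H.lift_add keys_I_sub H.smult_r_distr proj_add H.smult_closed)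
  }
qed

sublocale N: hecke_module W S Mq
  by (rule hecke_module.intro[OF left_module_Mq])

lemma finsum_Mq:
  assumes "finite A" "\<And>i. i \<in> A \<Longrightarrow> Poly_Mapping.keys (g i) \<subseteq> I"
  shows "finsum Mq g A = sum g A"
  using assms
proof (induction A)
  case (insert i A)
  have "finsum Mq g (insert i A) = g i \<oplus>\<^bsub>Mq\<^esub> finsum Mq g A"
    by (rule N.M.finsum_insert) (use insert in auto)
  then show ?case using insert by simp
qed simp

lemma scal_Mq: "Poly_Mapping.keys f \<subseteq> I \<Longrightarrow> scal W S Mq a f = smul a f"
  using proj_scal[of "H.lift f" a] by (simp add: scal_def lift_closed_I proj_lift_I)

lemma lin_comb_Mq:
  assumes "\<And>k. k \<in> Poly_Mapping.keys f \<Longrightarrow> Poly_Mapping.keys (d k) \<subseteq> I"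
  shows "lin_comb W S Mq d f = comb d f"
proof -
  have "lin_comb W S Mq d f = (\<Sum>k\<in>Poly_Mapping.keys f. scal W S Mq (Poly_Mapping.lookup f k) (d k))"
    unfolding lin_comb_def
  proof (rule finsum_Mq)
    fix k assume "k \<in> Poly_Mapping.keys f"
    then show "Poly_Mapping.keys (scal W S Mq (Poly_Mapping.lookup f k) (d k)) \<subseteq> I"
      using assms[of k] keys_smul[of "Poly_Mapping.lookup f k" "d k"] by (auto simp: scal_Mq)
  qed simp
  then show ?thesis unfolding comb_def using assms by (simp add: scal_Mq)
qed

lemma act_Mq_b:
  assumes "w \<in> I" "s \<in> S"
  shows "act W S Mq s (bcoord Qq w) = proj (act W S M s (b w))"
  using proj_hecke[OF hecke_gen_closed[OF assms(2)] b_closed[of w]] assms I_sub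
  by (auto simp: act_def proj_b_I)

lemma Qq_keys: "w \<in> I0 \<Longrightarrow> Poly_Mapping.keys (Qq w) \<subseteq> {y \<in> I. bruhat_less W S y w}"
  using Q_keys[of w] I_sub by (auto simp: Qq_def keys_prestrict)

lemma Qq_pos: "w \<in> I0 \<Longrightarrow> Poly_Mapping.lookup (Qq w) y \<in> laurent_pos"
  using Q_pos[of w y] I_sub by (auto simp: Qq_def laurent_pos_closed)

lemma Qq_keys_I: "w \<in> I \<Longrightarrow> Poly_Mapping.keys (Qq w) \<subseteq> {y \<in> I. bruhat_less W S y w}"
  and Qq_pos_I: "w \<in> I \<Longrightarrow> Poly_Mapping.lookup (Qq w) y \<in> laurent_pos"
  using Qq_keys Qq_pos I_sub by blast+

lemma keys_bcoord_Qq: "w \<in> I \<Longrightarrow> Poly_Mapping.keys (bcoord Qq w) \<subseteq> {y \<in> I. y = w \<or> bruhat_less W S y w}"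
  using Qq_keys_I[of w] by (auto simp: in_keys_iff lookup_bcoord split: if_splits)

lemma keys_bcoord_Qq_I: "w \<in> I \<Longrightarrow> Poly_Mapping.keys (bcoord Qq w) \<subseteq> I"
  using keys_bcoord_Qq by blast

lemma is_basis_Mq: "is_basis W S Mq I (bcoord Qq)"
  unfolding is_basis_def
proof (intro conjI ballI allI impI)
  show "bcoord Qq ` I \<subseteq> carrier Mq" using keys_bcoord_Qq_I by auto
  have lc: "lin_comb W S Mq (bcoord Qq) f = comb (bcoord Qq) f" if "Poly_Mapping.keys f \<subseteq> I" for f
    by (rule lin_comb_Mq) (use that keys_bcoord_Qq_I in blast)
  show "\<exists>g. Poly_Mapping.keys g \<subseteq> I \<and> lin_comb W S Mq (bcoord Qq) g = f" if f: "f \<in> carrier Mq" for f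
  proof -
    have fI: "Poly_Mapping.keys f \<subseteq> I" using f by simp
    obtain g where g: "comb (bcoord Qq) g = f"
      "Poly_Mapping.keys g \<subseteq> {y \<in> I. \<exists>k\<in>Poly_Mapping.keys f. y = k \<or> bruhat_less W S y k}"
      using B.ex_comb_bcoord[of Qq f, OF Qq_keys_I Qq_pos_I fI] by blast
    then have "Poly_Mapping.keys g \<subseteq> I" by blast
    then show ?thesis using g lc by blast
  qed
  show "f = 0" if "Poly_Mapping.keys f \<subseteq> I \<and> lin_comb W S Mq (bcoord Qq) f = \<zero>\<^bsub>Mq\<^esub>" for f
    using B.comb_bcoord_inj[of Qq f, OF Qq_keys_I Qq_pos_I] that lc[of f] by simp
qed

text \<open>Supplies the coefficients r of a weak ascent: it suffices to bound coordinates in the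
  standard basis, since the unitriangular change of basis preserves the Bruhat bound and
  divisibility by q.\<close>

lemma ex_bcoord_below:
  assumes "Poly_Mapping.keys f \<subseteq> {y \<in> I. bruhat_less W S y v}"
    and "\<And>y. Poly_Mapping.lookup f y \<in> laurent_qpos"
  shows "\<exists>r. Poly_Mapping.keys r \<subseteq> {y \<in> I. bruhat_less W S y v} \<and>
    (\<forall>y. Poly_Mapping.lookup r y \<in> (*) q_var ` laurent_pos) \<and> f = lin_comb W S Mq (bcoord Qq) r"
proof -
  have fI: "Poly_Mapping.keys f \<subseteq> I" using assms(1) by blast
  obtain g where g: "comb (bcoord Qq) g = f"
    "Poly_Mapping.keys g \<subseteq> {y \<in> I. \<exists>k\<in>Poly_Mapping.keys f. y = k \<or> bruhat_less W S y k}"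
    "(\<forall>k. Poly_Mapping.lookup f k \<in> laurent_qpos) \<longrightarrow> (\<forall>k. Poly_Mapping.lookup g k \<in> laurent_qpos)"
    by (rule B.ex_comb_bcoord[of Qq f, OF Qq_keys_I Qq_pos_I fI])
  have "Poly_Mapping.keys g \<subseteq> {y \<in> I. bruhat_less W S y v}"
    using g(2) assms(1) bruhat_less_trans by blast
  moreover have "lin_comb W S Mq (bcoord Qq) g = f"
    unfolding g(1)[symmetric] by (rule lin_comb_Mq) (use g(2) keys_bcoord_Qq_I in blast)
  ultimately show ?thesis using g(3) assms(2) unfolding laurent_qpos_def by blast
qed

lemma minus_Mq:
  assumes "Poly_Mapping.keys f \<subseteq> I" "Poly_Mapping.keys g \<subseteq> I"
  shows "f \<ominus>\<^bsub>Mq\<^esub> g = f - g"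
proof -
  have "Poly_Mapping.keys (f - g) \<subseteq> I" using keys_minus_subset[of f g] assms by blast
  then show ?thesis using N.M.a_minus_eqI[of "f - g" g f] assms by simp
qed

section \<open>The axioms of a W-graph ideal in the quotient\<close>

lemma ideal_module_Mq: "ideal_module W S J I Mq (bcoord Qq)"
  unfolding ideal_module_def
proof (intro conjI ballI left_module_Mq is_basis_Mq)
  fix w s assume w: "w \<in> I"
  then have w0: "w \<in> I0" using I_sub by blast
  note bw = b_closed[OF w0]
  have act0: "(\<forall>s\<in>SA W S I0 w. act W S M s (b w) = b (s \<otimes> w))"
       "(\<forall>s\<in>SD W S w. act W S M s (b w) = b (s \<otimes> w) \<oplus>\<^bsub>M\<^esub> scal W S M (q_var - q_inv) (b w))"
       "(\<forall>s\<in>WD W S J w. act W S M s (b w) = scal W S M (- q_inv) (b w))"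
       "(\<forall>s\<in>WA W S J I0 w. \<exists>r :: 'w \<Rightarrow>\<^sub>0 laurent.
          Poly_Mapping.keys r \<subseteq> {y \<in> I0. bruhat_less W S y (s \<otimes> w)} \<and>
          (\<forall>y. Poly_Mapping.lookup r y \<in> (*) q_var ` laurent_pos) \<and>
          act W S M s (b w) = scal W S M q_var (b w) \<ominus>\<^bsub>M\<^esub> lin_comb W S M b r)"
    using ideal_module w0 unfolding ideal_module_def by blast+
  {
    assume s: "s \<in> SA W S I w"
    then have "s \<in> S" "s \<otimes> w \<in> I" "s \<in> SA W S I0 w" using I_sub by (auto simp: SA_def)
    then show "act W S Mq s (bcoord Qq w) = bcoord Qq (s \<otimes> w)"
      using act0(1) w by (simp add: act_Mq_b proj_b_I)
  next
    assume s: "s \<in> SD W S w"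
    note v = B.SD_lower[OF w s]
    have v0: "s \<otimes> w \<in> I0" using v(2) I_sub by blast
    show "act W S Mq s (bcoord Qq w) = bcoord Qq (s \<otimes> w) \<oplus>\<^bsub>Mq\<^esub> scal W S Mq (q_var - q_inv) (bcoord Qq w)"
      using act0(2) s w v(1,2) bw b_closed[OF v0]
      by (simp add: act_Mq_b proj_add H.scal_closed proj_scal proj_b_I scal_Mq keys_bcoord_Qq_I)
  next
    assume s: "s \<in> WD W S J w"
    then have "s \<in> S" by (simp add: WD_def)
    then show "act W S Mq s (bcoord Qq w) = scal W S Mq (- q_inv) (bcoord Qq w)"
      using act0(3) s w bw by (simp add: act_Mq_b proj_scal proj_b_I scal_Mq keys_bcoord_Qq_I)
  next
    assume s: "s \<in> WA W S J I w"
    then have sS: "s \<in> S" and sw: "bruhat_less W S w (s \<otimes> w)" "s \<otimes> w \<in> D_set W S J" "s \<otimes> w \<notin> I"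
      by (auto simp: WA_def)
    \<comment> \<open>The vector q b_w - T_s b_w in the quotient, which has to be the sum of the r
      b_y. Outside \<open>I\<close>, s w may still be in \<open>I0\<close>, where s is a strong
      ascent, or not, where s is a weak ascent for \<open>I0\<close> too.\<close>
    let ?f = "smul q_var (bcoord Qq w) - proj (act W S M s (b w))"
    have f: "Poly_Mapping.keys ?f \<subseteq> {y \<in> I. bruhat_less W S y (s \<otimes> w)} \<and>
      (\<forall>y. Poly_Mapping.lookup ?f y \<in> laurent_qpos)"
    proof (cases "s \<otimes> w \<in> I0")
      case True
      then have "act W S M s (b w) = b (s \<otimes> w)"
        using act0(1) sS sw(1) by (simp add: SA_def)
      \<comment> \<open>The leading term of b_sw sits at s w, outside \<open>I\<close>, and is cut
        off.\<close>
      moreover have "proj (b (s \<otimes> w)) = smul q_var (Qq (s \<otimes> w))"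
        using True sw(3) by (intro poly_mapping_eqI) (auto simp: proj_b lookup_bcoord Qq_def)
      ultimately have eq: "?f = smul q_var (bcoord Qq w - Qq (s \<otimes> w))" by (simp add: smul_distribs)
      have "Poly_Mapping.keys ?f \<subseteq> Poly_Mapping.keys (bcoord Qq w) \<union> Poly_Mapping.keys (Qq (s \<otimes> w))"
        unfolding eq using keys_smul[of q_var "bcoord Qq w - Qq (s \<otimes> w)"]
          keys_minus_subset[of "bcoord Qq w" "Qq (s \<otimes> w)"] by blast
      then have "Poly_Mapping.keys ?f \<subseteq> {y \<in> I. bruhat_less W S y (s \<otimes> w)}"
        using keys_bcoord_Qq[OF w] Qq_keys[OF True] sw(1) bruhat_less_trans by blast
      moreover have "Poly_Mapping.lookup (bcoord Qq w) y \<in> laurent_pos" for y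
        using Qq_pos[OF w0] by (auto simp: lookup_bcoord intro!: laurent_pos_closed(1-6))
      then have "Poly_Mapping.lookup ?f y \<in> laurent_qpos" for y
        unfolding eq using Qq_pos[OF True] by (auto simp: lookup_minus intro!: laurent_qpos_closed(2) laurent_pos_minus)
      ultimately show ?thesis by blast
    next
      case False
      then have "s \<in> WA W S J I0 w" using sS sw by (simp add: WA_def)
      then obtain r where r: "Poly_Mapping.keys r \<subseteq> {y \<in> I0. bruhat_less W S y (s \<otimes> w)}"
          "\<forall>y. Poly_Mapping.lookup r y \<in> (*) q_var ` laurent_pos"
          "act W S M s (b w) = scal W S M q_var (b w) \<ominus>\<^bsub>M\<^esub> lin_comb W S M b r"
        using act0(4) by blast
      have rI: "Poly_Mapping.keys r \<subseteq> I0" using r(1) by blast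
      have lr: "lin_comb W S M b r = H.lift (comb (bcoord Q) r)"
        by (rule H.lin_comb_comb[OF H.c_closed rI]) (simp add: keys_bcoord_I b_lift)
      have k: "z \<in> I0 \<and> bruhat_less W S z (s \<otimes> w)" if z: "z \<in> Poly_Mapping.keys (comb (bcoord Q) r)" for z
      proof -
        obtain y where y: "y \<in> Poly_Mapping.keys r" "z \<in> Poly_Mapping.keys (bcoord Q y)"
          using z by (rule keys_comb)
        then have "y \<in> I0" "bruhat_less W S y (s \<otimes> w)" using r(1) by auto
        then show ?thesis using y(2) keys_bcoord[of y] bruhat_less_trans by blast
      qed
      then have kI: "Poly_Mapping.keys (comb (bcoord Q) r) \<subseteq> I0" by blast
      have eq: "?f = prestrict I (comb (bcoord Q) r)"
        unfolding r(3) lr using bw w H.lift_closed[OF kI] kI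
        by (simp add: proj_minus H.scal_closed proj_scal proj_b_I proj_lift)
      have "Poly_Mapping.lookup (comb (bcoord Q) r) y \<in> laurent_qpos" for y
        unfolding lookup_comb using r(2) rI K.bcoord_pos
        by (intro sum_laurent_qpos laurent_qpos_closed(6)) (auto simp: laurent_qpos_def)
      then show ?thesis unfolding eq using k by (auto simp: keys_prestrict laurent_qpos_closed)
    qed
    then obtain r where r: "Poly_Mapping.keys r \<subseteq> {y \<in> I. bruhat_less W S y (s \<otimes> w)}"
        "\<forall>y. Poly_Mapping.lookup r y \<in> (*) q_var ` laurent_pos" "?f = lin_comb W S Mq (bcoord Qq) r"
      using ex_bcoord_below by blast
    have "Poly_Mapping.keys (smul q_var (bcoord Qq w)) \<subseteq> I"
      using keys_smul[of q_var "bcoord Qq w"] keys_bcoord_Qq_I[OF w] by blast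
    moreover have "Poly_Mapping.keys ?f \<subseteq> I" using f by blast
    ultimately have "act W S Mq s (bcoord Qq w) =
        scal W S Mq q_var (bcoord Qq w) \<ominus>\<^bsub>Mq\<^esub> lin_comb W S Mq (bcoord Qq) r"
      unfolding r(3)[symmetric] using w sS
      by (simp add: act_Mq_b scal_Mq keys_bcoord_Qq_I minus_Mq)
    then show "\<exists>r. Poly_Mapping.keys r \<subseteq> {y \<in> I. bruhat_less W S y (s \<otimes> w)} \<and>
          (\<forall>y. Poly_Mapping.lookup r y \<in> (*) q_var ` laurent_pos) \<and>
          act W S Mq s (bcoord Qq w) = scal W S Mq q_var (bcoord Qq w) \<ominus>\<^bsub>Mq\<^esub> lin_comb W S Mq (bcoord Qq) r"
      using r by blast
  }
qed

lemma proj_\<iota>: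
  assumes "x \<in> carrier M"
  shows "proj (\<iota> x) = vbar (proj x)"
proof -
  note c = H.coord[OF assms]
  have v: "Poly_Mapping.keys (vbar (H.coord x)) \<subseteq> I0" using c(1) keys_vbar[of "H.coord x"] by blast
  have "\<iota> x = H.lift (vbar (H.coord x))" using \<iota>_lift[OF c(1)] c(2) by simp
  then show ?thesis using v by (simp add: proj_lift) (simp add: proj_def prestrict_simps)
qed

lemma ideal_involution_Mq: "ideal_involution W S I Mq (bcoord Qq) vbar"
  unfolding ideal_involution_def
proof (intro conjI ballI allI impI)
  show "vbar \<in> carrier Mq \<rightarrow> carrier Mq" using keys_vbar by fastforce
  show "vbar (scal W S Mq a x) = scal W S Mq (laurent_bar a) (vbar x)" if "x \<in> carrier Mq" for a x
    using that keys_vbar[of x] by (simp add: scal_Mq subset_trans)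
  show "vbar (bcoord Qq \<one>) = bcoord Qq \<one>" if "\<one> \<in> I"
    using proj_\<iota>[OF b_closed, of \<one>] \<iota>_b_one that I_sub by (auto simp: proj_b_I)
  show "vbar (h \<odot>\<^bsub>Mq\<^esub> x) = hecke_bar W S h \<odot>\<^bsub>Mq\<^esub> vbar x" if h: "h \<in> carrier (hecke W S)" and x: "x \<in> carrier Mq" for h x
  proof -
    have xI: "Poly_Mapping.keys x \<subseteq> I" using x by simp
    note lx = lift_closed_I[OF xI]
    show ?thesis
      using proj_\<iota>[OF H.smult_closed[OF h lx]] \<iota>_hecke[OF h lx] \<iota>_lift[OF keys_I_sub[OF xI]] by simp
  qed
qed simp_all

lemma W_graph_basis_Mq: "W_graph_basis W S I Mq (bcoord Qq) vbar (\<lambda>w. Poly_Mapping.single w 1) Qq"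
proof -
  have lc: "lin_comb W S Mq (\<lambda>w. Poly_Mapping.single w 1) f = f" if "Poly_Mapping.keys f \<subseteq> I" for f
    using that by (subst lin_comb_Mq) (auto simp: comb_basis)
  have "is_basis W S Mq I (\<lambda>w. Poly_Mapping.single w 1)"
    unfolding is_basis_def using lc by auto
  moreover have "bcoord Qq w = Poly_Mapping.single w 1 \<oplus>\<^bsub>Mq\<^esub>
      scal W S Mq q_var (lin_comb W S Mq (\<lambda>w. Poly_Mapping.single w 1) (Qq w))" if "w \<in> I" for w
  proof -
    have "Poly_Mapping.keys (Qq w) \<subseteq> I" using Qq_keys_I[OF that] by blast
    then show ?thesis by (simp add: lc scal_Mq bcoord_def)
  qed
  ultimately show ?thesis
    unfolding W_graph_basis_def using Qq_keys_I Qq_pos_I by simp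
qed

lemma W_graph_ideal_I: "W_graph_ideal W S J I"
  unfolding W_graph_ideal_def
  using weak_ideal_I B.J_Pos ideal_module_Mq ideal_involution_Mq by blast

lemma ex_corresponding_W_graph:
  "\<exists>\<Gamma> :: ('w \<Rightarrow>\<^sub>0 laurent, 'w) W_graph. corresponding_W_graph W S J I \<Gamma>"
  unfolding corresponding_W_graph_def
  using ideal_module_Mq ideal_involution_Mq W_graph_basis_Mq by blast

text \<open>The module behind \<Gamma> is arbitrary, so it is compared with \<open>Mq\<close>
  through the polynomials only; the vertices are then matched by their index in
  \<open>I\<close>.\<close>

lemma corresponding_W_graph_iso:
  fixes \<Gamma> :: "('n, 'w) W_graph"
  assumes "corresponding_W_graph W S J I \<Gamma>"
  shows "W_graph_iso \<Gamma> (full_subgraph (basis_graph W S J I0 c Q) (c ` I))"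
proof -
  obtain M' :: "('w hecke_elt, 'n) module" and b' \<iota>' c' Q' where M': "ideal_module W S J I M' b'"
      "ideal_involution W S I M' b' \<iota>'" "W_graph_basis W S I M' b' \<iota>' c' Q'"
    and \<Gamma>: "\<Gamma> = basis_graph W S J I c' Q'"
    using assms unfolding corresponding_W_graph_def by blast
  interpret M': ideal_basis W S J I M' c' b' \<iota>' Q'
    using M' by (intro ideal_basisI B.coxeter_ideal_axioms)
  interpret Mq: ideal_basis W S J I Mq "\<lambda>w. Poly_Mapping.single w 1" "bcoord Qq" vbar Qq
    by (intro ideal_basisI B.coxeter_ideal_axioms ideal_module_Mq ideal_involution_Mq W_graph_basis_Mq)
  have Q': "Q' w = Qq w" if "w \<in> I" for w
    by (rule W_graph_coords_unique[OF M'.W_graph_coords Mq.W_graph_coords that])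
  \<comment> \<open>Restriction to \<open>I\<close> does not change the entry at an index y in
    \<open>I\<close>.\<close>
  have mu: "mu_coeff Q' y w = mu_coeff Q y w" if "y \<in> I" "w \<in> I" for y w
    using that by (simp add: mu_coeff_def Q' Qq_def)
  have inv: "inv_into I0 c (c w) = w" "inv_into I c' (c' w) = w" if "w \<in> I" for w
    using that H.c_inj M'.H.c_inj I_sub by auto
  have bij: "bij_betw (c \<circ> inv_into I c') (c' ` I) (c ` I)"
    using bij_betw_trans[OF bij_betw_inv_into[OF inj_on_imp_bij_betw[OF M'.H.c_inj]]
        inj_on_imp_bij_betw[OF inj_on_subset[OF H.c_inj I_sub]]] .
  show ?thesis
    unfolding W_graph_iso_def \<Gamma>
  proof (intro exI[of _ "c \<circ> inv_into I c'"] conjI ballI)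
    show "bij_betw (c \<circ> inv_into I c') (verts (basis_graph W S J I c' Q'))
        (verts (full_subgraph (basis_graph W S J I0 c Q) (c ` I)))"
      using bij by (simp add: basis_graph_def full_subgraph_def)
  \<comment> \<open>For \<open>tau\<close>, \<open>descents\<close> depends on \<open>J\<close> and
    the element but not on the ideal, so equal indices have equal descent sets.\<close>
  qed (auto simp: basis_graph_def full_subgraph_def inv mu)
qed

end

theorem theorem4p4:
  fixes W :: "('w, 'g) monoid_scheme" and S J I0 I :: "'w set"
    and M0 :: "('w hecke_elt, 'm) module"
    and b0 c0 :: "'w \<Rightarrow> 'm" and \<iota>0 :: "'m \<Rightarrow> 'm"
    and Q0 :: "'w \<Rightarrow> 'w \<Rightarrow>\<^sub>0 laurent"
    and \<Gamma>0 :: "('m, 'w) W_graph"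
  assumes "coxeter_system W S"
    and "J \<subseteq> Pos W S I0"
    and "W_graph_ideal W S J I0"
    and "ideal_module W S J I0 M0 b0" and "ideal_involution W S I0 M0 b0 \<iota>0"
    and "W_graph_basis W S I0 M0 b0 \<iota>0 c0 Q0"
    and "\<Gamma>0 = basis_graph W S J I0 c0 Q0"
    and "weak_ideal W S I" and "I \<subseteq> I0"
    and "W_graph_closed W S \<Gamma>0 (c0 ` (I0 - I))"
  shows "W_graph_ideal W S J I \<and>
    (\<exists>\<Gamma> :: ('w \<Rightarrow>\<^sub>0 laurent, 'w) W_graph. corresponding_W_graph W S J I \<Gamma>) \<and>
    (\<forall>\<Gamma> :: ('n, 'w) W_graph. corresponding_W_graph W S J I \<Gamma> \<longrightarrow>
       W_graph_iso \<Gamma> (full_subgraph \<Gamma>0 (c0 ` I)))"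
proof -
  have "coxeter_ideal W S J I0"
    using assms(1-3) by (simp add: coxeter_ideal_def coxeter_ideal_axioms_def W_graph_ideal_def)
  then have "ideal_basis W S J I0 M0 c0 b0 \<iota>0 Q0"
    using assms(4-6) by (rule ideal_basisI)
  then interpret W_graph_quotient W S J I0 M0 c0 b0 \<iota>0 Q0 I
    using assms(7-10) by (simp add: W_graph_quotient_def W_graph_quotient_axioms_def)
  show ?thesis
    using W_graph_ideal_I ex_corresponding_W_graph corresponding_W_graph_iso assms(7) by blast
qed

end
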